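(* Let $R$ be an ordinary standard differential ring that is a Jaffard ring. Then $R$ is a J-ring.
   Context: All rings are commutative with identity. A ring $R$ is a Jaffard ring if it has finite Krull dimension and $\dim R[x_1,\dots,x_n]=\dim R+n$ for all $n$ (ordinary polynomial rings, Krull dimension). A differential ring is a ring with finitely many pairwise commuting derivations; it is ordinary if it has exactly one distinguished derivation. An ideal is differential if it is stable under the derivations; $\operatorname{Spec}^{\Delta}R$ is the set of differential prime ideals of $R$, assumed nonempty. $R\{z_1,\dots,z_n\}$ is the ring of differential polynomials in $n$ differential indeterminates over $R$. $R$ is standard if for every differential prime $\mathfrak p$ of $R$ the residue field $R_{\mathfrak p}/\mathfrak pR_{\mathfrak p}$ has characteristic zero. Gap measure: for $X\subseteq\operatorname{Spec}^{\Delta}R$ there is a unique function $\mu$ with values in $\mathbb Z\cup\{\infty\}$ on pairs $(\mathfrak p,\mathfrak p')$ of elements of $X$ with $\mathfrak p\supseteq\mathfrak p'$ such that: (1) $\mu(\mathfrak p,\mathfrak p')\ge 0$; (2) $\mu(\mathfrak p,\mathfrak p')=0$ iff $\mathfrak p=\mathfrak p'$ or there is no infinite strictly descending chain $\mathfrak p=\mathfrak p_0\supsetneq\mathfrak p_1\supsetneq\cdots\supseteq\mathfrak p'$ in $X$; (3) for an integer $d>0$, $\mu(\mathfrak p,\mathfrak p')\ge d$ iff $\mathfrak p\ne\mathfrak p'$ and there is an infinite strictly descending sequence $\mathfrak p=\mathfrak p_0\supsetneq\mathfrak p_1\supsetneq\cdots\supseteq\mathfrak p'$ in $X$ (all terms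 containing $\mathfrak p'$) with $\mu(\mathfrak p_{i-1},\mathfrak p_i)\ge d-1$ for all $i\ge 1$. The differential type $\operatorname{type}^{\Delta}R$ is the supremum of all $\mu(\mathfrak p,\mathfrak p')$ with $\mathfrak p\supseteq\mathfrak p'$ in $X=\operatorname{Spec}^{\Delta}R$. The differential dimension $\dim^{\Delta}R$ is the supremum of the integers $k\ge 0$ such that there is a chain $\mathfrak p_0\supsetneq\cdots\supsetneq\mathfrak p_k$ in $\operatorname{Spec}^{\Delta}R$ with $\mu(\mathfrak p_{i-1},\mathfrak p_i)=\operatorname{type}^{\Delta}R$ for $i=1,\dots,k$. J-ring: a differential ring $R$ with $m$ derivations and finite differential type $t$ is a J-ring if for every $n>0$ one has $\operatorname{type}^{\Delta}R\{z_1,\dots,z_n\}=\max(t,m)$ and: (i) $\dim^{\Delta}R\{z_1,\dots,z_n\}=n$ if $t<m$; (ii) $\dim^{\Delta}R<\infty$ and $\dim^{\Delta}R\{z_1,\dots,z_n\}=n+\dim^{\Delta}R$ if $t=m$; (iii) $\dim^{\Delta}R<\infty$ and $\dim^{\Delta}R\{z_1,\dots,z_n\}=\dim^{\Delta}R$ if $t>m$. (Here $m=1$.) *)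

theory Defs
  imports
    "HOL-Library.Extended_Nat"
    "HOL-Library.Poly_Mapping"
    "HOL-Algebra.Algebraic_Closure_Type"
begin

section \<open>Polynomial rings and Jaffard rings\<close>

text \<open>
  The ground ring is a type of class \<open>comm_ring_1\<close>; as an object it is the library's
  \<open>ring_of_type_algebra\<close>. Polynomials over it in variables from \<open>'v\<close> are the elements of
  \<open>('v \<Rightarrow>\<^sub>0 nat) \<Rightarrow>\<^sub>0 'a\<close> (finitely supported coefficient functions on exponent vectors). The number
  of variables is a number and not a type, so a polynomial ring is a subring of this type.
\<close>

definition poly_ring_in :: "'v set \<Rightarrow> (('v \<Rightarrow>\<^sub>0 nat) \<Rightarrow>\<^sub>0 'a::comm_ring_1) ring" where
  "poly_ring_in V = ring_of_type_algebra
     \<lparr>carrier := {p. \<forall>m\<in>Poly_Mapping.keys p. Poly_Mapping.keys m \<subseteq> V}\<rparr>"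

definition poly_ring :: "nat \<Rightarrow> ((nat \<Rightarrow>\<^sub>0 nat) \<Rightarrow>\<^sub>0 'a::comm_ring_1) ring" where
  "poly_ring n = poly_ring_in {..<n}"

definition krull_dim :: "('a, 'b) ring_scheme \<Rightarrow> enat" where
  "krull_dim R = Sup {enat k | k. \<exists>p :: nat \<Rightarrow> 'a set.
     (\<forall>i\<le>k. primeideal (p i) R) \<and> (\<forall>i<k. p (Suc i) \<subset> p i)}"

definition jaffard :: "'a::comm_ring_1 itself \<Rightarrow> bool" where
  "jaffard _ \<longleftrightarrow>
     krull_dim (ring_of_type_algebra :: 'a ring) < \<infinity> \<and>
     (\<forall>n. krull_dim (poly_ring n :: ((nat \<Rightarrow>\<^sub>0 nat) \<Rightarrow>\<^sub>0 'a) ring) =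
          krull_dim (ring_of_type_algebra :: 'a ring) + enat n)"


section \<open>Ordinary differential rings\<close>

definition derivation :: "('a, 'b) ring_scheme \<Rightarrow> ('a \<Rightarrow> 'a) \<Rightarrow> bool" where
  "derivation R \<delta> \<longleftrightarrow> \<delta> \<in> carrier R \<rightarrow> carrier R \<and>
     (\<forall>x\<in>carrier R. \<forall>y\<in>carrier R.
        \<delta> (x \<oplus>\<^bsub>R\<^esub> y) = \<delta> x \<oplus>\<^bsub>R\<^esub> \<delta> y \<and>
        \<delta> (x \<otimes>\<^bsub>R\<^esub> y) = \<delta> x \<otimes>\<^bsub>R\<^esub> y \<oplus>\<^bsub>R\<^esub> x \<otimes>\<^bsub>R\<^esub> \<delta> y)"

definition diff_spec :: "('a, 'b) ring_scheme \<Rightarrow> ('a \<Rightarrow> 'a) \<Rightarrow> 'a set set" where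
  "diff_spec R \<delta> = {P. primeideal P R \<and> (\<forall>x\<in>P. \<delta> x \<in> P)}"

text \<open>
  The variable \<open>(i, k)\<close> stands for the \<open>k\<close>-th derivative of the differential indeterminate \<open>z\<^sub>i\<close>.
\<close>

definition diff_poly_ring :: "nat \<Rightarrow> ((nat \<times> nat \<Rightarrow>\<^sub>0 nat) \<Rightarrow>\<^sub>0 'a::comm_ring_1) ring" where
  "diff_poly_ring n = poly_ring_in ({..<n} \<times> UNIV)"

text \<open>
  The extension of \<open>\<delta>\<close> sending the variable \<open>(i, k)\<close> to \<open>(i, k + 1)\<close>: on a term \<open>c * m\<close> with
  exponent vector \<open>m\<close> it is \<open>\<delta> c * m + (\<Sum>v. c * m\<^sub>v * (m / v) * v')\<close>.
\<close>

definition diff_poly_deriv ::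
  "('a \<Rightarrow> 'a::comm_ring_1) \<Rightarrow> ((nat \<times> nat \<Rightarrow>\<^sub>0 nat) \<Rightarrow>\<^sub>0 'a) \<Rightarrow> ((nat \<times> nat \<Rightarrow>\<^sub>0 nat) \<Rightarrow>\<^sub>0 'a)" where
  "diff_poly_deriv \<delta> p =
     (\<Sum>m\<in>Poly_Mapping.keys p.
        Poly_Mapping.single m (\<delta> (Poly_Mapping.lookup p m)) +
        (\<Sum>(i, k)\<in>Poly_Mapping.keys m.
           Poly_Mapping.single
             (m - Poly_Mapping.single (i, k) 1 + Poly_Mapping.single (i, Suc k) 1)
             (of_nat (Poly_Mapping.lookup m (i, k)) * Poly_Mapping.lookup p m)))"

text \<open>
  It is additive (\<open>diff_poly_deriv_add\<close>), satisfies the Leibniz rule (\<open>diff_poly_deriv_mult\<close>) and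
  has the prescribed values on constants and variables.
\<close>

context fixes \<delta> :: "'a::comm_ring_1 \<Rightarrow> 'a"
  assumes add: "\<And>x y. \<delta> (x+y) = \<delta> x + \<delta> y" and mult: "\<And>x y. \<delta> (x*y) = \<delta> x * y + x * \<delta> y"
begin

definition diff_poly_term where "diff_poly_term m c = Poly_Mapping.single m (\<delta> c) +
        (\<Sum>(i, k)\<in>Poly_Mapping.keys m.
           Poly_Mapping.single
             (m - Poly_Mapping.single (i::nat, k) 1 + Poly_Mapping.single (i, Suc k) 1)
             (of_nat (Poly_Mapping.lookup m (i, k)) * c))"

lemma additive_0: "\<delta> 0 = 0" using add[of 0 0] by simp
lemma leibniz_1: "\<delta> 1 = 0" using mult[of 1 1] by simp
lemma diff_poly_term_0: "diff_poly_term m 0 = 0" by (simp add: diff_poly_term_def additive_0 case_prod_unfold)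
lemma diff_poly_term_add: "diff_poly_term m (a+b) = diff_poly_term m a + diff_poly_term m b"
  by (simp add: diff_poly_term_def add single_add algebra_simps sum.distrib case_prod_unfold)

lemma diff_poly_deriv_superset: "diff_poly_deriv \<delta> p = (\<Sum>m\<in>A. diff_poly_term m (Poly_Mapping.lookup p m))"
  if "finite A" "Poly_Mapping.keys p \<subseteq> A"
  unfolding diff_poly_deriv_def diff_poly_term_def[symmetric] using that
  by (intro sum.mono_neutral_left) (auto simp: diff_poly_term_0 in_keys_iff)

lemma diff_poly_deriv_add: "diff_poly_deriv \<delta> (p+q) = diff_poly_deriv \<delta> p + diff_poly_deriv \<delta> q"
  by (subst (1 2 3) diff_poly_deriv_superset[of "Poly_Mapping.keys p \<union> Poly_Mapping.keys q"])
     (auto simp: lookup_add diff_poly_term_add sum.distrib dest: Poly_Mapping.keys_add[THEN subsetD])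

lemma diff_poly_deriv_single: "diff_poly_deriv \<delta> (Poly_Mapping.single m c) = diff_poly_term m c"
  by (subst diff_poly_deriv_superset[of "{m}"]) auto

lemma diff_poly_term_alt: "diff_poly_term m c = Poly_Mapping.single m (\<delta> c) +
        (\<Sum>(i, k)\<in>A. Poly_Mapping.single
             (m - Poly_Mapping.single (i::nat, k) 1 + Poly_Mapping.single (i, Suc k) 1)
             (of_nat (Poly_Mapping.lookup m (i, k)) * c))" if "finite A" "Poly_Mapping.keys m \<subseteq> A"
  unfolding diff_poly_term_def using that
  by (intro arg_cong2[of _ _ _ _ "(+)"] refl sum.mono_neutral_left) (auto simp: in_keys_iff)

lemma poly_mapping_minus_single_add: "Poly_Mapping.lookup m v > 0 \<Longrightarrow> m + n - Poly_Mapping.single v 1 = (m - Poly_Mapping.single v (1::nat)) + n"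
  by (rule poly_mapping_eqI) (auto simp: lookup_add lookup_minus lookup_single when_def)

lemma diff_poly_term_mult: "diff_poly_term (m+n) (a*b) = diff_poly_term m a * Poly_Mapping.single n b + Poly_Mapping.single m a * diff_poly_term n b"
proof -
  let ?A = "Poly_Mapping.keys m \<union> Poly_Mapping.keys n"
  have k: "Poly_Mapping.keys (m+n) \<subseteq> ?A" by (rule Poly_Mapping.keys_add)
  have f: "finite ?A" by simp
  let ?s = "\<lambda>m n v c d. Poly_Mapping.single (m - Poly_Mapping.single v 1 + Poly_Mapping.single (fst v, Suc (snd v)) 1 + n) (of_nat (Poly_Mapping.lookup m v) * c * d)"
  have *: "?s (m+n) 0 v (a*b) 1 = ?s m n v a b + ?s n m v b a" for v
  proof -
    have 1: "?s m n v a b = Poly_Mapping.single (m+n- Poly_Mapping.single v 1 + Poly_Mapping.single (fst v, Suc (snd v)) 1) (of_nat (Poly_Mapping.lookup m v) * a * b)" for m n a b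
      by (cases "Poly_Mapping.lookup m v = 0") (auto simp: poly_mapping_minus_single_add algebra_simps simp del: One_nat_def)
    show ?thesis unfolding 1 by (simp add: single_add[symmetric] lookup_add algebra_simps)
  qed
  show ?thesis
    unfolding diff_poly_term_alt[OF f k] diff_poly_term_alt[OF f Un_upper1] diff_poly_term_alt[OF f Un_upper2]
    using *
    by (simp add: distrib_left distrib_right sum_distrib_left sum_distrib_right mult_single sum.distrib
       case_prod_unfold mult single_add algebra_simps)
qed

lemma diff_poly_deriv_sum: "diff_poly_deriv \<delta> (sum f A) = (\<Sum>x\<in>A. diff_poly_deriv \<delta> (f x))"
  by (induction A rule: infinite_finite_induct) (simp_all add: diff_poly_deriv_add, simp_all add: diff_poly_deriv_def)

lemma diff_poly_deriv_mult: "diff_poly_deriv \<delta> (p*q) = diff_poly_deriv \<delta> p * q + p * diff_poly_deriv \<delta> q"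
proof -
  have p: "p = (\<Sum>m\<in>Poly_Mapping.keys p. Poly_Mapping.single m (Poly_Mapping.lookup p m))" for p :: "(nat \<times> nat \<Rightarrow>\<^sub>0 nat) \<Rightarrow>\<^sub>0 'a"
    by (rule poly_mapping_eqI) (auto simp: lookup_sum lookup_single when_def in_keys_iff)
  define P Q where "P = (\<lambda>m. Poly_Mapping.single m (Poly_Mapping.lookup p m))"
    and "Q = (\<lambda>m. Poly_Mapping.single m (Poly_Mapping.lookup q m))"
  have PQ: "p = sum P (Poly_Mapping.keys p)" "q = sum Q (Poly_Mapping.keys q)"
    unfolding P_def Q_def by (rule p)+
  have 1: "diff_poly_deriv \<delta> (P m * Q n) = diff_poly_deriv \<delta> (P m) * Q n + P m * diff_poly_deriv \<delta> (Q n)" for m n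
    by (simp add: P_def Q_def mult_single diff_poly_deriv_single diff_poly_term_mult)
  have "diff_poly_deriv \<delta> (sum P A * sum Q B) = diff_poly_deriv \<delta> (sum P A) * sum Q B + sum P A * diff_poly_deriv \<delta> (sum Q B)" for A B
    by (simp add: sum_product diff_poly_deriv_sum 1 sum.distrib)
  then show ?thesis using PQ by metis
qed

lemma diff_poly_deriv_const: "diff_poly_deriv \<delta> (Poly_Mapping.single 0 c) = Poly_Mapping.single 0 (\<delta> c)"
  by (simp add: diff_poly_deriv_single diff_poly_term_def)
lemma diff_poly_deriv_var:
  "diff_poly_deriv \<delta> (Poly_Mapping.single (Poly_Mapping.single (i,k) 1) 1)
   = Poly_Mapping.single (Poly_Mapping.single (i,Suc k) 1) 1"
  by (simp add: diff_poly_deriv_single diff_poly_term_def leibniz_1)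

end


section \<open>Localization at a prime and standard differential rings\<close>

definition loc_rel :: "('a, 'b) ring_scheme \<Rightarrow> 'a set \<Rightarrow> (('a \<times> 'a) \<times> ('a \<times> 'a)) set" where
  "loc_rel R P = {((a, s), (b, t)).
     a \<in> carrier R \<and> b \<in> carrier R \<and> s \<in> carrier R - P \<and> t \<in> carrier R - P \<and>
     (\<exists>u\<in>carrier R - P. u \<otimes>\<^bsub>R\<^esub> (t \<otimes>\<^bsub>R\<^esub> a) = u \<otimes>\<^bsub>R\<^esub> (s \<otimes>\<^bsub>R\<^esub> b))}"

definition frac_at :: "('a, 'b) ring_scheme \<Rightarrow> 'a set \<Rightarrow> 'a \<Rightarrow> 'a \<Rightarrow> ('a \<times> 'a) set" where
  "frac_at R P a s = loc_rel R P `` {(a, s)}"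

definition localization_at :: "('a, 'b) ring_scheme \<Rightarrow> 'a set \<Rightarrow> ('a \<times> 'a) set ring" where
  "localization_at R P =
     \<lparr>carrier = (carrier R \<times> (carrier R - P)) // loc_rel R P,
      monoid.mult = (\<lambda>A B. \<Union>(a, s)\<in>A. \<Union>(b, t)\<in>B. frac_at R P (a \<otimes>\<^bsub>R\<^esub> b) (s \<otimes>\<^bsub>R\<^esub> t)),
      one = frac_at R P \<one>\<^bsub>R\<^esub> \<one>\<^bsub>R\<^esub>,
      ring.zero = frac_at R P \<zero>\<^bsub>R\<^esub> \<one>\<^bsub>R\<^esub>,
      add = (\<lambda>A B. \<Union>(a, s)\<in>A. \<Union>(b, t)\<in>B.
               frac_at R P (t \<otimes>\<^bsub>R\<^esub> a \<oplus>\<^bsub>R\<^esub> s \<otimes>\<^bsub>R\<^esub> b) (s \<otimes>\<^bsub>R\<^esub> t))\<rparr>"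

text \<open>The ideal \<open>P R\<^sub>P\<close> consists of the fractions with numerator in \<open>P\<close>.\<close>

definition residue_field :: "('a, 'b) ring_scheme \<Rightarrow> 'a set \<Rightarrow> ('a \<times> 'a) set set ring" where
  "residue_field R P =
     localization_at R P Quot {frac_at R P a s | a s. a \<in> P \<and> s \<in> carrier R - P}"

definition standard :: "('a, 'b) ring_scheme \<Rightarrow> ('a \<Rightarrow> 'a) \<Rightarrow> bool" where
  "standard R \<delta> \<longleftrightarrow> (\<forall>P\<in>diff_spec R \<delta>. \<forall>n::nat. n > 0 \<longrightarrow>
     add_pow (residue_field R P) n \<one>\<^bsub>residue_field R P\<^esub> \<noteq> \<zero>\<^bsub>residue_field R P\<^esub>)"


section \<open>Gap measure, differential type and differential dimension\<close>

definition inf_desc_chain :: "'a set set \<Rightarrow> 'a set \<Rightarrow> 'a set \<Rightarrow> (nat \<Rightarrow> 'a set) \<Rightarrow> bool" where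
  "inf_desc_chain F p p' s \<longleftrightarrow>
     s 0 = p \<and> (\<forall>i. s i \<in> F \<and> p' \<subseteq> s i) \<and> (\<forall>i. s (Suc i) \<subset> s i)"

text \<open>Nonnegativity is built into the value type \<open>enat\<close>.\<close>

definition is_gap_measure :: "'a set set \<Rightarrow> ('a set \<Rightarrow> 'a set \<Rightarrow> enat) \<Rightarrow> bool" where
  "is_gap_measure F g \<longleftrightarrow> (\<forall>p\<in>F. \<forall>p'\<in>F. p' \<subseteq> p \<longrightarrow>
     (g p p' = 0 \<longleftrightarrow> p = p' \<or> \<not> (\<exists>s. inf_desc_chain F p p' s)) \<and>
     (\<forall>d::nat. d > 0 \<longrightarrow>
        (g p p' \<ge> enat d \<longleftrightarrow>
           p \<noteq> p' \<and> (\<exists>s. inf_desc_chain F p p' s \<and>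
                      (\<forall>i\<ge>1. g (s (i - 1)) (s i) \<ge> enat (d - 1))))))"

text \<open>
  The value \<open>0\<close> off the pairs \<open>p \<supseteq> p'\<close> in \<open>F\<close> is a dummy which makes the total function unique.
\<close>

definition gap_measure :: "'a set set \<Rightarrow> 'a set \<Rightarrow> 'a set \<Rightarrow> enat" where
  "gap_measure F = (THE g. is_gap_measure F g \<and>
     (\<forall>p p'. \<not> (p \<in> F \<and> p' \<in> F \<and> p' \<subseteq> p) \<longrightarrow> g p p' = 0))"

text \<open>
  Existence and uniqueness, so that the description above denotes: the conditions determine
  recursively when the value is at least \<open>d\<close>.
\<close>

fun gap_ge :: "'a set set \<Rightarrow> nat \<Rightarrow> 'a set \<Rightarrow> 'a set \<Rightarrow> bool" where
  "gap_ge F 0 p p' = True"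
| "gap_ge F (Suc d) p p' = (p \<noteq> p' \<and> (\<exists>s. inf_desc_chain F p p' s \<and> (\<forall>i\<ge>1. gap_ge F d (s (i - 1)) (s i))))"

lemma gap_ge_mono: "gap_ge F (Suc d) p p' \<Longrightarrow> gap_ge F d p p'"
proof (induction d arbitrary: p p')
  case (Suc d)
  from Suc.prems obtain s where s: "p \<noteq> p'" "inf_desc_chain F p p' s"
      and ge: "\<forall>i\<ge>1. gap_ge F (Suc d) (s (i - 1)) (s i)"
    unfolding gap_ge.simps(2)[of F "Suc d"] by blast
  have "\<forall>i\<ge>1. gap_ge F d (s (i - 1)) (s i)"
    using ge by (intro allI impI Suc.IH) blast
  with s show ?case unfolding gap_ge.simps(2)[of F d] by (intro conjI exI[of _ s])
qed simp

lemma ex_gap_measure: "\<exists>g. \<forall>p p' d. enat d \<le> g p p' \<longleftrightarrow> gap_ge F d p p'"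
proof -
  have "\<exists>e. \<forall>d. enat d \<le> e \<longleftrightarrow> gap_ge F d p p'" for p p'
  proof (cases "\<forall>d. gap_ge F d p p'")
    case True
    then show ?thesis by (intro exI[of _ \<infinity>]) simp
  next
    case False
    define m where "m = (LEAST d. \<not> gap_ge F d p p')"
    have m: "\<not> gap_ge F m p p'" using False LeastI_ex[of "\<lambda>d. \<not> gap_ge F d p p'"]
      unfolding m_def by blast
    have below: "gap_ge F d p p'" if "d < m" for d using that not_less_Least unfolding m_def by blast
    have above: "\<not> gap_ge F d p p'" if "m \<le> d" for d
      using that
    proof (induction rule: dec_induct)
      case (step k)
      then show ?case using gap_ge_mono[of F k p p'] by blast
    qed (rule m)
    have "m > 0" using m by (cases m) auto
    then have "enat d \<le> enat (m - 1) \<longleftrightarrow> gap_ge F d p p'" for d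
      using below[of d] above[of d] by (cases "d < m") auto
    then show ?thesis by blast
  qed
  then have "\<forall>p. \<exists>f. \<forall>p' d. enat d \<le> f p' \<longleftrightarrow> gap_ge F d p p'"
    by (intro allI choice)
  then show ?thesis by (rule choice)
qed

lemma is_gap_measure_iff_gap_ge:
  assumes "is_gap_measure F g" "p \<in> F" "p' \<in> F" "p' \<subseteq> p"
  shows "enat d \<le> g p p' \<longleftrightarrow> gap_ge F d p p'"
  using assms(2-)
proof (induction d arbitrary: p p')
  case 0
  then show ?case by (simp flip: zero_enat_def)
next
  case (Suc d)
  have "enat (Suc d) \<le> g p p' \<longleftrightarrow> p \<noteq> p' \<and> (\<exists>s. inf_desc_chain F p p' s \<and>
                      (\<forall>i\<ge>1. g (s (i - 1)) (s i) \<ge> enat d))"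
    using assms(1) Suc.prems unfolding is_gap_measure_def by simp
  also have "\<dots> \<longleftrightarrow> gap_ge F (Suc d) p p'"
  proof -
    have "(\<forall>i\<ge>1. g (s (i - 1)) (s i) \<ge> enat d) \<longleftrightarrow> (\<forall>i\<ge>1. gap_ge F d (s (i - 1)) (s i))"
      if s: "inf_desc_chain F p p' s" for s
    proof -
      have "g (s (i - 1)) (s i) \<ge> enat d \<longleftrightarrow> gap_ge F d (s (i - 1)) (s i)" if "i \<ge> 1" for i
      proof (rule Suc.IH)
        show "s (i - 1) \<in> F" "s i \<in> F" using s by (auto simp: inf_desc_chain_def)
        show "s i \<subseteq> s (i - 1)" using s that by (cases i) (auto simp: inf_desc_chain_def)
      qed
      then show ?thesis by blast
    qed
    then show ?thesis by (simp cong: conj_cong)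
  qed
  finally show ?case .
qed

lemma is_gap_measureI:
  assumes g: "\<And>p p' d. p \<in> F \<Longrightarrow> p' \<in> F \<Longrightarrow> p' \<subseteq> p \<Longrightarrow> enat d \<le> g p p' \<longleftrightarrow> gap_ge F d p p'"
  shows "is_gap_measure F g"
  unfolding is_gap_measure_def
proof (intro ballI impI conjI allI)
  fix p p' assume F: "p \<in> F" "p' \<in> F" "p' \<subseteq> p"
  have "g p p' = 0 \<longleftrightarrow> \<not> enat 1 \<le> g p p'"
    by (cases "g p p'") (auto simp: zero_enat_def)
  also have "enat 1 \<le> g p p' \<longleftrightarrow> p \<noteq> p' \<and> (\<exists>s. inf_desc_chain F p p' s)"
    using g[OF F, of "Suc 0"] by simp
  finally show "g p p' = 0 \<longleftrightarrow> p = p' \<or> \<not> (\<exists>s. inf_desc_chain F p p' s)"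
    by blast
  fix d :: nat assume d: "d > 0"
  have *: "enat (d - 1) \<le> g (s (i - 1)) (s i) \<longleftrightarrow> gap_ge F (d - 1) (s (i - 1)) (s i)"
    if "inf_desc_chain F p p' s" "i \<ge> 1" for s i
  proof (rule g)
    show "s (i - 1) \<in> F" "s i \<in> F" using that(1) by (auto simp: inf_desc_chain_def)
    show "s i \<subseteq> s (i - 1)" using that by (cases i) (auto simp: inf_desc_chain_def)
  qed
  have "gap_ge F d p p' \<longleftrightarrow> p \<noteq> p' \<and> (\<exists>s. inf_desc_chain F p p' s \<and>
                      (\<forall>i\<ge>1. gap_ge F (d - 1) (s (i - 1)) (s i)))"
    using d by (cases d) simp_all
  also have "\<dots> \<longleftrightarrow> p \<noteq> p' \<and> (\<exists>s. inf_desc_chain F p p' s \<and>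
                      (\<forall>i\<ge>1. g (s (i - 1)) (s i) \<ge> enat (d - 1)))"
    by (intro conj_cong refl ex_cong1 all_cong) (simp only: *)
  finally show "enat d \<le> g p p' \<longleftrightarrow> p \<noteq> p' \<and> (\<exists>s. inf_desc_chain F p p' s \<and>
                      (\<forall>i\<ge>1. g (s (i - 1)) (s i) \<ge> enat (d - 1)))"
    unfolding g[OF F] .
qed

lemma enat_le_by_nats:
  assumes "\<And>d::nat. enat d \<le> a \<Longrightarrow> enat d \<le> b"
  shows "a \<le> b"
proof (cases a)
  case (enat n)
  then show ?thesis using assms[of n] by simp
next
  case infinity
  then show ?thesis using assms[of "Suc (the_enat b)"] by (cases b) simp_all
qed

lemma enat_eq_by_nats: "(\<And>d::nat. enat d \<le> a \<longleftrightarrow> enat d \<le> b) \<Longrightarrow> a = b"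
  by (rule antisym; rule enat_le_by_nats; simp only:)

lemma gap_measure_ex1:
  "\<exists>!g. is_gap_measure F g \<and> (\<forall>p p'. \<not> (p \<in> F \<and> p' \<in> F \<and> p' \<subseteq> p) \<longrightarrow> g p p' = 0)"
proof -
  obtain g where g: "\<And>p p' d. enat d \<le> g p p' \<longleftrightarrow> gap_ge F d p p'"
    using ex_gap_measure by blast
  define h where "h = (\<lambda>p p'. if p \<in> F \<and> p' \<in> F \<and> p' \<subseteq> p then g p p' else 0)"
  have h: "is_gap_measure F h" by (rule is_gap_measureI) (simp add: h_def g)
  have h0: "\<forall>p p'. \<not> (p \<in> F \<and> p' \<in> F \<and> p' \<subseteq> p) \<longrightarrow> h p p' = 0"
    by (simp add: h_def)
  show ?thesis
  proof (rule ex1I[of _ h])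
    show "is_gap_measure F h \<and> (\<forall>p p'. \<not> (p \<in> F \<and> p' \<in> F \<and> p' \<subseteq> p) \<longrightarrow> h p p' = 0)"
      using h h0 by (rule conjI)
  next
    fix h' assume h': "is_gap_measure F h' \<and> (\<forall>p p'. \<not> (p \<in> F \<and> p' \<in> F \<and> p' \<subseteq> p) \<longrightarrow> h' p p' = 0)"
    show "h' = h"
    proof (intro ext)
      fix p p' show "h' p p' = h p p'"
      proof (cases "p \<in> F \<and> p' \<in> F \<and> p' \<subseteq> p")
        case True
        then have F: "p \<in> F" "p' \<in> F" "p' \<subseteq> p" by auto
        show ?thesis
          by (rule enat_eq_by_nats) (simp only: is_gap_measure_iff_gap_ge[OF conjunct1[OF h'] F] is_gap_measure_iff_gap_ge[OF h F])
      next
        case False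
        have "h' p p' = 0" by (rule conjunct2[OF h', rule_format]) (rule False)
        moreover have "h p p' = 0" by (rule h0[rule_format]) (rule False)
        ultimately show ?thesis by (rule trans[OF _ sym])
      qed
    qed
  qed
qed

definition diff_type :: "('a, 'b) ring_scheme \<Rightarrow> ('a \<Rightarrow> 'a) \<Rightarrow> enat" where
  "diff_type R \<delta> = Sup {gap_measure (diff_spec R \<delta>) p p' | p p'.
     p \<in> diff_spec R \<delta> \<and> p' \<in> diff_spec R \<delta> \<and> p' \<subseteq> p}"

definition diff_dim :: "('a, 'b) ring_scheme \<Rightarrow> ('a \<Rightarrow> 'a) \<Rightarrow> enat" where
  "diff_dim R \<delta> = Sup {enat k | k. \<exists>p :: nat \<Rightarrow> 'a set.
     (\<forall>i\<le>k. p i \<in> diff_spec R \<delta>) \<and> (\<forall>i<k. p (Suc i) \<subset> p i) \<and>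
     (\<forall>i\<in>{1..k}. gap_measure (diff_spec R \<delta>) (p (i - 1)) (p i) = diff_type R \<delta>)}"


section \<open>J-rings\<close>

text \<open>The ordinary case: the number of derivations is 1.\<close>

definition J_ring :: "('a \<Rightarrow> 'a::comm_ring_1) \<Rightarrow> bool" where
  "J_ring \<delta> \<longleftrightarrow>
    (let R = ring_of_type_algebra :: 'a ring; t = diff_type R \<delta> in
       t < \<infinity> \<and>
       (\<forall>n>0. let S = diff_poly_ring n; \<delta>' = diff_poly_deriv \<delta> in
          diff_type S \<delta>' = max t 1 \<and>
          (t < 1 \<longrightarrow> diff_dim S \<delta>' = enat n) \<and>
          (t = 1 \<longrightarrow> diff_dim R \<delta> < \<infinity> \<and> diff_dim S \<delta>' = enat n + diff_dim R \<delta>) \<and>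
          (t > 1 \<longrightarrow> diff_dim R \<delta> < \<infinity> \<and> diff_dim S \<delta>' = diff_dim R \<delta>)))"

end

theory Submission
  imports Defs "HOL-Computational_Algebra.Polynomial"
begin

hide_const (open) Polynomials.degree Poly_Mapping.degree

text \<open>
  A Jaffard ring has finite Krull dimension, so \<open>R\<close> has differential type \<open>0\<close>. For a differential
  prime \<open>p\<close> of \<open>R{z\<^sub>1, \<dots>, z\<^sub>n}\<close> let \<open>f\<^sub>p(k)\<close> be the transcendence degree, over the residue field of
  \<open>p \<inter> R\<close>, of the subring of the quotient generated by the derivatives of order at most \<open>k\<close>. In
  characteristic zero, differentiating a minimal relation shows that \<open>f\<^sub>p(k) - a\<^sub>p (k + 1)\<close> is
  nonnegative and bounded for some \<open>a\<^sub>p \<le> n\<close>. If \<open>q \<subseteq> p\<close> then \<open>f\<^sub>p \<le> f\<^sub>q + dim R\<close>: for a transcendence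
  basis \<open>B\<close> modulo \<open>p\<close>, the prime \<open>q \<inter> R[B]\<close> has height at least \<open>|B| - f\<^sub>q\<close>, and there are \<open>|B|\<close>
  further steps above \<open>p \<inter> R[B]\<close>, so the Jaffard property applies. If the inclusion is strict and
  \<open>p \<inter> R = q \<inter> R\<close>, then eventually \<open>f\<^sub>p < f\<^sub>q\<close>. In an infinite chain from \<open>p\<close> down to \<open>q\<close> the contractions to
  \<open>R\<close> stabilize, so \<open>f\<^sub>q - f\<^sub>p\<close> is unbounded and \<open>a\<^sub>p < a\<^sub>q\<close>. Hence chains of positive gap measure
  have length at most \<open>n\<close>, which also excludes gap measure \<open>2\<close>; killing the \<open>z\<^sub>i\<close> one after
  another attains both bounds.
\<close>

section \<open>Primes of a subring of a commutative ring\<close>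

text \<open>Subrings and their primes are kept as sets inside a ring type, so that type-class
  algebra and \<open>poly\<close> apply to them; \<open>primeideal_iff_prime_in\<close> leads back
  to carrier-based ideals.\<close>

definition subring_of :: "'b::comm_ring_1 set \<Rightarrow> bool" where
  "subring_of A \<longleftrightarrow> 0 \<in> A \<and> 1 \<in> A \<and>
     (\<forall>x\<in>A. - x \<in> A \<and> (\<forall>y\<in>A. x + y \<in> A \<and> x * y \<in> A))"

lemma subring_ofD:
  assumes "subring_of A"
  shows "0 \<in> A" "1 \<in> A" "x \<in> A \<Longrightarrow> - x \<in> A" "x \<in> A \<Longrightarrow> y \<in> A \<Longrightarrow> x + y \<in> A"
    "x \<in> A \<Longrightarrow> y \<in> A \<Longrightarrow> x - y \<in> A" "x \<in> A \<Longrightarrow> y \<in> A \<Longrightarrow> x * y \<in> A"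
  using assms unfolding subring_of_def diff_conv_add_uminus[of x y] by blast+

lemma subring_of_sum: "subring_of A \<Longrightarrow> (\<And>i. i \<in> I \<Longrightarrow> f i \<in> A) \<Longrightarrow> sum f I \<in> A"
  by (induction I rule: infinite_finite_induct) (auto intro: subring_ofD)

lemma subring_of_power: "subring_of A \<Longrightarrow> x \<in> A \<Longrightarrow> x ^ n \<in> A"
  by (induction n) (auto intro: subring_ofD)

lemma subring_of_of_nat: "subring_of A \<Longrightarrow> of_nat n \<in> A"
  by (induction n) (auto intro: subring_ofD)

definition prime_in :: "'b::comm_ring_1 set \<Rightarrow> 'b set \<Rightarrow> bool" where
  "prime_in A P \<longleftrightarrow> P \<subseteq> A \<and> 0 \<in> P \<and> 1 \<notin> P \<and> (\<forall>x\<in>P. \<forall>y\<in>P. x + y \<in> P) \<and>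
     (\<forall>x\<in>A. \<forall>y\<in>P. x * y \<in> P) \<and> (\<forall>x\<in>A. \<forall>y\<in>A. x * y \<in> P \<longrightarrow> x \<in> P \<or> y \<in> P)"

lemma prime_inD:
  assumes "prime_in A P"
  shows "P \<subseteq> A" "0 \<in> P" "1 \<notin> P" "x \<in> P \<Longrightarrow> y \<in> P \<Longrightarrow> x + y \<in> P"
    "x \<in> A \<Longrightarrow> y \<in> P \<Longrightarrow> x * y \<in> P" "x \<in> P \<Longrightarrow> y \<in> A \<Longrightarrow> x * y \<in> P"
    "x \<in> A \<Longrightarrow> y \<in> A \<Longrightarrow> x * y \<in> P \<Longrightarrow> x \<in> P \<or> y \<in> P"
proof -
  have *: "x * y \<in> P" if "x \<in> A" "y \<in> P" for x y
    using assms that unfolding prime_in_def by blast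
  show "x \<in> P \<Longrightarrow> y \<in> A \<Longrightarrow> x * y \<in> P" using *[of y x] by (simp add: mult.commute)
qed (use assms in \<open>unfold prime_in_def, blast+\<close>)

lemma prime_in_uminus:
  assumes "subring_of A" "prime_in A P" "x \<in> P"
  shows "- x \<in> P"
  using prime_inD(5)[OF assms(2) _ assms(3), of "-1"] subring_ofD[OF assms(1)] by simp

lemma prime_in_diff:
  assumes "subring_of A" "prime_in A P" "x \<in> P" "y \<in> P"
  shows "x - y \<in> P"
  using prime_inD(4)[OF assms(2,3) prime_in_uminus[OF assms(1,2,4)]] by simp

lemma prime_in_sum: "prime_in A P \<Longrightarrow> (\<And>i. i \<in> I \<Longrightarrow> f i \<in> P) \<Longrightarrow> sum f I \<in> P"
  by (induction I rule: infinite_finite_induct) (auto intro: prime_inD)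

lemma prime_in_power: "subring_of A \<Longrightarrow> prime_in A P \<Longrightarrow> x \<in> A \<Longrightarrow> x ^ n \<in> P \<Longrightarrow> x \<in> P"
proof (induction n)
  case (Suc n)
  then show ?case using prime_inD(7)[OF Suc.prems(2), of x "x ^ n"] subring_of_power[of A x n] by auto
qed (auto dest: prime_inD)

lemma prime_in_contract:
  assumes "prime_in A P" "subring_of B" "B \<subseteq> A"
  shows "prime_in B (P \<inter> B)"
  using assms subring_ofD[OF assms(2)] unfolding prime_in_def by (auto 4 3)

lemma primeideal_iff_prime_in:
  assumes "subring_of (A :: 'b::comm_ring_1 set)"
  shows "primeideal P (ring_of_type_algebra\<lparr>carrier := A\<rparr>) \<longleftrightarrow> prime_in A P"
proof -
  let ?R = "ring_of_type_algebra\<lparr>carrier := A\<rparr>"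
  note s = subring_ofD[OF assms]
  have inv: "\<exists>y\<in>A. y + x = 0" if "x \<in> A" for x using that s(3)[of x] by (intro bexI[of _ "- x"]) auto
  interpret R: cring ?R
    by (rule cringI)
       (use s inv in \<open>auto intro!: abelian_groupI comm_monoidI simp: ring_of_type_algebra_def algebra_simps\<close>)
  have am: "a_inv ?R x = - x" if "x \<in> A" for x
    using R.minus_equality[of "- x" x] that s by (auto simp: ring_of_type_algebra_def)
  show ?thesis
  proof
    assume "primeideal P ?R"
    then interpret P: primeideal P ?R .
    show "prime_in A P"
      unfolding prime_in_def
      using P.a_subset P.zero_closed P.one_imp_carrier P.I_notcarr P.I_l_closed P.I_prime
        P.a_closed
      by (auto simp: ring_of_type_algebra_def)
  next
    assume P: "prime_in A P"
    have "additive_subgroup P ?R"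
      using prime_inD[OF P] prime_in_uminus[OF assms P] am
      by (intro additive_subgroup.intro subgroup.intro)
         (auto simp: ring_of_type_algebra_def a_inv_def subset_iff)
    then show "primeideal P ?R"
      using prime_inD[OF P] s
      by (intro primeidealI2 R.is_cring) (auto simp: ring_of_type_algebra_def)
  qed
qed

section \<open>Incomparability for simple algebraic extensions\<close>

text \<open>Also used with a prime in place of a subring, where it expresses that the polynomial
  vanishes modulo that prime.\<close>

definition coeffs_in :: "'b::comm_ring_1 set \<Rightarrow> 'b poly \<Rightarrow> bool" where
  "coeffs_in A f \<longleftrightarrow> (\<forall>i. coeff f i \<in> A)"

lemma coeffs_in_mono: "coeffs_in A f \<Longrightarrow> A \<subseteq> B \<Longrightarrow> coeffs_in B f"
  by (auto simp: coeffs_in_def)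

lemma coeffs_in_ring:
  assumes "subring_of A"
  shows "coeffs_in A 0" "coeffs_in A f \<Longrightarrow> coeffs_in A g \<Longrightarrow> coeffs_in A (f + g)"
    "coeffs_in A f \<Longrightarrow> coeffs_in A g \<Longrightarrow> coeffs_in A (f - g)"
    "coeffs_in A f \<Longrightarrow> coeffs_in A g \<Longrightarrow> coeffs_in A (f * g)"
    "a \<in> A \<Longrightarrow> coeffs_in A f \<Longrightarrow> coeffs_in A (smult a f)" "a \<in> A \<Longrightarrow> coeffs_in A (Polynomial.monom a n)"
  using subring_ofD[OF assms]
  by (auto simp: coeffs_in_def coeff_mult coeff_monom intro!: subring_of_sum[OF assms])

lemma coeffs_in_pCons: "coeffs_in A (pCons a f) \<longleftrightarrow> a \<in> A \<and> coeffs_in A f"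
  unfolding coeffs_in_def by (metis coeff_pCons_0 coeff_pCons_Suc not0_implies_Suc)

lemma poly_in_subring:
  assumes "subring_of A" "coeffs_in A f" "y \<in> A"
  shows "poly f y \<in> A"
  using assms unfolding poly_altdef coeffs_in_def
  by (auto intro!: subring_of_sum subring_ofD(6)[OF assms(1)] subring_of_power)

lemma poly_in_prime:
  assumes "subring_of A" "prime_in A P" "coeffs_in P f" "y \<in> A"
  shows "poly f y \<in> P"
  using assms unfolding poly_altdef coeffs_in_def
  by (auto intro!: prime_in_sum prime_inD(6)[OF assms(2)] subring_of_power)

text \<open>The residue of \<open>y\<close> modulo \<open>P\<close> is algebraic over the image of
  \<open>A\<close>, with witness \<open>f\<close>; this form avoids residue domains and their
  fraction fields.\<close>

definition alg_rel :: "'b::comm_ring_1 set \<Rightarrow> 'b \<Rightarrow> 'b set \<Rightarrow> 'b poly \<Rightarrow> bool" where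
  "alg_rel A y P f \<longleftrightarrow> coeffs_in A f \<and> poly f y \<in> P \<and> (\<exists>i. coeff f i \<notin> P)"

text \<open>In a relation of least degree the leading coefficient lies outside \<open>P\<close>, for
  otherwise removing the leading term leaves a smaller relation. A constant relation is impossible,
  since its value is its leading coefficient.\<close>

lemma minimal_alg_rel:
  assumes "subring_of B" "prime_in B P" "A \<subseteq> B" "y \<in> B" "alg_rel A y P f0" "subring_of A"
  obtains f where "alg_rel A y P f" "lead_coeff f \<notin> P" "degree f > 0"
    "\<And>g. alg_rel A y P g \<Longrightarrow> degree f \<le> degree g"
proof -
  define f where "f = arg_min degree (alg_rel A y P)"
  have f: "alg_rel A y P f" and min: "\<And>g. alg_rel A y P g \<Longrightarrow> degree f \<le> degree g"
    using arg_min_nat_lemma[of "alg_rel A y P" f0 degree] assms(5) by (auto simp: f_def)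
  have lc: "lead_coeff f \<notin> P"
  proof
    assume lc: "lead_coeff f \<in> P"
    let ?g = "f - Polynomial.monom (lead_coeff f) (degree f)"
    from f obtain i where i: "coeff f i \<notin> P" by (auto simp: alg_rel_def)
    then have ine: "i \<noteq> degree f" using lc by auto
    have "i \<le> degree f" using i prime_inD(2)[OF assms(2)] by (metis coeff_eq_0 not_le)
    then have deg: "0 < degree f" using ine by simp
    have "alg_rel A y P ?g"
      unfolding alg_rel_def
    proof (intro conjI exI[of _ i])
      show "coeffs_in A ?g" using f by (intro coeffs_in_ring assms) (auto simp: alg_rel_def coeffs_in_def)
      show "poly ?g y \<in> P" using f lc assms
        by (auto simp: alg_rel_def poly_monom intro!: prime_in_diff prime_inD(6) subring_of_power)
      show "coeff ?g i \<notin> P" using i ine by (simp add: coeff_monom)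
    qed
    moreover have "degree ?g < degree f"
    proof (rule degree_lessI)
      show "?g \<noteq> 0 \<or> 0 < degree f" using deg by simp
      show "\<forall>k\<ge>degree f. coeff ?g k = 0" by (auto simp: coeff_monom coeff_eq_0)
    qed
    ultimately show False using min by fastforce
  qed
  have "degree f \<noteq> 0"
  proof
    assume "degree f = 0"
    then obtain c where "f = [:c:]" by (rule degree_eq_zeroE)
    then show False using f lc by (simp add: alg_rel_def)
  qed
  then show ?thesis using that f lc min by blast
qed

text \<open>The division stops when the remainder vanishes modulo \<open>P\<close>. As long as
  \<open>h\<close> does not, it is itself a relation for \<open>y\<close>, hence of degree at least
  \<open>degree f\<close>, and cancelling leading terms after multiplying by
  \<open>lead_coeff f\<close> lowers the degree.\<close>

lemma pseudo_division:
  assumes AB: "subring_of A" "subring_of B" "prime_in B P" "A \<subseteq> B" "y \<in> B"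
    and f: "alg_rel A y P f" "\<And>g. alg_rel A y P g \<Longrightarrow> degree f \<le> degree g"
    and h: "coeffs_in A h" "poly h y \<in> P" and df: "degree f > 0"
  shows "\<exists>e q. coeffs_in A q \<and> coeffs_in P (smult (lead_coeff f ^ e) h - q * f) \<and>
           (q = 0 \<or> degree q + degree f \<le> degree h)"
  using h
proof (induction "degree h" arbitrary: h rule: less_induct)
  case less
  show ?case
  proof (cases "coeffs_in P h")
    case True
    then show ?thesis by (intro exI[of _ 0]) (auto simp: coeffs_in_ring AB)
  next
    case False
    then have hf: "degree f \<le> degree h" using less.prems f(2) by (auto simp: alg_rel_def coeffs_in_def)
    let ?b = "lead_coeff f" and ?m = "Polynomial.monom (lead_coeff h) (degree h - degree f)"
    define h' where "h' = smult ?b h - ?m * f"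
    have bA: "?b \<in> A" and hA: "lead_coeff h \<in> A" and fA: "coeffs_in A f"
      using f(1) less.prems by (auto simp: alg_rel_def coeffs_in_def)
    have h'A: "coeffs_in A h'" unfolding h'_def
      using less.prems fA bA hA by (intro coeffs_in_ring AB)
    have mA: "coeffs_in A ?m" using hA by (intro coeffs_in_ring AB)
    have "poly ?m y \<in> B" using poly_in_subring[OF AB(2) coeffs_in_mono[OF mA AB(4)] AB(5)] .
    then have h'P: "poly h' y \<in> P" unfolding h'_def poly_diff poly_mult poly_smult
      using f(1) less.prems(2) bA AB(4)
      by (intro prime_in_diff[OF AB(2,3)] prime_inD(5)[OF AB(3)]) (auto simp: alg_rel_def)
    have dh': "degree h' < degree h"
    proof (rule degree_lessI)
      show "h' \<noteq> 0 \<or> 0 < degree h" using hf df by auto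
      show "\<forall>k\<ge>degree h. coeff h' k = 0"
      proof (intro allI impI)
        fix k assume k: "k \<ge> degree h"
        have d: "degree (?m * f) \<le> degree h"
          by (rule order_trans[OF degree_mult_le]) (use hf in \<open>simp add: order_trans[OF add_right_mono[OF degree_monom_le]]\<close>)
        show "coeff h' k = 0"
        proof (cases "k = degree h")
          case True
          have "coeff (?m * f) (degree h) = lead_coeff h * ?b"
            using hf by (simp add: coeff_monom_mult)
          then show ?thesis by (simp add: h'_def True mult.commute)
        next
          case False
          then show ?thesis using k d by (simp add: h'_def coeff_eq_0)
        qed
      qed
    qed
    from less.hyps[OF dh' h'A h'P] obtain e q where
      q: "coeffs_in A q" "coeffs_in P (smult (?b ^ e) h' - q * f)" "q = 0 \<or> degree q + degree f \<le> degree h'" by blast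
    let ?q = "q + smult (?b ^ e) ?m"
    have "smult (?b ^ Suc e) h - ?q * f = smult (?b ^ e) h' - q * f"
      by (simp add: h'_def algebra_simps smult_diff_right)
    moreover have "coeffs_in A ?q" using q(1) mA subring_of_power[OF AB(1) bA] by (intro coeffs_in_ring(2,5)[OF AB(1)])
    moreover have "degree ?q + degree f \<le> degree h"
    proof -
      have "degree q \<le> degree h - degree f" using q(3) dh' by auto
      moreover have "degree (smult (?b ^ e) ?m) \<le> degree h - degree f"
        by (rule order_trans[OF degree_smult_le degree_monom_le])
      ultimately have "degree ?q \<le> degree h - degree f" by (rule degree_add_le)
      then show ?thesis using hf by simp
    qed
    ultimately show ?thesis using q(2) by metis
  qed
qed

text \<open>Let \<open>f\<close> and \<open>g\<close> be minimal relations for \<open>y\<close>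
  modulo \<open>P\<close> and \<open>Q\<close>. Pseudo-dividing \<open>g\<close> by \<open>f\<close>
  forces f(y) into \<open>Q\<close>: otherwise the quotient would vanish at \<open>y\<close> modulo
  \<open>Q\<close>, so it would be a relation of smaller degree than \<open>g\<close>, or zero
  modulo \<open>Q\<close> and then \<open>g\<close> as well. Dividing any member of \<open>P\<close>
  by \<open>f\<close> then puts its product with a power of the leading coefficient of
  \<open>f\<close> into \<open>Q\<close>, and that power is outside \<open>Q\<close>.\<close>

lemma incomparability:
  assumes A: "subring_of A" and B: "subring_of B" "A \<subseteq> B" "y \<in> B"
    and gen: "\<And>b. b \<in> B \<Longrightarrow> \<exists>g. coeffs_in A g \<and> b = poly g y"
    and P: "prime_in B P" and Q: "prime_in B Q" and QP: "Q \<subseteq> P" and PA: "P \<inter> A \<subseteq> Q"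
    and rel: "alg_rel A y Q g0"
  shows "P \<subseteq> Q"
proof -
  obtain g where g: "alg_rel A y Q g" "degree g > 0" "\<And>h. alg_rel A y Q h \<Longrightarrow> degree g \<le> degree h"
    using minimal_alg_rel[OF B(1) Q B(2,3) rel A] by metis
  \<comment> \<open>By \<open>PA\<close>, coefficients from \<open>A\<close> that lie outside
    \<open>Q\<close> also lie outside \<open>P\<close>.\<close>
  have mono: "alg_rel A y P h" if "alg_rel A y Q h" for h
    using that QP PA unfolding alg_rel_def coeffs_in_def by blast
  obtain f where f: "alg_rel A y P f" "lead_coeff f \<notin> P" "degree f > 0"
    "\<And>h. alg_rel A y P h \<Longrightarrow> degree f \<le> degree h"
    using minimal_alg_rel[OF B(1) P B(2,3) mono[OF rel] A] by metis
  let ?b = "lead_coeff f"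
  have fA: "coeffs_in A f" and gA: "coeffs_in A g" using f(1) g(1) by (auto simp: alg_rel_def)
  have bA: "?b ^ e \<in> A" for e using fA by (intro subring_of_power A) (auto simp: coeffs_in_def)
  have bQ: "?b ^ e \<notin> Q" for e using prime_in_power[OF B(1) P, of ?b e] f(2) fA QP B(2) by (auto simp: coeffs_in_def)
  have ev: "poly h y \<in> B" if "coeffs_in A h" for h
    using poly_in_subring[OF B(1) coeffs_in_mono[OF that B(2)] B(3)] .
  \<comment> \<open>The remainder has its coefficients in \<open>A\<close> as well as in
    \<open>P\<close>, hence in \<open>Q\<close>, so the division is valid modulo the smaller
    prime.\<close>
  have div: "\<exists>e q. coeffs_in A q \<and> coeffs_in Q (smult (?b ^ e) h - q * f) \<and>
           (q = 0 \<or> degree q + degree f \<le> degree h)" if "coeffs_in A h" "poly h y \<in> P" for h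
  proof -
    from pseudo_division[OF A B(1) P B(2,3) f(1) f(4) that f(3)] obtain e q where
      q: "coeffs_in A q" "coeffs_in P (smult (?b ^ e) h - q * f)" "q = 0 \<or> degree q + degree f \<le> degree h" by blast
    have "coeffs_in A (smult (?b ^ e) h - q * f)"
      using that q(1) fA bA by (intro coeffs_in_ring A)
    then have "coeffs_in Q (smult (?b ^ e) h - q * f)"
      using q(2) PA unfolding coeffs_in_def by blast
    then show ?thesis using q by blast
  qed
  have "poly f y \<in> Q"
  proof (rule ccontr)
    assume nf: "poly f y \<notin> Q"
    have "poly g y \<in> P" using g(1) QP by (auto simp: alg_rel_def)
    from div[OF gA this] obtain e q where q: "coeffs_in A q" "coeffs_in Q (smult (?b ^ e) g - q * f)"
      "q = 0 \<or> degree q + degree f \<le> degree g" by blast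
    have "poly (smult (?b ^ e) g) y \<in> Q"
      using g(1) bA[of e] B(2) by (auto simp: alg_rel_def intro!: prime_inD(5)[OF Q])
    then have "poly (smult (?b ^ e) g) y - poly (smult (?b ^ e) g - q * f) y \<in> Q"
      using poly_in_prime[OF B(1) Q q(2) B(3)] by (rule prime_in_diff[OF B(1) Q])
    then have "poly q y * poly f y \<in> Q" by simp
    then have qQ: "poly q y \<in> Q" using prime_inD(7)[OF Q ev[OF q(1)] ev[OF fA]] nf by blast
    show False
    proof (cases "coeffs_in Q q")
      case True
      have "coeffs_in Q (q * f)"
        unfolding coeffs_in_def coeff_mult
        using True fA B(2) by (auto intro!: prime_in_sum[OF Q] prime_inD(6)[OF Q] simp: coeffs_in_def)
      then have "coeff (smult (?b ^ e) g - q * f) i + coeff (q * f) i \<in> Q" for i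
        using q(2) by (intro prime_inD(4)[OF Q]) (auto simp: coeffs_in_def)
      then have "?b ^ e * coeff g i \<in> Q" for i by simp
      then have "coeff g i \<in> Q" for i
        using prime_inD(7)[OF Q, of "?b ^ e" "coeff g i"] bA[of e] gA B(2) bQ by (auto simp: coeffs_in_def)
      then show False using g(1) by (auto simp: alg_rel_def)
    next
      case False
      then have "alg_rel A y Q q" using q(1) qQ by (auto simp: alg_rel_def coeffs_in_def)
      moreover have "q \<noteq> 0" using False prime_inD(2)[OF Q] by (auto simp: coeffs_in_def)
      ultimately show False using g(3)[of q] q(3) f(3) by auto
    qed
  qed
  show "P \<subseteq> Q"
  proof
    fix u assume u: "u \<in> P"
    then obtain h where h: "coeffs_in A h" "u = poly h y" using gen prime_inD(1)[OF P] by blast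
    from div[OF h(1)] u h(2) obtain e q where q: "coeffs_in A q" "coeffs_in Q (smult (?b ^ e) h - q * f)" by blast
    have "poly (smult (?b ^ e) h - q * f) y + poly q y * poly f y \<in> Q"
      using poly_in_prime[OF B(1) Q q(2) B(3)] \<open>poly f y \<in> Q\<close> ev[OF q(1)]
      by (intro prime_inD(4)[OF Q] prime_inD(5)[OF Q])
    then have "?b ^ e * u \<in> Q" by (simp add: h(2))
    then show "u \<in> Q" using prime_inD(7)[OF Q, of "?b ^ e" u] bA[of e] B(2) bQ u prime_inD(1)[OF P] by blast
  qed
qed

section \<open>Polynomial rings in sets of variables\<close>

definition polys :: "'v set \<Rightarrow> (('v \<Rightarrow>\<^sub>0 nat) \<Rightarrow>\<^sub>0 'a::comm_ring_1) set" where
  "polys W = {p. \<forall>m\<in>Poly_Mapping.keys p. Poly_Mapping.keys m \<subseteq> W}"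

abbreviation Const :: "'a \<Rightarrow> ('v \<Rightarrow>\<^sub>0 nat) \<Rightarrow>\<^sub>0 'a::comm_ring_1" where
  "Const c \<equiv> Poly_Mapping.single 0 c"

abbreviation Var :: "'v \<Rightarrow> ('v \<Rightarrow>\<^sub>0 nat) \<Rightarrow>\<^sub>0 'a::comm_ring_1" where
  "Var v \<equiv> Poly_Mapping.single (Poly_Mapping.single v (Suc 0)) 1"

lemma poly_mapping_sum_single:
  "p = (\<Sum>m\<in>Poly_Mapping.keys p. Poly_Mapping.single m (Poly_Mapping.lookup p m))"
  by (rule poly_mapping_eqI) (auto simp: lookup_sum lookup_single when_def in_keys_iff)

lemma keys_add_nat: "Poly_Mapping.keys (m + n) = Poly_Mapping.keys m \<union> Poly_Mapping.keys (n :: 'v \<Rightarrow>\<^sub>0 nat)"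
  by (auto simp: in_keys_iff lookup_add)

lemma subring_of_polys: "subring_of (polys W)"
  unfolding subring_of_def
proof (intro conjI ballI)
  fix x y :: "('a \<Rightarrow>\<^sub>0 nat) \<Rightarrow>\<^sub>0 'b" assume x: "x \<in> polys W"
  show "- x \<in> polys W" using x by (auto simp: polys_def in_keys_iff)
  assume y: "y \<in> polys W"
  show "x + y \<in> polys W" using x y Poly_Mapping.keys_add[of x y] by (auto simp: polys_def)
  show "x * y \<in> polys W" using x y Poly_Mapping.keys_mult[of x y] by (fastforce simp: polys_def keys_add_nat)
qed (auto simp: polys_def)

lemma polys_mono: "V \<subseteq> W \<Longrightarrow> polys V \<subseteq> polys W"
  by (auto simp: polys_def)

lemma single_in_polys: "Poly_Mapping.keys m \<subseteq> W \<Longrightarrow> Poly_Mapping.single m c \<in> polys W"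
  by (auto simp: polys_def)

lemma Var_in_polys: "v \<in> W \<Longrightarrow> Var v \<in> polys W"
  by (simp add: single_in_polys)

lemma polys_finite_support: "\<exists>W. finite W \<and> W \<subseteq> U \<and> f \<in> polys W" if "f \<in> polys U"
  using that by (intro exI[of _ "\<Union>m\<in>Poly_Mapping.keys f. Poly_Mapping.keys m"]) (auto simp: polys_def)

lemma single_mult_Var_power: "Poly_Mapping.single m c * Var v ^ e = Poly_Mapping.single (m + Poly_Mapping.single v e) c"
proof -
  have "(Var v :: ('a \<Rightarrow>\<^sub>0 nat) \<Rightarrow>\<^sub>0 'b) ^ e = Poly_Mapping.single (Poly_Mapping.single v e) 1"
    by (induction e) (simp_all add: mult_single flip: single_add)
  then show ?thesis by (simp add: mult_single)
qed

subsection \<open>Coefficientwise extension of additive maps\<close>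

text \<open>Meant for \<open>F m\<close> additive in the coefficient. Taking coefficients with
  respect to one variable, deleting monomials and renaming variables are all instances.\<close>

definition extend_additive :: "('k \<Rightarrow> 'c::zero \<Rightarrow> 'd::comm_monoid_add) \<Rightarrow> ('k \<Rightarrow>\<^sub>0 'c) \<Rightarrow> 'd" where
  "extend_additive F p = (\<Sum>m\<in>Poly_Mapping.keys p. F m (Poly_Mapping.lookup p m))"

context
  fixes F :: "'k \<Rightarrow> 'c::comm_monoid_add \<Rightarrow> 'd::comm_monoid_add"
  assumes F0: "\<And>m. F m 0 = 0" and Fadd: "\<And>m a b. F m (a + b) = F m a + F m b"
begin

lemma extend_additive_superset:
  "extend_additive F p = (\<Sum>m\<in>A. F m (Poly_Mapping.lookup p m))" if "finite A" "Poly_Mapping.keys p \<subseteq> A"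
  unfolding extend_additive_def using that
  by (intro sum.mono_neutral_left) (auto simp: F0 in_keys_iff)

lemma extend_additive_add: "extend_additive F (p + q) = extend_additive F p + extend_additive F q"
  by (subst (1 2 3) extend_additive_superset[of "Poly_Mapping.keys p \<union> Poly_Mapping.keys q"])
     (auto simp: lookup_add Fadd sum.distrib dest: Poly_Mapping.keys_add[THEN subsetD])

lemma extend_additive_single: "extend_additive F (Poly_Mapping.single m c) = F m c"
  by (subst extend_additive_superset[of "{m}"]) auto

lemma extend_additive_0: "extend_additive F 0 = 0"
  by (simp add: extend_additive_def)

lemma extend_additive_sum: "extend_additive F (sum f A) = (\<Sum>x\<in>A. extend_additive F (f x))"
  by (induction A rule: infinite_finite_induct) (simp_all add: extend_additive_add extend_additive_0)

end

lemma extend_additive_mult: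
  fixes F :: "'k::comm_monoid_add \<Rightarrow> 'c::comm_ring_1 \<Rightarrow> 'd::comm_ring_1"
  assumes F0: "\<And>m. F m 0 = 0" and Fadd: "\<And>m a b. F m (a + b) = F m a + F m b"
    and Fmult: "\<And>m n a b. F (m + n) (a * b) = F m a * F n b"
  shows "extend_additive F (p * q) = extend_additive F p * extend_additive F q"
proof -
  note E = extend_additive_sum[of F, OF F0 Fadd] extend_additive_single[of F, OF F0 Fadd]
  have "p * q = (\<Sum>m\<in>Poly_Mapping.keys p. \<Sum>n\<in>Poly_Mapping.keys q.
          Poly_Mapping.single (m + n) (Poly_Mapping.lookup p m * Poly_Mapping.lookup q n))"
    by (subst poly_mapping_sum_single[of p], subst poly_mapping_sum_single[of q])
       (simp add: sum_product mult_single)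
  then show ?thesis
    by (simp add: E Fmult) (simp add: extend_additive_def sum_product)
qed

subsection \<open>Adjoining one variable\<close>

definition var_coeff :: "'v \<Rightarrow> nat \<Rightarrow> (('v \<Rightarrow>\<^sub>0 nat) \<Rightarrow>\<^sub>0 'a::comm_ring_1) \<Rightarrow> ('v \<Rightarrow>\<^sub>0 nat) \<Rightarrow>\<^sub>0 'a" where
  "var_coeff v j = extend_additive (\<lambda>m c. if Poly_Mapping.lookup m v = j
     then Poly_Mapping.single (m - Poly_Mapping.single v j) c else 0)"

lemma var_coeff_sum: "var_coeff v j (sum f A) = (\<Sum>x\<in>A. var_coeff v j (f x))"
  unfolding var_coeff_def by (intro extend_additive_sum) (auto simp: single_add)

lemma var_coeff_single: "var_coeff v j (Poly_Mapping.single m c) =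
    (if Poly_Mapping.lookup m v = j then Poly_Mapping.single (m - Poly_Mapping.single v j) c else 0)"
  unfolding var_coeff_def by (subst extend_additive_single) (auto simp: single_add)

lemma var_coeff_mult_Var_power:
  assumes "a \<in> polys W" "v \<notin> W"
  shows "var_coeff v j (a * Var v ^ i) = (if i = j then a else 0)"
proof -
  have "a * Var v ^ i = (\<Sum>m\<in>Poly_Mapping.keys a.
      Poly_Mapping.single (m + Poly_Mapping.single v i) (Poly_Mapping.lookup a m))"
    by (subst poly_mapping_sum_single[of a]) (simp add: sum_distrib_right single_mult_Var_power)
  moreover have "Poly_Mapping.lookup m v = 0" if "m \<in> Poly_Mapping.keys a" for m
    using that assms unfolding polys_def by (metis (mono_tags, lifting) in_keys_iff mem_Collect_eq subsetD)
  ultimately have "var_coeff v j (a * Var v ^ i) = (if i = j then (\<Sum>m\<in>Poly_Mapping.keys a. Poly_Mapping.single m (Poly_Mapping.lookup a m)) else 0)"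
    by (auto simp: var_coeff_sum var_coeff_single lookup_add intro!: sum.cong sum.neutral)
  then show ?thesis by (simp flip: poly_mapping_sum_single)
qed

lemma var_coeff_poly:
  assumes "coeffs_in (polys W) g" "v \<notin> W"
  shows "var_coeff v j (poly g (Var v)) = coeff g j"
  using assms unfolding poly_altdef coeffs_in_def
  by (auto simp: var_coeff_sum var_coeff_mult_Var_power[of _ W] coeff_eq_0)

lemma poly_Var_inject:
  assumes "coeffs_in (polys W) g" "coeffs_in (polys W) h" "v \<notin> W" "poly g (Var v) = poly h (Var v)"
  shows "g = h"
  using assms var_coeff_poly[of W _ v] by (metis poly_eqI)

text \<open>Together with \<open>poly_Var_inject\<close> this identifies
  \<open>polys (insert v W)\<close>, for \<open>v\<close> outside \<open>W\<close>, with the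
  univariate polynomials over \<open>polys W\<close>, so that results about one adjoined element
  apply variable by variable.\<close>

lemma polys_insert_poly:
  assumes "f \<in> polys (insert v W)"
  shows "\<exists>g. coeffs_in (polys W) g \<and> f = poly g (Var v)"
proof -
  have *: "\<exists>g. coeffs_in (polys W) g \<and> (\<Sum>m\<in>M. Poly_Mapping.single m (Poly_Mapping.lookup f m)) = poly g (Var v)"
    if "finite M" "M \<subseteq> Poly_Mapping.keys f" for M
    using that
  proof (induction M rule: finite_induct)
    case empty
    then show ?case by (intro exI[of _ 0]) (auto simp: coeffs_in_ring subring_of_polys)
  next
    case (insert m M)
    then obtain g where g: "coeffs_in (polys W) g" "(\<Sum>m\<in>M. Poly_Mapping.single m (Poly_Mapping.lookup f m)) = poly g (Var v)" by auto
    let ?e = "Poly_Mapping.lookup m v"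
    let ?m = "m - Poly_Mapping.single v ?e"
    have m: "m = ?m + Poly_Mapping.single v ?e"
      by (rule poly_mapping_eqI) (auto simp: lookup_add lookup_minus lookup_single when_def)
    have "Poly_Mapping.keys m \<subseteq> insert v W" using insert.prems assms by (auto simp: polys_def)
    then have "Poly_Mapping.keys ?m \<subseteq> W"
      by (auto simp: subset_iff in_keys_iff lookup_minus lookup_single when_def split: if_splits)
    then have "coeffs_in (polys W) (g + Polynomial.monom (Poly_Mapping.single ?m (Poly_Mapping.lookup f m)) ?e)"
      by (intro coeffs_in_ring subring_of_polys g single_in_polys)
    moreover have "poly (Polynomial.monom (Poly_Mapping.single ?m (Poly_Mapping.lookup f m)) ?e) (Var v)
        = Poly_Mapping.single m (Poly_Mapping.lookup f m)"
      using m by (simp add: poly_monom single_mult_Var_power)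
    ultimately show ?case using insert g
      by (intro exI[of _ "g + Polynomial.monom (Poly_Mapping.single ?m (Poly_Mapping.lookup f m)) ?e"]) (simp add: add.commute)
  qed
  show ?thesis using *[of "Poly_Mapping.keys f"] poly_mapping_sum_single[of f] by simp
qed

text \<open>Take the lowest coefficients of \<open>g\<close> and \<open>h\<close> outside
  \<open>P\<close>, at \<open>i\<close> and \<open>j\<close>. In the coefficient of the product at
  \<open>i + j\<close> every other summand has a factor in \<open>P\<close>, so the product of these
  two would lie in \<open>P\<close>.\<close>

lemma gauss_prime:
  assumes "subring_of A" "prime_in A P" "coeffs_in A g" "coeffs_in A h" "coeffs_in P (g * h)"
  shows "coeffs_in P g \<or> coeffs_in P h"
proof (rule ccontr)
  assume "\<not> ?thesis"
  then have g: "\<exists>i. coeff g i \<notin> P" and h: "\<exists>i. coeff h i \<notin> P" by (auto simp: coeffs_in_def)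
  define i where "i = (LEAST i. coeff g i \<notin> P)"
  define j where "j = (LEAST i. coeff h i \<notin> P)"
  have i: "coeff g i \<notin> P" "\<And>k. k < i \<Longrightarrow> coeff g k \<in> P"
    unfolding i_def using LeastI_ex[OF g] not_less_Least by blast+
  have j: "coeff h j \<notin> P" "\<And>k. k < j \<Longrightarrow> coeff h k \<in> P"
    unfolding j_def using LeastI_ex[OF h] not_less_Least by blast+
  let ?t = "\<lambda>k. coeff g k * coeff h (i + j - k)"
  have "coeff (g * h) (i + j) = ?t i + sum ?t ({..i + j} - {i})"
    unfolding coeff_mult by (rule sum.remove) auto
  moreover have "sum ?t ({..i + j} - {i}) \<in> P"
  proof (rule prime_in_sum[OF assms(2)])
    fix k assume k: "k \<in> {..i + j} - {i}"
    have "coeff g k \<in> A" "coeff h (i + j - k) \<in> A" using assms by (auto simp: coeffs_in_def)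
    moreover have "coeff g k \<in> P \<or> coeff h (i + j - k) \<in> P"
    proof (cases "k < i")
      case False
      then have "i + j - k < j" using k by auto
      then show ?thesis by (intro disjI2 j(2))
    qed (simp add: i(2))
    ultimately show "?t k \<in> P" using prime_inD(5,6)[OF assms(2)] by blast
  qed
  ultimately have "?t i \<in> P" using assms(5) prime_in_diff[OF assms(1,2)]
    unfolding coeffs_in_def by (metis add_diff_cancel_right')
  then show False using i j prime_inD(7)[OF assms(2), of "coeff g i" "coeff h j"] assms(3,4)
    by (auto simp: coeffs_in_def)
qed

text \<open>For \<open>v\<close> outside \<open>W\<close> this is the extension I[v] of an ideal of
  \<open>polys W\<close> to the ring with one more variable.\<close>

definition extended_ideal :: "'v \<Rightarrow> (('v \<Rightarrow>\<^sub>0 nat) \<Rightarrow>\<^sub>0 'a::comm_ring_1) set \<Rightarrow> (('v \<Rightarrow>\<^sub>0 nat) \<Rightarrow>\<^sub>0 'a) set" where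
  "extended_ideal v I = {poly g (Var v) | g. coeffs_in I g}"

lemma poly_in_extended_ideal_iff:
  assumes "coeffs_in (polys W) g" "v \<notin> W" "I \<subseteq> polys W"
  shows "poly g (Var v) \<in> extended_ideal v I \<longleftrightarrow> coeffs_in I g"
  using assms poly_Var_inject[OF assms(1) coeffs_in_mono[OF _ assms(3)] assms(2)]
  by (auto simp: extended_ideal_def)

lemma extended_ideal_contract:
  assumes "f \<in> polys W" "v \<notin> W" "I \<subseteq> polys W" "0 \<in> I"
  shows "f \<in> extended_ideal v I \<longleftrightarrow> f \<in> I"
  using poly_in_extended_ideal_iff[of W "[:f:]" v I] assms
  by (auto simp: coeffs_in_pCons) (auto simp: coeffs_in_def polys_def)

text \<open>Under the identification with univariate polynomials, the primality condition on
  products is \<open>gauss_prime\<close>.\<close>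

lemma extended_ideal_prime:
  fixes I :: "(('v \<Rightarrow>\<^sub>0 nat) \<Rightarrow>\<^sub>0 'a::comm_ring_1) set"
  assumes I: "prime_in (polys W) I" and v: "v \<notin> W"
  shows "prime_in (polys (insert v W)) (extended_ideal v I)"
proof -
  have A: "subring_of (polys W)" "subring_of (polys (insert v W))" by (rule subring_of_polys)+
  note IW = prime_inD(1)[OF I]
  have sub: "polys W \<subseteq> polys (insert v W)" by (rule polys_mono) blast
  have ex: "\<exists>g. coeffs_in (polys W) g \<and> f = poly g (Var v)" if "f \<in> polys (insert v W)" for f :: "('v \<Rightarrow>\<^sub>0 nat) \<Rightarrow>\<^sub>0 'a"
    by (rule polys_insert_poly[OF that])
  have absorb: "coeffs_in I (g * h)" if "coeffs_in (polys W) g" "coeffs_in I h" for g h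
    using that unfolding coeffs_in_def coeff_mult
    by (auto intro!: prime_in_sum[OF I] prime_inD(5)[OF I])
  show ?thesis
    unfolding prime_in_def
  proof (intro conjI ballI impI)
    show "extended_ideal v I \<subseteq> polys (insert v W)"
      using IW sub by (auto simp: extended_ideal_def intro!: poly_in_subring[OF A(2)] Var_in_polys coeffs_in_mono[of I])
    show "0 \<in> extended_ideal v I" unfolding extended_ideal_def
      using prime_inD(2)[OF I] by (auto intro!: exI[of _ 0] simp: coeffs_in_def)
    show "1 \<notin> extended_ideal v I"
      using extended_ideal_contract[OF _ v IW prime_inD(2)[OF I], of 1] prime_inD(3)[OF I] subring_ofD(2)[OF A(1)] by auto
  next
    fix x y assume "x \<in> extended_ideal v I" "y \<in> extended_ideal v I"
    then obtain g h where "coeffs_in I g" "coeffs_in I h" "x = poly g (Var v)" "y = poly h (Var v)"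
      by (auto simp: extended_ideal_def)
    then show "x + y \<in> extended_ideal v I" unfolding extended_ideal_def
      by (auto intro!: exI[of _ "g + h"] prime_inD(4)[OF I] simp: coeffs_in_def)
  next
    fix x y :: "('v \<Rightarrow>\<^sub>0 nat) \<Rightarrow>\<^sub>0 'a"
    assume "x \<in> polys (insert v W)" "y \<in> extended_ideal v I"
    then obtain g h where "coeffs_in (polys W) g" "coeffs_in I h" "x = poly g (Var v)" "y = poly h (Var v)"
      using ex[of x] by (auto simp: extended_ideal_def)
    then show "x * y \<in> extended_ideal v I" unfolding extended_ideal_def
      by (auto intro!: exI[of _ "g * h"] absorb)
  next
    fix x y :: "('v \<Rightarrow>\<^sub>0 nat) \<Rightarrow>\<^sub>0 'a"
    assume "x \<in> polys (insert v W)" "y \<in> polys (insert v W)" and xy: "x * y \<in> extended_ideal v I"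
    then obtain g h where g: "coeffs_in (polys W) g" "x = poly g (Var v)"
      and h: "coeffs_in (polys W) h" "y = poly h (Var v)"
      using ex by metis
    have "coeffs_in I (g * h)"
      using xy poly_in_extended_ideal_iff[OF coeffs_in_ring(4)[OF A(1) g(1) h(1)] v IW] g(2) h(2) by simp
    then have "coeffs_in I g \<or> coeffs_in I h" using gauss_prime[OF A(1) I g(1) h(1)] by simp
    then show "x \<in> extended_ideal v I \<or> y \<in> extended_ideal v I"
      using g h by (auto simp: extended_ideal_def)
  qed
qed

subsection \<open>Ideals generated by constants and variables\<close>

text \<open>The ideal of \<open>polys U\<close> generated by the constants from \<open>r\<close> and the variables from \<open>Z\<close>.\<close>

definition vars_ideal :: "'v set \<Rightarrow> 'a set \<Rightarrow> 'v set \<Rightarrow> (('v \<Rightarrow>\<^sub>0 nat) \<Rightarrow>\<^sub>0 'a::comm_ring_1) set" where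
  "vars_ideal U r Z = {f \<in> polys U. \<forall>m. Poly_Mapping.keys m \<inter> Z = {} \<longrightarrow> Poly_Mapping.lookup f m \<in> r}"

lemma vars_ideal_subset: "vars_ideal U r Z \<subseteq> polys U"
  by (auto simp: vars_ideal_def)

context
  fixes r :: "'a::comm_ring_1 set"
  assumes r: "prime_in UNIV r"
begin

lemma single_in_vars_ideal:
  assumes "Poly_Mapping.keys m \<subseteq> U" "c \<in> r \<or> Poly_Mapping.keys m \<inter> Z \<noteq> {}"
  shows "Poly_Mapping.single m c \<in> vars_ideal U r Z"
  using assms prime_inD(2)[OF r] by (auto simp: vars_ideal_def single_in_polys lookup_single when_def)

lemma vars_ideal_add: "f \<in> vars_ideal U r Z \<Longrightarrow> g \<in> vars_ideal U r Z \<Longrightarrow> f + g \<in> vars_ideal U r Z"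
  using prime_inD(4)[OF r] subring_ofD(4)[OF subring_of_polys[of U]] by (auto simp: vars_ideal_def lookup_add)

lemma vars_ideal_0: "0 \<in> vars_ideal U r Z"
  using prime_inD(2)[OF r] subring_ofD(1)[OF subring_of_polys[of U]] by (auto simp: vars_ideal_def)

lemma vars_ideal_sum: "(\<And>i. i \<in> I \<Longrightarrow> f i \<in> vars_ideal U r Z) \<Longrightarrow> sum f I \<in> vars_ideal U r Z"
  by (induction I rule: infinite_finite_induct) (auto intro: vars_ideal_add vars_ideal_0)

lemma vars_ideal_term:
  assumes "f \<in> vars_ideal U r Z" "m \<in> Poly_Mapping.keys f"
  shows "Poly_Mapping.keys m \<subseteq> U" "Poly_Mapping.lookup f m \<in> r \<or> Poly_Mapping.keys m \<inter> Z \<noteq> {}"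
  using assms by (auto simp: vars_ideal_def polys_def)

lemma vars_ideal_mult:
  assumes p: "p \<in> polys U" and f: "f \<in> vars_ideal U r Z"
  shows "p * f \<in> vars_ideal U r Z"
proof -
  have "p * f = (\<Sum>m\<in>Poly_Mapping.keys p. \<Sum>n\<in>Poly_Mapping.keys f.
          Poly_Mapping.single (m + n) (Poly_Mapping.lookup p m * Poly_Mapping.lookup f n))"
    by (subst poly_mapping_sum_single[of p], subst poly_mapping_sum_single[of f])
       (simp add: sum_product mult_single)
  moreover have "\<dots> \<in> vars_ideal U r Z"
  proof (intro vars_ideal_sum single_in_vars_ideal)
    fix m n assume m: "m \<in> Poly_Mapping.keys p" and n: "n \<in> Poly_Mapping.keys f"
    show "Poly_Mapping.keys (m + n) \<subseteq> U"
      using p m vars_ideal_term[OF f n] by (auto simp: keys_add_nat polys_def)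
    show "Poly_Mapping.lookup p m * Poly_Mapping.lookup f n \<in> r \<or> Poly_Mapping.keys (m + n) \<inter> Z \<noteq> {}"
      using prime_inD(5)[OF r, of "Poly_Mapping.lookup p m" "Poly_Mapping.lookup f n"] vars_ideal_term[OF f n]
      by (auto simp: keys_add_nat)
  qed
  ultimately show ?thesis by simp
qed

text \<open>Lets primality of the ideal generated by \<open>r\<close> be proved by adjoining one
  variable at a time.\<close>

lemma vars_ideal_insert: 
  assumes "v \<notin> W"
  shows "vars_ideal (insert v W) r {} = extended_ideal v (vars_ideal W r {})"
proof (intro equalityI subsetI)
  fix f assume f: "f \<in> vars_ideal (insert v W) r {}"
  then obtain g where g: "coeffs_in (polys W) g" "f = poly g (Var v)"
    using polys_insert_poly[of f v W] by (auto simp: vars_ideal_def)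
  have "coeff g j \<in> vars_ideal W r {}" for j
  proof -
    have "coeff g j = var_coeff v j f" using var_coeff_poly[OF g(1) assms] g(2) by simp
    also have "\<dots> = (\<Sum>m\<in>Poly_Mapping.keys f. if Poly_Mapping.lookup m v = j
       then Poly_Mapping.single (m - Poly_Mapping.single v j) (Poly_Mapping.lookup f m) else 0)"
      by (simp add: var_coeff_def extend_additive_def)
    also have "\<dots> \<in> vars_ideal W r {}"
    proof (intro vars_ideal_sum)
      fix m assume m: "m \<in> Poly_Mapping.keys f"
      have "Poly_Mapping.keys (m - Poly_Mapping.single v j) \<subseteq> W" if "Poly_Mapping.lookup m v = j"
        using vars_ideal_term(1)[OF f m] that
        by (auto simp: subset_iff in_keys_iff lookup_minus lookup_single when_def split: if_splits)
      then show "(if Poly_Mapping.lookup m v = j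
       then Poly_Mapping.single (m - Poly_Mapping.single v j) (Poly_Mapping.lookup f m) else 0) \<in> vars_ideal W r {}"
        using vars_ideal_term(2)[OF f m] by (auto intro!: single_in_vars_ideal vars_ideal_0)
    qed
    finally show ?thesis .
  qed
  then show "f \<in> extended_ideal v (vars_ideal W r {})" using g(2) by (auto simp: extended_ideal_def coeffs_in_def)
next
  fix f assume "f \<in> extended_ideal v (vars_ideal W r {})"
  then obtain g where g: "coeffs_in (vars_ideal W r {}) g" "f = poly g (Var v)" by (auto simp: extended_ideal_def)
  have "vars_ideal W r {} \<subseteq> vars_ideal (insert v W) r {}"
    using polys_mono[of W "insert v W"] by (auto simp: vars_ideal_def)
  then have c: "coeff g i \<in> vars_ideal (insert v W) r {}" for i using g(1) by (auto simp: coeffs_in_def)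
  have "f = (\<Sum>i\<le>degree g. Var v ^ i * coeff g i)" by (simp add: g(2) poly_altdef mult.commute)
  also have "\<dots> \<in> vars_ideal (insert v W) r {}"
    by (intro vars_ideal_sum vars_ideal_mult c subring_of_power subring_of_polys Var_in_polys) simp
  finally show "f \<in> vars_ideal (insert v W) r {}" .
qed

lemma vars_ideal_prime_finite: "finite W \<Longrightarrow> prime_in (polys W) (vars_ideal W r {})"
proof (induction W rule: finite_induct)
  case empty
  have c: "f = Const (Poly_Mapping.lookup f 0)" if "f \<in> polys {}" for f :: "('b \<Rightarrow>\<^sub>0 nat) \<Rightarrow>\<^sub>0 'a"
    using that by (intro poly_mapping_eqI) (auto simp: polys_def lookup_single when_def in_keys_iff)
  have iff: "Const a \<in> (vars_ideal {} r {} :: (('b \<Rightarrow>\<^sub>0 nat) \<Rightarrow>\<^sub>0 'a) set) \<longleftrightarrow> a \<in> r" for a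
    using prime_inD(2)[OF r] by (auto simp: vars_ideal_def single_in_polys lookup_single when_def)
  show ?case
    unfolding prime_in_def
  proof (intro conjI ballI impI)
    show "1 \<notin> (vars_ideal {} r {} :: (('b \<Rightarrow>\<^sub>0 nat) \<Rightarrow>\<^sub>0 'a) set)" using iff[of 1] prime_inD(3)[OF r] by simp
    fix x y :: "('b \<Rightarrow>\<^sub>0 nat) \<Rightarrow>\<^sub>0 'a" assume *: "x \<in> polys {}" "y \<in> polys {}" "x * y \<in> vars_ideal {} r {}"
    obtain a b where "x = Const a" "y = Const b" using c *(1,2) by blast
    then show "x \<in> vars_ideal {} r {} \<or> y \<in> vars_ideal {} r {}"
      using *(3) iff prime_inD(7)[OF r, of a b] by (auto simp: mult_single)
  qed (auto intro: vars_ideal_add vars_ideal_0 vars_ideal_mult simp: vars_ideal_subset[THEN subsetD])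
next
  case (insert v W)
  then show ?case using extended_ideal_prime[of W "vars_ideal W r {}" v] by (simp add: vars_ideal_insert)
qed

text \<open>Deleting the monomials that meet \<open>Z\<close> is a ring homomorphism, and membership
  means that the remaining coefficients lie in \<open>r\<close>. Two polynomials involve only
  finitely many variables, so the finite case with empty \<open>Z\<close> applies to their
  images.\<close>

lemma vars_ideal_prime: "prime_in (polys U) (vars_ideal U r Z)"
  unfolding prime_in_def
proof (intro conjI ballI impI)
  show "1 \<notin> vars_ideal U r Z" using prime_inD(3)[OF r] by (auto simp: vars_ideal_def intro!: exI[of _ 0])
  fix f g :: "('b \<Rightarrow>\<^sub>0 nat) \<Rightarrow>\<^sub>0 'a" assume f: "f \<in> polys U" and g: "g \<in> polys U" and fg: "f * g \<in> vars_ideal U r Z"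
  define \<pi> where "\<pi> = extend_additive (\<lambda>(m :: 'b \<Rightarrow>\<^sub>0 nat) (c :: 'a). if Poly_Mapping.keys m \<inter> Z = {} then Poly_Mapping.single m c else 0)"
  have lookup: "Poly_Mapping.lookup (\<pi> h) m = (if Poly_Mapping.keys m \<inter> Z = {} then Poly_Mapping.lookup h m else 0)" for h m
  proof -
    have "Poly_Mapping.lookup (\<pi> h) m = (\<Sum>k\<in>Poly_Mapping.keys h. if m = k then
        (if Poly_Mapping.keys m \<inter> Z = {} then Poly_Mapping.lookup h m else 0) else 0)"
      unfolding \<pi>_def extend_additive_def lookup_sum
      by (intro sum.cong) (auto simp: lookup_single when_def)
    then show ?thesis by (simp add: in_keys_iff)
  qed
  have mult: "\<pi> (f * g) = \<pi> f * \<pi> g"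
    unfolding \<pi>_def by (rule extend_additive_mult) (auto simp: single_add mult_single keys_add_nat)
  obtain V1 V2 where "finite V1" "f \<in> polys V1" "finite V2" "g \<in> polys V2" using polys_finite_support f g by metis
  then obtain W where W: "finite W" "f \<in> polys W" "g \<in> polys W"
    using polys_mono[of V1 "V1 \<union> V2"] polys_mono[of V2 "V1 \<union> V2"] by (metis finite_Un inf_sup_ord(3,4) subsetD)
  have \<pi>W: "\<pi> h \<in> polys W" if "h \<in> polys W" for h
    using that lookup by (auto simp: polys_def in_keys_iff split: if_splits)
  have "\<pi> f * \<pi> g \<in> vars_ideal W r {}"
    using fg prime_inD(2)[OF r] subring_ofD(6)[OF subring_of_polys \<pi>W[OF W(2)] \<pi>W[OF W(3)]] lookup[of "f * g"] mult by (auto simp: vars_ideal_def)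
  then have "\<pi> f \<in> vars_ideal W r {} \<or> \<pi> g \<in> vars_ideal W r {}"
    using prime_inD(7)[OF vars_ideal_prime_finite[OF W(1)] \<pi>W \<pi>W] W by blast
  then have "(\<forall>m. Poly_Mapping.lookup (\<pi> f) m \<in> r) \<or> (\<forall>m. Poly_Mapping.lookup (\<pi> g) m \<in> r)" by (auto simp: vars_ideal_def)
  then show "f \<in> vars_ideal U r Z \<or> g \<in> vars_ideal U r Z"
    using f g unfolding lookup vars_ideal_def mem_Collect_eq by metis
qed (auto intro: vars_ideal_add vars_ideal_0 vars_ideal_mult simp: vars_ideal_subset[THEN subsetD])

end

section \<open>Algebraic dependence modulo a prime\<close>

definition alg_dep :: "(('v \<Rightarrow>\<^sub>0 nat) \<Rightarrow>\<^sub>0 'a::comm_ring_1) set \<Rightarrow> 'v set \<Rightarrow> 'v \<Rightarrow> bool" where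
  "alg_dep s T v \<longleftrightarrow> (\<exists>g. alg_rel (polys T) (Var v) s g)"

lemma alg_dep_mono: "alg_dep s T v \<Longrightarrow> T \<subseteq> T' \<Longrightarrow> alg_dep s T' v"
  unfolding alg_dep_def alg_rel_def using coeffs_in_mono[OF _ polys_mono] by blast

definition base_prime :: "(('v \<Rightarrow>\<^sub>0 nat) \<Rightarrow>\<^sub>0 'a::comm_ring_1) set \<Rightarrow> 'a set" where
  "base_prime P = {c. Const c \<in> P}"

text \<open>Algebraic independence of the residues of \<open>B\<close> over the residue field of
  \<open>base_prime P\<close>: a polynomial in \<open>B\<close> lies in \<open>P\<close> only
  because all its coefficients do.\<close>

definition alg_indep :: "(('v \<Rightarrow>\<^sub>0 nat) \<Rightarrow>\<^sub>0 'a::comm_ring_1) set \<Rightarrow> 'v set \<Rightarrow> bool" where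
  "alg_indep P B \<longleftrightarrow> P \<inter> polys B \<subseteq> vars_ideal B (base_prime P) {}"

lemma alg_indep_subset: "alg_indep P B \<Longrightarrow> C \<subseteq> B \<Longrightarrow> alg_indep P C"
  unfolding alg_indep_def vars_ideal_def using polys_mono[of C B] by blast

lemma base_prime_prime:
  assumes "prime_in (polys U) P"
  shows "prime_in UNIV (base_prime P)"
proof -
  have "Const c \<in> polys U" for c :: 'b by (simp add: single_in_polys)
  moreover have "(Const (a * b) :: ('a \<Rightarrow>\<^sub>0 nat) \<Rightarrow>\<^sub>0 'b) = Const a * Const b" for a b
    by (simp add: mult_single)
  ultimately show ?thesis
    unfolding prime_in_def[of UNIV] base_prime_def mem_Collect_eq single_add single_one single_zero
    using prime_inD(2,3)[OF assms] prime_inD(7)[OF assms, of "Const _" "Const _"]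
    by (auto intro: prime_inD(4,5)[OF assms])
qed

section \<open>Algebraic dependence modulo a prime: transitivity, exchange and bases\<close>

context
  fixes U :: "'v set" and P :: "(('v \<Rightarrow>\<^sub>0 nat) \<Rightarrow>\<^sub>0 'a::comm_ring_1) set"
  assumes P: "prime_in (polys U) P"
begin

lemma alg_dep_self: "v \<in> T \<Longrightarrow> alg_dep P T v"
  using prime_inD(2,3)[OF P] subring_ofD(1,2)[OF subring_of_polys[of T]]
    subring_ofD(3)[OF subring_of_polys Var_in_polys[of v T]]
  unfolding alg_dep_def alg_rel_def
  by (intro exI[of _ "[:- Var v, 1:]"]) (auto simp: coeffs_in_pCons coeffs_in_ring subring_of_polys intro!: exI[of _ "Suc 0"])

text \<open>If \<open>x\<close> were not dependent on \<open>T\<close>, compare on R[T, x, y] the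
  prime \<open>P\<close> with the extension \<open>?Q\<close> of its part in R[T, y]. They agree on
  R[T, x], and \<open>y\<close> is algebraic over that ring modulo \<open>?Q\<close>, so
  incomparability makes them equal. But the relation for \<open>x\<close> over R[T, y] has its value
  in \<open>P\<close> and not in the extension.\<close>

lemma alg_dep_trans:
  assumes U: "insert x (insert y T) \<subseteq> U" and y: "alg_dep P T y" and x: "alg_dep P (insert y T) x"
  shows "alg_dep P T x"
proof (rule ccontr)
  assume nx: "\<not> alg_dep P T x"
  have "x \<notin> T" using nx alg_dep_self by blast
  moreover have "y \<notin> T" using nx x by (metis insert_absorb)
  moreover have "x \<noteq> y" using nx y by blast
  ultimately have xn: "x \<notin> insert y T" by blast
  let ?A = "polys (insert x T) :: (('v \<Rightarrow>\<^sub>0 nat) \<Rightarrow>\<^sub>0 'a) set"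
  let ?B = "polys (insert x (insert y T)) :: (('v \<Rightarrow>\<^sub>0 nat) \<Rightarrow>\<^sub>0 'a) set"
  let ?b = "P \<inter> polys (insert y T)"
  let ?Q = "extended_ideal x ?b"
  have B: "?B = polys (insert y (insert x T))" by (simp add: insert_commute)
  have bpr: "prime_in (polys (insert y T)) ?b"
    using prime_in_contract[OF P subring_of_polys polys_mono] U by simp
  have Q: "prime_in ?B ?Q" by (rule extended_ideal_prime[OF bpr xn])
  have PB: "prime_in ?B (P \<inter> ?B)"
    using prime_in_contract[OF P subring_of_polys polys_mono[OF U]] .
  have TyT: "polys T \<subseteq> (polys (insert y T) :: (('v \<Rightarrow>\<^sub>0 nat) \<Rightarrow>\<^sub>0 'a) set)" by (rule polys_mono) blast
  have QP: "?Q \<subseteq> P \<inter> ?B"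
  proof
    fix f assume f: "f \<in> ?Q"
    then obtain g where g: "coeffs_in ?b g" "f = poly g (Var x)" by (auto simp: extended_ideal_def)
    have "f \<in> P" unfolding g(2)
      by (rule poly_in_prime[OF subring_of_polys P]) (use g U in \<open>auto simp: coeffs_in_def Var_in_polys\<close>)
    then show "f \<in> P \<inter> ?B" using f prime_inD(1)[OF Q] by blast
  qed
  have "P \<inter> ?B \<subseteq> ?Q"
  proof -
    obtain g0 where g0: "alg_rel (polys T) (Var y) P g0" using y by (auto simp: alg_dep_def)
    have g0A: "coeffs_in ?A g0" using g0 polys_mono[of T "insert x T"] by (auto simp: alg_rel_def coeffs_in_def)
    have "poly g0 (Var y) \<in> polys (insert y T)"
      by (rule poly_in_subring[OF subring_of_polys])
         (use g0 polys_mono[of T "insert y T"] in \<open>auto simp: alg_rel_def coeffs_in_def Var_in_polys\<close>)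
    then have "poly g0 (Var y) \<in> ?Q"
      using extended_ideal_contract[OF _ xn prime_inD(1,2)[OF bpr]] g0 by (auto simp: alg_rel_def)
    then have g0Q: "alg_rel ?A (Var y) ?Q g0" using g0 g0A QP by (auto simp: alg_rel_def)
    \<comment> \<open>Since \<open>x\<close> does not depend on \<open>T\<close>, a polynomial in
      \<open>x\<close> over R[T] lies in \<open>P\<close> only if all its coefficients do.\<close>
    have cA: "(P \<inter> ?B) \<inter> ?A \<subseteq> ?Q"
    proof
      fix f assume f: "f \<in> (P \<inter> ?B) \<inter> ?A"
      then obtain g where g: "coeffs_in (polys T) g" "f = poly g (Var x)" using polys_insert_poly[of f x T] by auto
      have "coeff g i \<in> P" for i using nx f g by (auto simp: alg_dep_def alg_rel_def)
      then have "coeffs_in ?b g" using g(1) TyT by (auto simp: coeffs_in_def)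
      then show "f \<in> ?Q" using g(2) by (auto simp: extended_ideal_def)
    qed
    show ?thesis
    proof (rule incomparability[where A = ?A and B = ?B and y = "Var y", OF _ _ _ _ _ PB Q QP cA g0Q])
      show "?A \<subseteq> ?B" by (rule polys_mono) blast
      show "\<And>b. b \<in> ?B \<Longrightarrow> \<exists>g. coeffs_in ?A g \<and> b = poly g (Var y)"
        unfolding B by (rule polys_insert_poly)
    qed (auto simp: subring_of_polys Var_in_polys)
  qed
  moreover obtain g1 where g1: "coeffs_in (polys (insert y T)) g1" "poly g1 (Var x) \<in> P" "\<exists>i. coeff g1 i \<notin> P"
    using x by (auto simp: alg_dep_def alg_rel_def)
  moreover have "poly g1 (Var x) \<in> ?B"
    by (rule poly_in_subring[OF subring_of_polys])
       (use g1(1) polys_mono[of "insert y T" "insert x (insert y T)"] in \<open>auto simp: coeffs_in_def Var_in_polys\<close>)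
  ultimately have "poly g1 (Var x) \<in> ?Q" by blast
  then have "coeffs_in ?b g1"
    using poly_in_extended_ideal_iff[OF g1(1) xn, of ?b] by simp
  then show False using g1(3) by (auto simp: coeffs_in_def)
qed

lemma alg_dep_trans_set:
  assumes "finite Y" "Y \<union> T \<subseteq> U" "x \<in> U" "\<And>y. y \<in> Y \<Longrightarrow> alg_dep P T y" "alg_dep P Y x"
  shows "alg_dep P T x"
proof -
  have "alg_dep P (T \<union> Y) x \<Longrightarrow> alg_dep P T x"
    using assms(1,2,4)
  proof (induction Y rule: finite_induct)
    case (insert y Y)
    have "alg_dep P (T \<union> Y) y" using insert.prems(3)[of y] alg_dep_mono[of P T y "T \<union> Y"] by blast
    then have "alg_dep P (T \<union> Y) x"
      using insert.prems assms(3) by (intro alg_dep_trans[of x y "T \<union> Y"]) auto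
    then show ?case using insert by blast
  qed simp
  then show ?thesis using alg_dep_mono[OF assms(5), of "T \<union> Y"] by blast
qed

lemma base_prime: "prime_in UNIV (base_prime P)"
  by (rule base_prime_prime[OF P])

lemma vars_ideal_subset_prime: "B \<subseteq> U \<Longrightarrow> vars_ideal B (base_prime P) {} \<subseteq> P"
proof
  fix f assume B: "B \<subseteq> U" and f: "f \<in> vars_ideal B (base_prime P) {}"
  have "Poly_Mapping.single m (Poly_Mapping.lookup f m) \<in> P" if "m \<in> Poly_Mapping.keys f" for m
  proof -
    have "Poly_Mapping.keys m \<subseteq> U" using vars_ideal_term(1)[OF base_prime f that] B by blast
    then have "Poly_Mapping.single m 1 \<in> polys U" by (rule single_in_polys)
    moreover have "Const (Poly_Mapping.lookup f m) \<in> P"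
      using f unfolding vars_ideal_def base_prime_def by blast
    ultimately have "Poly_Mapping.single m 1 * Const (Poly_Mapping.lookup f m) \<in> P"
      by (rule prime_inD(5)[OF P])
    then show ?thesis unfolding mult_single by simp
  qed
  then have "(\<Sum>m\<in>Poly_Mapping.keys f. Poly_Mapping.single m (Poly_Mapping.lookup f m)) \<in> P"
    by (rule prime_in_sum[OF P])
  then show "f \<in> P" by (simp flip: poly_mapping_sum_single)
qed

lemma alg_indep_empty: "alg_indep P {}"
proof -
  have c: "f = Const (Poly_Mapping.lookup f 0)" if "f \<in> polys {}" for f :: "('v \<Rightarrow>\<^sub>0 nat) \<Rightarrow>\<^sub>0 'a"
    using that by (intro poly_mapping_eqI) (auto simp: polys_def lookup_single when_def in_keys_iff)
  show ?thesis
    unfolding alg_indep_def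
  proof
    fix f assume f: "f \<in> P \<inter> polys {}"
    then obtain a where a: "f = Const a" using c by blast
    then have "a \<in> base_prime P" using f by (simp add: base_prime_def)
    then show "f \<in> vars_ideal {} (base_prime P) {}"
      unfolding a by (intro single_in_vars_ideal[OF base_prime]) auto
  qed
qed

lemma alg_indep_insert:
  assumes "alg_indep P B" "\<not> alg_dep P B v"
  shows "alg_indep P (insert v B)"
  unfolding alg_indep_def
proof
  fix f assume f: "f \<in> P \<inter> polys (insert v B)"
  have v: "v \<notin> B" using assms(2) alg_dep_self by blast
  obtain g where g: "coeffs_in (polys B) g" "f = poly g (Var v)" using f polys_insert_poly[of f v B] by auto
  have "coeff g i \<in> P" for i using assms(2) f g by (auto simp: alg_dep_def alg_rel_def)
  then have "coeffs_in (vars_ideal B (base_prime P) {}) g"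
    using g(1) assms(1) by (auto simp: coeffs_in_def alg_indep_def)
  then show "f \<in> vars_ideal (insert v B) (base_prime P) {}"
    using g(2) by (auto simp: vars_ideal_insert[OF base_prime v] extended_ideal_def)
qed

lemma alg_indep_not_dep:
  assumes "alg_indep P (insert v C)" "v \<notin> C" "insert v C \<subseteq> U"
  shows "\<not> alg_dep P C v"
proof
  assume "alg_dep P C v"
  then obtain g where g: "coeffs_in (polys C) g" "poly g (Var v) \<in> P" "\<exists>i. coeff g i \<notin> P"
    by (auto simp: alg_dep_def alg_rel_def)
  have "poly g (Var v) \<in> polys (insert v C)"
    by (rule poly_in_subring[OF subring_of_polys])
       (use g(1) polys_mono[of C "insert v C"] in \<open>auto simp: coeffs_in_def Var_in_polys\<close>)
  then have "poly g (Var v) \<in> extended_ideal v (vars_ideal C (base_prime P) {})"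
    using assms(1) g(2) by (auto simp: alg_indep_def vars_ideal_insert[OF base_prime assms(2), symmetric])
  then have "coeffs_in (vars_ideal C (base_prime P) {}) g"
    using poly_in_extended_ideal_iff[OF g(1) assms(2) vars_ideal_subset] by simp
  then show False using g(3) vars_ideal_subset_prime[of C] assms(3) by (auto simp: coeffs_in_def)
qed

text \<open>Induction on the number of elements of \<open>C\<close> outside \<open>T\<close>. For
  such a \<open>v\<close>, the rest \<open>D\<close> of \<open>C\<close> cannot span
  \<open>T\<close>, since then \<open>v\<close> would depend on \<open>D\<close> by transitivity. So
  \<open>v\<close> can be exchanged for some \<open>t\<close> in \<open>T\<close> that does not
  depend on \<open>D\<close>, which keeps both independence and cardinality.\<close>

lemma steinitz:
  assumes "alg_indep P C" "finite C" "finite T" "C \<union> T \<subseteq> U" "\<And>v. v \<in> C \<Longrightarrow> alg_dep P T v"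
  shows "card C \<le> card T"
  using assms
proof (induction "card (C - T)" arbitrary: C rule: less_induct)
  case less
  show ?case
  proof (cases "C \<subseteq> T")
    case True
    then show ?thesis using less.prems by (intro card_mono)
  next
    case False
    then obtain v where v: "v \<in> C" "v \<notin> T" by blast
    define D where "D = C - {v}"
    have CD: "C = insert v D" "v \<notin> D" using v by (auto simp: D_def)
    have nv: "\<not> alg_dep P D v" using alg_indep_not_dep[of v D] less.prems CD by auto
    obtain t where t: "t \<in> T" "\<not> alg_dep P D t"
    proof (rule ccontr)
      assume "\<not> thesis"
      with that have "\<And>t. t \<in> T \<Longrightarrow> alg_dep P D t" by blast
      then have "alg_dep P D v"
        using less.prems(4) CD v(1) by (intro alg_dep_trans_set[OF less.prems(3) _ _ _ less.prems(5)[OF v(1)]]) auto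
      then show False using nv by blast
    qed
    have tD: "t \<notin> D" using t(2) alg_dep_self[of t D] by blast
    let ?C = "insert t D"
    have "card ?C \<le> card T"
    proof (rule less.hyps)
      have "?C - T = D - T" using t(1) by auto
      moreover have "C - T = insert v (D - T)" using v(2) by (subst CD(1)) auto
      ultimately have "?C - T \<subset> C - T" using CD(2) by auto
      then show "card (?C - T) < card (C - T)" using less.prems(2) by (intro psubset_card_mono) auto
      show "alg_indep P ?C" by (rule alg_indep_insert[OF alg_indep_subset[OF less.prems(1)] t(2)]) (use CD(1) in blast)
      show "finite ?C" "finite T" "?C \<union> T \<subseteq> U" using less.prems(2-4) CD t by auto
      show "alg_dep P T w" if "w \<in> ?C" for w
        using that less.prems(5)[of w] CD t alg_dep_self[of w T] by blast
    qed
    then show ?thesis using CD tD less.prems(2) by simp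
  qed
qed

text \<open>An independent subset of largest cardinality works, since an element not depending on it
  could be adjoined.\<close>

lemma ex_basis:
  assumes "finite V"
  obtains C where "C \<subseteq> V" "alg_indep P C" "\<And>v. v \<in> V \<Longrightarrow> alg_dep P C v"
proof -
  let ?S = "{C. C \<subseteq> V \<and> alg_indep P C}"
  have "finite (card ` ?S)" "card ` ?S \<noteq> {}" using assms alg_indep_empty by auto
  then obtain C where C: "C \<subseteq> V" "alg_indep P C" "card C = Max (card ` ?S)"
    using Max_in[of "card ` ?S"] by (smt (verit) imageE mem_Collect_eq)
  have max: "card C' \<le> card C" if "C' \<subseteq> V" "alg_indep P C'" for C'
    unfolding C(3) using that \<open>finite (card ` ?S)\<close> by (intro Max_ge) auto
  have "alg_dep P C v" if v: "v \<in> V" for v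
  proof (rule ccontr)
    assume n: "\<not> alg_dep P C v"
    then have "v \<notin> C" using alg_dep_self by blast
    then show False using max[of "insert v C"] alg_indep_insert[OF C(2) n] v C(1) finite_subset[OF C(1) assms] by simp
  qed
  then show ?thesis using that C by blast
qed

end

text \<open>Independence confines the part of \<open>P\<close> in R[B] to polynomials with
  coefficients in its contraction, which lies in that of \<open>Q\<close>. The variables of
  \<open>V\<close>, dependent on \<open>B\<close> modulo \<open>Q\<close>, are then adjoined one at
  a time by incomparability.\<close>

lemma prime_eq_of_spanning_indep:
  assumes P: "prime_in (polys U) P" and Q: "prime_in (polys U) Q" and QP: "Q \<subseteq> P"
    and base: "base_prime P \<subseteq> base_prime Q" and B: "alg_indep P B" "B \<subseteq> U"
    and V: "finite V" "V \<subseteq> U" and dep: "\<And>v. v \<in> V \<Longrightarrow> alg_dep Q B v"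
  shows "P \<inter> polys (B \<union> V) \<subseteq> Q"
  using V dep
proof (induction V rule: finite_induct)
  case empty
  have "P \<inter> polys B \<subseteq> vars_ideal B (base_prime P) {}" using B by (simp add: alg_indep_def)
  also have "\<dots> \<subseteq> vars_ideal B (base_prime Q) {}" using base by (auto simp: vars_ideal_def)
  also have "\<dots> \<subseteq> Q" by (rule vars_ideal_subset_prime[OF Q B(2)])
  finally show ?case by simp
next
  case (insert y V)
  let ?W = "insert y (B \<union> V)"
  have W: "?W \<subseteq> U" using insert B by auto
  let ?A = "polys (B \<union> V) :: (('a \<Rightarrow>\<^sub>0 nat) \<Rightarrow>\<^sub>0 'b) set" and ?B = "polys ?W :: (('a \<Rightarrow>\<^sub>0 nat) \<Rightarrow>\<^sub>0 'b) set"
  obtain g where g: "alg_rel ?A (Var y) Q g"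
    using alg_dep_mono[OF insert.prems(2)[of y], of "B \<union> V"] by (auto simp: alg_dep_def)
  have "poly g (Var y) \<in> ?B"
    by (rule poly_in_subring[OF subring_of_polys])
       (use g polys_mono[of "B \<union> V" ?W] in \<open>auto simp: alg_rel_def coeffs_in_def Var_in_polys\<close>)
  then have g': "alg_rel ?A (Var y) (Q \<inter> ?B) g" using g by (auto simp: alg_rel_def)
  have AB: "?A \<subseteq> ?B" by (rule polys_mono) blast
  have "P \<inter> ?B \<subseteq> Q \<inter> ?B"
  proof (rule incomparability[where A = ?A and B = ?B and y = "Var y", OF _ _ _ _ _ _ _ _ _ g'])
    show "prime_in ?B (P \<inter> ?B)" by (rule prime_in_contract[OF P subring_of_polys polys_mono[OF W]])
    show "prime_in ?B (Q \<inter> ?B)" by (rule prime_in_contract[OF Q subring_of_polys polys_mono[OF W]])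
    show "P \<inter> ?B \<inter> ?A \<subseteq> Q \<inter> ?B" using insert AB by auto
  qed (use QP AB polys_insert_poly in \<open>auto simp: subring_of_polys Var_in_polys\<close>)
  then show ?case by simp
qed

section \<open>Chains of primes and the Jaffard property\<close>

text \<open>The height of the prime \<open>I\<close> is at least \<open>h\<close>. The recursive
  form allows chains to be lengthened at the top.\<close>

fun ht_ge :: "'b::comm_ring_1 set \<Rightarrow> nat \<Rightarrow> 'b set \<Rightarrow> bool" where
  "ht_ge A 0 I \<longleftrightarrow> prime_in A I"
| "ht_ge A (Suc h) I \<longleftrightarrow> prime_in A I \<and> (\<exists>J. J \<subset> I \<and> ht_ge A h J)"

lemma ht_ge_prime: "ht_ge A h I \<Longrightarrow> prime_in A I"
  by (cases h) auto

lemma ht_ge_mono: "ht_ge A h J \<Longrightarrow> J \<subseteq> I \<Longrightarrow> prime_in A I \<Longrightarrow> ht_ge A h I"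
proof (cases h)
  case (Suc k)
  moreover assume "ht_ge A h J" "J \<subseteq> I" "prime_in A I"
  ultimately show ?thesis unfolding Suc ht_ge.simps by (meson psubset_subset_trans)
qed simp

lemma ht_ge_chain:
  "ht_ge A h I \<Longrightarrow> \<exists>p. p 0 = I \<and> (\<forall>i\<le>h. prime_in A (p i)) \<and> (\<forall>i<h. p (Suc i) \<subset> p i)"
proof (induction h arbitrary: I)
  case 0
  then show ?case by (intro exI[of _ "\<lambda>_. I"]) simp
next
  case (Suc h)
  then obtain J where J: "J \<subset> I" "ht_ge A h J" unfolding ht_ge.simps by blast
  with Suc.IH[OF J(2)] obtain p where p: "J \<subset> I" "p 0 = J" "\<forall>i\<le>h. prime_in A (p i)" "\<forall>i<h. p (Suc i) \<subset> p i"
    by blast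
  have "prime_in A I" using Suc.prems by simp
  then have "\<forall>i\<le>Suc h. prime_in A (case i of 0 \<Rightarrow> I | Suc i \<Rightarrow> p i)" using p(3) by (simp split: nat.split)
  moreover have "\<forall>i<Suc h. (case Suc i of 0 \<Rightarrow> I | Suc i \<Rightarrow> p i) \<subset> (case i of 0 \<Rightarrow> I | Suc i \<Rightarrow> p i)"
    using p(1,2,4) by (simp split: nat.split)
  ultimately show ?case by (intro exI[of _ "case_nat I p"]) simp
qed

text \<open>Extended ideals contract back to the original ones, so a strict chain stays strict after
  extension.\<close>

lemma ht_ge_extended_ideal:
  assumes "v \<notin> W"
  shows "ht_ge (polys W) h I \<Longrightarrow> ht_ge (polys (insert v W)) h (extended_ideal v I)"
proof (induction h arbitrary: I)
  case 0
  then show ?case using extended_ideal_prime[OF _ assms] by simp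
next
  case (Suc h)
  then obtain J where J: "J \<subset> I" "ht_ge (polys W) h J" and I: "prime_in (polys W) I" by auto
  have Jp: "prime_in (polys W) J" by (rule ht_ge_prime[OF J(2)])
  obtain f where f: "f \<in> I" "f \<notin> J" using J by blast
  have fW: "f \<in> polys W" using f prime_inD(1)[OF I] by blast
  have "f \<in> extended_ideal v I" "f \<notin> extended_ideal v J"
    using f extended_ideal_contract[OF fW assms prime_inD(1,2)[OF I]]
      extended_ideal_contract[OF fW assms prime_inD(1,2)[OF Jp]] by auto
  moreover have "extended_ideal v J \<subseteq> extended_ideal v I"
    using J(1) by (auto simp: extended_ideal_def coeffs_in_def)
  ultimately have "extended_ideal v J \<subset> extended_ideal v I" by blast
  then show ?case using Suc.IH[OF J(2)] extended_ideal_prime[OF I assms] by auto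
qed

text \<open>Each dependent variable adds one step: the value of its relation lies in the contraction
  of \<open>P\<close> to the larger ring, but not in the extension of the contraction to the smaller
  ring, as some coefficient is outside \<open>P\<close>.\<close>

lemma ht_ge_dependent:
  assumes P: "prime_in (polys U) P" and C: "C \<subseteq> U"
    and D: "finite D" "D \<subseteq> U" "D \<inter> C = {}" "\<And>v. v \<in> D \<Longrightarrow> alg_dep P C v"
  shows "ht_ge (polys (C \<union> D)) (card D) (P \<inter> polys (C \<union> D))"
  using D
proof (induction D rule: finite_induct)
  case empty
  then show ?case using prime_in_contract[OF P subring_of_polys polys_mono[OF C]] by simp
next
  case (insert v D)
  let ?W = "C \<union> D"
  have W: "insert v ?W \<subseteq> U" "?W \<subseteq> U" "v \<notin> ?W" using insert C by auto
  let ?I = "P \<inter> polys ?W" and ?I' = "P \<inter> polys (insert v ?W)"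
  have I: "ht_ge (polys ?W) (card D) ?I" using insert by auto
  have Ip: "prime_in (polys ?W) ?I" by (rule ht_ge_prime[OF I])
  have I': "prime_in (polys (insert v ?W)) ?I'" by (rule prime_in_contract[OF P subring_of_polys polys_mono[OF W(1)]])
  have sub: "extended_ideal v ?I \<subseteq> ?I'"
  proof
    fix f assume f: "f \<in> extended_ideal v ?I"
    then obtain g where g: "coeffs_in ?I g" "f = poly g (Var v)" by (auto simp: extended_ideal_def)
    have "f \<in> P" unfolding g(2)
      by (rule poly_in_prime[OF subring_of_polys P]) (use g W in \<open>auto simp: coeffs_in_def Var_in_polys\<close>)
    then show "f \<in> ?I'" using f prime_inD(1)[OF extended_ideal_prime[OF Ip W(3)]] by blast
  qed
  obtain g where g: "alg_rel (polys ?W) (Var v) P g"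
    using alg_dep_mono[OF insert.prems(3)[of v], of ?W] by (auto simp: alg_dep_def)
  have "poly g (Var v) \<in> polys (insert v ?W)"
    by (rule poly_in_subring[OF subring_of_polys])
       (use g polys_mono[of ?W "insert v ?W"] in \<open>auto simp: alg_rel_def coeffs_in_def Var_in_polys\<close>)
  then have "poly g (Var v) \<in> ?I'" using g by (auto simp: alg_rel_def)
  moreover have "poly g (Var v) \<notin> extended_ideal v ?I"
    using poly_in_extended_ideal_iff[OF _ W(3), of g ?I] g by (auto simp: alg_rel_def coeffs_in_def)
  ultimately have "extended_ideal v ?I \<subset> ?I'" using sub by blast
  then have "ht_ge (polys (insert v ?W)) (Suc (card D)) ?I'"
    using ht_ge_extended_ideal[OF W(3) I] I' by auto
  then show ?case using insert by simp
qed

text \<open>The variables of \<open>Y\<close> are added to the ideal one at a time, and none of them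
  lies in the ideal reached before it.\<close>

lemma ht_ge_vars_ideal:
  assumes r: "prime_in UNIV r" and Y: "finite Y" "Y \<subseteq> B" and "ht_ge (polys B) h (vars_ideal B r {})"
  shows "ht_ge (polys B) (h + card Y) (vars_ideal B r Y)"
  using Y
proof (induction Y rule: finite_induct)
  case (insert v Y)
  have "vars_ideal B r Y \<subseteq> vars_ideal B r (insert v Y)" by (auto simp: vars_ideal_def)
  moreover have "Var v \<in> vars_ideal B r (insert v Y)"
    using insert.prems by (intro single_in_vars_ideal[OF r]) auto
  moreover have "Var v \<notin> vars_ideal B r Y"
    using insert.hyps prime_inD(3)[OF r] by (auto simp: vars_ideal_def intro!: exI[of _ "Poly_Mapping.single v 1"])
  ultimately have "vars_ideal B r Y \<subset> vars_ideal B r (insert v Y)" by blast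
  then show ?case using insert vars_ideal_prime[OF r, of B "insert v Y"] by auto
qed (use assms in simp)

section \<open>Transport of chains to numbered variables and the Jaffard bound\<close>

lemma ht_ge_vimage:
  assumes hom: "\<And>x y. \<phi> (x + y) = \<phi> x + \<phi> y" "\<And>x y. \<phi> (x * y) = \<phi> x * \<phi> y" "\<phi> 0 = 0" "\<phi> 1 = 1"
    and A: "subring_of A" "\<phi> ` A = B" and "ht_ge B h I"
  shows "ht_ge A h {x \<in> A. \<phi> x \<in> I}"
  using assms(7)
proof (induction h arbitrary: I)
  have pr: "prime_in A {x \<in> A. \<phi> x \<in> I}" if "prime_in B I" for I
  proof -
    have "\<phi> x \<in> B" if "x \<in> A" for x using that A(2) by blast
    then show ?thesis
      unfolding prime_in_def[of A] mem_Collect_eq hom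
      using prime_inD(2,3)[OF that] subring_ofD(1)[OF A(1)]
      by (auto simp: hom intro: prime_inD(4,5)[OF that] subring_ofD(4,6)[OF A(1)] dest: prime_inD(7)[OF that])
  qed
  {
    case 0
    then show ?case using pr by simp
  next
    case (Suc h)
    then obtain J where J: "J \<subset> I" "ht_ge B h J" and I: "prime_in B I" by auto
    then obtain f where f: "f \<in> I" "f \<notin> J" by blast
    then obtain x where "x \<in> A" "f = \<phi> x" using prime_inD(1)[OF I] A(2) by blast
    then have "{x \<in> A. \<phi> x \<in> J} \<subset> {x \<in> A. \<phi> x \<in> I}" using f J(1) by blast
    then show ?case using Suc.IH[OF J(2)] pr[OF I] by auto
  }
qed

lemma ht_le_krull_dim:
  fixes A :: "'b::comm_ring_1 set"
  assumes "subring_of A" "ht_ge A h I"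
  shows "enat h \<le> krull_dim (ring_of_type_algebra\<lparr>carrier := A\<rparr>)"
proof -
  from ht_ge_chain[OF assms(2)] obtain p where "\<forall>i\<le>h. prime_in A (p i)" "\<forall>i<h. p (Suc i) \<subset> p i" by blast
  then show ?thesis unfolding krull_dim_def primeideal_iff_prime_in[OF assms(1)]
    by (intro Sup_upper) blast
qed

text \<open>The renaming acts on exponent vectors as \<open>\<mu>\<close> and on polynomials as
  \<open>\<phi>\<close>. Being onto \<open>polys B\<close> is what keeps the inverse images of a
  strict chain strict.\<close>

lemma polys_rename:
  fixes \<beta> :: "'w \<Rightarrow> 'v"
  assumes \<beta>: "bij_betw \<beta> W B"
  obtains \<phi> :: "(('w \<Rightarrow>\<^sub>0 nat) \<Rightarrow>\<^sub>0 'a::comm_ring_1) \<Rightarrow> (('v \<Rightarrow>\<^sub>0 nat) \<Rightarrow>\<^sub>0 'a)"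
  where "\<And>x y. \<phi> (x + y) = \<phi> x + \<phi> y" "\<And>x y. \<phi> (x * y) = \<phi> x * \<phi> y" "\<phi> 0 = 0" "\<phi> 1 = 1"
    "\<phi> ` polys W = polys B"
proof -
  define \<mu> where "\<mu> = extend_additive (\<lambda>i e. Poly_Mapping.single (\<beta> i) (e::nat))"
  have \<mu>add: "\<mu> (m + n) = \<mu> m + \<mu> n" for m n
    unfolding \<mu>_def by (rule extend_additive_add) (auto simp: single_add)
  have \<mu>0: "\<mu> 0 = 0" by (simp add: \<mu>_def extend_additive_def)
  define \<phi> where "\<phi> = extend_additive (\<lambda>m (c::'a). Poly_Mapping.single (\<mu> m) c)"
  have \<phi>_single: "\<phi> (Poly_Mapping.single m c) = Poly_Mapping.single (\<mu> m) c" for m c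
    unfolding \<phi>_def by (rule extend_additive_single) (auto simp: single_add)
  have \<phi>sum: "\<phi> (sum f Y) = (\<Sum>x\<in>Y. \<phi> (f x))" for f :: "'k \<Rightarrow> _" and Y
    unfolding \<phi>_def by (rule extend_additive_sum) (auto simp: single_add)
  show ?thesis
  proof
    show "\<phi> (x + y) = \<phi> x + \<phi> y" for x y
      unfolding \<phi>_def by (rule extend_additive_add) (auto simp: single_add)
    show "\<phi> (x * y) = \<phi> x * \<phi> y" for x y
      unfolding \<phi>_def by (rule extend_additive_mult) (auto simp: single_add mult_single \<mu>add)
    show "\<phi> 0 = 0" by (simp add: \<phi>_def extend_additive_def)
    show "\<phi> 1 = 1" using \<phi>_single[of 0 1] by (simp add: \<mu>0)
    have key: "Poly_Mapping.keys (\<mu> m) \<subseteq> B" if "Poly_Mapping.keys m \<subseteq> W" for m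
    proof
      fix v assume "v \<in> Poly_Mapping.keys (\<mu> m)"
      then have "(\<Sum>i\<in>Poly_Mapping.keys m. Poly_Mapping.lookup (Poly_Mapping.single (\<beta> i) (Poly_Mapping.lookup m i)) v) \<noteq> 0"
        by (simp add: \<mu>_def extend_additive_def in_keys_iff lookup_sum)
      then obtain i where "i \<in> Poly_Mapping.keys m" "\<beta> i = v"
        by (metis (mono_tags, lifting) lookup_single_not_eq sum.neutral)
      then show "v \<in> B" using that \<beta> by (auto simp: bij_betw_def)
    qed
    show "\<phi> ` polys W = polys B"
    proof (intro equalityI subsetI)
      fix f assume "f \<in> \<phi> ` polys W"
      then obtain g where g: "g \<in> polys W" "f = \<phi> g" by blast
      show "f \<in> polys B" unfolding g(2) \<phi>_def extend_additive_def
        by (intro subring_of_sum subring_of_polys single_in_polys key) (use g(1) in \<open>auto simp: polys_def\<close>)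
    next
      fix f :: "('v \<Rightarrow>\<^sub>0 nat) \<Rightarrow>\<^sub>0 'a" assume f: "f \<in> polys B"
      \<comment> \<open>A right inverse of \<open>\<mu>\<close> on monomials in \<open>B\<close>,
        which supplies the preimage \<open>?g\<close> of \<open>f\<close>.\<close>
      define \<nu> where "\<nu> m = (\<Sum>v\<in>Poly_Mapping.keys m. Poly_Mapping.single (inv_into W \<beta> v) (Poly_Mapping.lookup m v))"
        for m :: "'v \<Rightarrow>\<^sub>0 nat"
      have inv: "inv_into W \<beta> v \<in> W" "\<beta> (inv_into W \<beta> v) = v" if "v \<in> B" for v
        using that \<beta> by (auto simp: bij_betw_def inv_into_into f_inv_into_f)
      have \<mu>\<nu>: "\<mu> (\<nu> m) = m" if "Poly_Mapping.keys m \<subseteq> B" for m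
      proof -
        have "\<mu> (\<nu> m) = (\<Sum>v\<in>Poly_Mapping.keys m. \<mu> (Poly_Mapping.single (inv_into W \<beta> v) (Poly_Mapping.lookup m v)))"
          unfolding \<nu>_def \<mu>_def by (rule extend_additive_sum) (auto simp: single_add)
        also have "\<dots> = (\<Sum>v\<in>Poly_Mapping.keys m. Poly_Mapping.single v (Poly_Mapping.lookup m v))"
        proof (rule sum.cong)
          fix v assume "v \<in> Poly_Mapping.keys m"
          then have "v \<in> B" using that by blast
          then show "\<mu> (Poly_Mapping.single (inv_into W \<beta> v) (Poly_Mapping.lookup m v)) = Poly_Mapping.single v (Poly_Mapping.lookup m v)"
            unfolding \<mu>_def by (subst extend_additive_single) (auto simp: single_add inv)
        qed simp
        finally show ?thesis by (simp flip: poly_mapping_sum_single)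
      qed
      have \<nu>W: "Poly_Mapping.keys (\<nu> m) \<subseteq> W" if "Poly_Mapping.keys m \<subseteq> B" for m
      proof
        fix i assume "i \<in> Poly_Mapping.keys (\<nu> m)"
        then have "(\<Sum>v\<in>Poly_Mapping.keys m. Poly_Mapping.lookup (Poly_Mapping.single (inv_into W \<beta> v) (Poly_Mapping.lookup m v)) i) \<noteq> 0"
          by (simp add: \<nu>_def in_keys_iff lookup_sum)
        then obtain v where "v \<in> Poly_Mapping.keys m" "inv_into W \<beta> v = i"
          by (metis (mono_tags, lifting) lookup_single_not_eq sum.neutral)
        then show "i \<in> W" using that inv by blast
      qed
      let ?g = "\<Sum>m\<in>Poly_Mapping.keys f. Poly_Mapping.single (\<nu> m) (Poly_Mapping.lookup f m)"
      have mB: "Poly_Mapping.keys m \<subseteq> B" if "m \<in> Poly_Mapping.keys f" for m using f that by (auto simp: polys_def)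
      have "\<phi> ?g = (\<Sum>m\<in>Poly_Mapping.keys f. Poly_Mapping.single m (Poly_Mapping.lookup f m))"
        unfolding \<phi>sum \<phi>_single by (intro sum.cong) (auto simp: \<mu>\<nu> mB)
      then have a: "\<phi> ?g = f" by (simp flip: poly_mapping_sum_single)
      have b: "?g \<in> polys W" by (intro subring_of_sum subring_of_polys single_in_polys \<nu>W mB)
      show "f \<in> \<phi> ` polys W" using imageI[OF b, of \<phi>] unfolding a .
    qed
  qed
qed

text \<open>The Krull dimension is given for variables numbered below \<open>card B\<close>, so the
  chain is pulled back along a renaming.\<close>

lemma jaffard_ht_bound:
  fixes B :: "'v set" and I :: "(('v \<Rightarrow>\<^sub>0 nat) \<Rightarrow>\<^sub>0 'a::comm_ring_1) set"
  assumes dim: "krull_dim (poly_ring (card B) :: ((nat \<Rightarrow>\<^sub>0 nat) \<Rightarrow>\<^sub>0 'a) ring) = enat d + enat (card B)"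
    and B: "finite B" and h: "ht_ge (polys B) h I"
  shows "h \<le> d + card B"
proof -
  obtain \<beta> where \<beta>: "bij_betw \<beta> {..<card B} B" using ex_bij_betw_nat_finite[OF B] by (auto simp: atLeast0LessThan)
  obtain \<phi> :: "((nat \<Rightarrow>\<^sub>0 nat) \<Rightarrow>\<^sub>0 'a) \<Rightarrow> (('v \<Rightarrow>\<^sub>0 nat) \<Rightarrow>\<^sub>0 'a)"
    where \<phi>: "\<And>x y. \<phi> (x + y) = \<phi> x + \<phi> y" "\<And>x y. \<phi> (x * y) = \<phi> x * \<phi> y" "\<phi> 0 = 0" "\<phi> 1 = 1"
      "\<phi> ` polys {..<card B} = polys B"
    using polys_rename[OF \<beta>] by blast
  have "ht_ge (polys {..<card B}) h {x \<in> polys {..<card B}. \<phi> x \<in> I}"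
    by (rule ht_ge_vimage[OF \<phi>(1-4) subring_of_polys \<phi>(5) h])
  from ht_le_krull_dim[OF subring_of_polys this]
  have "enat h \<le> krull_dim (poly_ring (card B) :: ((nat \<Rightarrow>\<^sub>0 nat) \<Rightarrow>\<^sub>0 'a) ring)"
    by (simp add: poly_ring_def poly_ring_in_def polys_def)
  then show ?thesis by (simp add: dim)
qed

text \<open>Choose \<open>C\<close> independent modulo \<open>Q\<close> and spanning
  \<open>B\<close>. The dependent variables give the part of \<open>Q\<close> in R[B] height at
  least |B - C|. By independence modulo \<open>P\<close>, that part lies inside the ideal generated
  by the contraction of \<open>P\<close>, above which the variables of \<open>B\<close> add |B|
  further steps. The dimension d + |B| of R[B] leaves |B - C| \<le> d.\<close>

lemma jaffard_rank_bound:
  fixes P Q :: "(('v \<Rightarrow>\<^sub>0 nat) \<Rightarrow>\<^sub>0 'a::comm_ring_1) set"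
  assumes dim: "\<And>n. krull_dim (poly_ring n :: ((nat \<Rightarrow>\<^sub>0 nat) \<Rightarrow>\<^sub>0 'a) ring) = enat d + enat n"
    and P: "prime_in (polys U) P" and Q: "prime_in (polys U) Q" and QP: "Q \<subseteq> P"
    and B: "finite B" "B \<subseteq> U" "alg_indep P B"
  obtains C where "C \<subseteq> B" "alg_indep Q C" "card B \<le> card C + d"
proof -
  obtain C where C: "C \<subseteq> B" "alg_indep Q C" "\<And>v. v \<in> B \<Longrightarrow> alg_dep Q C v"
    using ex_basis[OF Q B(1)] by metis
  have fC: "finite C" using C(1) B(1) finite_subset by blast
  have "ht_ge (polys (C \<union> (B - C))) (card (B - C)) (Q \<inter> polys (C \<union> (B - C)))"
    using C B by (intro ht_ge_dependent[OF Q]) auto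
  then have "ht_ge (polys B) (card (B - C)) (Q \<inter> polys B)" using C(1) by (simp add: Un_absorb1)
  moreover have "Q \<inter> polys B \<subseteq> vars_ideal B (base_prime P) {}" using B(3) QP by (auto simp: alg_indep_def)
  ultimately have "ht_ge (polys B) (card (B - C)) (vars_ideal B (base_prime P) {})"
    using vars_ideal_prime[OF base_prime_prime[OF P]] by (rule ht_ge_mono)
  then have "ht_ge (polys B) (card (B - C) + card B) (vars_ideal B (base_prime P) B)"
    using ht_ge_vars_ideal[OF base_prime_prime[OF P] B(1)] by blast
  then have "card (B - C) + card B \<le> d + card B" using jaffard_ht_bound[OF dim B(1)] by blast
  then have "card B \<le> card C + d" using card_Diff_subset[OF fC C(1)] by simp
  then show ?thesis using that C by blast
qed

section \<open>The growth of the transcendence degree of a differential prime\<close>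

definition var_shift :: "nat \<times> nat \<Rightarrow> nat \<times> nat" where
  "var_shift v = (fst v, Suc (snd v))"

definition diff_vars :: "nat \<Rightarrow> (nat \<times> nat) set" where
  "diff_vars n = {..<n} \<times> UNIV"

definition diff_vars_upto :: "nat \<Rightarrow> nat \<Rightarrow> (nat \<times> nat) set" where
  "diff_vars_upto n k = {..<n} \<times> {..k}"

text \<open>Ranks the variables by order of derivation first and by the index of the indeterminate
  second.\<close>

definition var_pos :: "nat \<Rightarrow> nat \<times> nat \<Rightarrow> nat" where
  "var_pos n v = snd v * n + fst v"

definition earlier :: "nat \<Rightarrow> nat \<times> nat \<Rightarrow> (nat \<times> nat) set" where
  "earlier n v = {w \<in> diff_vars n. var_pos n w < var_pos n v}"

lemma earlier_subset_upto:
  assumes "v \<in> diff_vars_upto n k"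
  shows "earlier n v \<subseteq> diff_vars_upto n k"
proof
  fix w assume w: "w \<in> earlier n v"
  then have "snd w * n \<le> var_pos n w" "var_pos n w < var_pos n v" by (auto simp: earlier_def var_pos_def)
  moreover have "var_pos n v < Suc k * n"
  proof -
    have "fst v < n" "snd v * n \<le> k * n" using assms by (auto simp: diff_vars_upto_def)
    then have "snd v * n + fst v < k * n + n" by (rule add_le_less_mono[rotated])
    then show ?thesis by (simp add: var_pos_def)
  qed
  ultimately have "snd w * n < Suc k * n" by linarith
  then have "snd w \<le> k" unfolding mult_less_cancel2 by simp
  then show "w \<in> diff_vars_upto n k"
    using w by (auto simp: earlier_def diff_vars_def diff_vars_upto_def)
qed

lemma finite_diff_vars_upto: "finite (diff_vars_upto n k)"
  by (simp add: diff_vars_upto_def)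

lemma diff_vars_upto_subset: "diff_vars_upto n k \<subseteq> diff_vars n"
  by (auto simp: diff_vars_upto_def diff_vars_def)

lemma var_pos_inj: "inj_on (var_pos n) (diff_vars n)"
proof (rule inj_onI)
  fix v w assume "v \<in> diff_vars n" "w \<in> diff_vars n" "var_pos n v = var_pos n w"
  then have *: "fst v < n" "fst w < n" "fst v + snd v * n = fst w + snd w * n"
    by (auto simp: diff_vars_def var_pos_def)
  have "fst v = fst w" using arg_cong[OF *(3), of "\<lambda>x. x mod n"] *(1,2) by simp
  moreover have "snd v = snd w" using arg_cong[OF *(3), of "\<lambda>x. x div n"] *(1,2) by simp
  ultimately show "v = w" by (rule prod_eqI)
qed

lemma finite_earlier: "finite (earlier n v)"
proof (rule finite_imageD[of "var_pos n"])
  show "finite (var_pos n ` earlier n v)"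
    by (rule finite_subset[of _ "{..<var_pos n v}"]) (auto simp: earlier_def)
  show "inj_on (var_pos n) (earlier n v)"
    by (rule inj_on_subset[OF var_pos_inj]) (auto simp: earlier_def)
qed

text \<open>Compatibility of the ranking with differentiation, in the form in which
  \<open>alg_dep_shift\<close> asks for it.\<close>

lemma earlier_shift:
  assumes "v \<in> diff_vars n"
  shows "earlier n v \<union> var_shift ` earlier n v \<union> {v} \<subseteq> earlier n (var_shift v)"
  using assms by (auto simp: earlier_def var_shift_def diff_vars_def var_pos_def)

text \<open>The variables that raise the transcendence degree when all variables are adjoined in the
  order of the ranking.\<close>

definition jumps :: "nat \<Rightarrow> ((nat \<times> nat \<Rightarrow>\<^sub>0 nat) \<Rightarrow>\<^sub>0 'a::comm_ring_1) set \<Rightarrow> (nat \<times> nat) set" where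
  "jumps n s = {v \<in> diff_vars n. \<not> alg_dep s (earlier n v) v}"

text \<open>This is f(k) of the overview: by \<open>jumps_indep\<close> and
  \<open>jumps_span\<close>, the jumps of order at most \<open>k\<close> form a transcendence basis
  for the derivatives of order at most \<open>k\<close>.\<close>

definition jump_count :: "nat \<Rightarrow> ((nat \<times> nat \<Rightarrow>\<^sub>0 nat) \<Rightarrow>\<^sub>0 'a::comm_ring_1) set \<Rightarrow> nat \<Rightarrow> nat" where
  "jump_count n s k = card (jumps n s \<inter> diff_vars_upto n k)"

text \<open>This is the slope a of the overview, the differential transcendence degree.\<close>

definition diff_trdeg :: "nat \<Rightarrow> ((nat \<times> nat \<Rightarrow>\<^sub>0 nat) \<Rightarrow>\<^sub>0 'a::comm_ring_1) set \<Rightarrow> nat" where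
  "diff_trdeg n s = card {i. i < n \<and> (\<forall>j. (i, j) \<in> jumps n s)}"

section \<open>Jumps as transcendence bases\<close>

context
  fixes n :: nat and s :: "((nat \<times> nat \<Rightarrow>\<^sub>0 nat) \<Rightarrow>\<^sub>0 'a::comm_ring_1) set"
  assumes s: "prime_in (polys (diff_vars n)) s"
begin

text \<open>The element of \<open>F\<close> of highest rank does not depend on the lower variables,
  hence not on the rest of \<open>F\<close>, to which induction applies.\<close>

lemma jumps_indep:
  assumes "finite F" "F \<subseteq> jumps n s"
  shows "alg_indep s F"
  using assms
proof (induction "card F" arbitrary: F)
  case 0
  then show ?case by (simp add: alg_indep_empty[OF s])
next
  case (Suc c)
  have FU: "F \<subseteq> diff_vars n" using Suc.prems by (auto simp: jumps_def)
  have "F \<noteq> {}" using Suc.hyps(2) by auto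
  then have "Max (var_pos n ` F) \<in> var_pos n ` F" using Suc.prems by (intro Max_in) auto
  then obtain v where v: "v \<in> F" "var_pos n v = Max (var_pos n ` F)" by auto
  have "F - {v} \<subseteq> earlier n v"
  proof
    fix w assume w: "w \<in> F - {v}"
    then have "var_pos n w \<le> var_pos n v" using Suc.prems v by auto
    moreover have "var_pos n w \<noteq> var_pos n v" using w v FU inj_onD[OF var_pos_inj, of n w v] by blast
    ultimately show "w \<in> earlier n v" using w FU by (auto simp: earlier_def)
  qed
  moreover have "\<not> alg_dep s (earlier n v) v" using v(1) Suc.prems by (auto simp: jumps_def)
  ultimately have nd: "\<not> alg_dep s (F - {v}) v"
    using alg_dep_mono[of s "F - {v}" v "earlier n v"] by blast
  have "alg_indep s (F - {v})"
    using Suc.prems Suc.hyps(2) v(1) by (intro Suc.hyps(1)) auto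
  from alg_indep_insert[OF s this nd] show ?case using v(1) by (simp add: insert_absorb)
qed

text \<open>A variable that is not a jump depends on earlier ones. These again have order at most
  \<open>k\<close>, because the ranking is orderly, so induction on the rank and transitivity
  apply.\<close>

lemma jumps_span:
  assumes "v \<in> diff_vars_upto n k"
  shows "alg_dep s (jumps n s \<inter> diff_vars_upto n k) v"
  using assms
proof (induction "var_pos n v" arbitrary: v rule: less_induct)
  case less
  let ?J = "jumps n s \<inter> diff_vars_upto n k"
  show ?case
  proof (cases "v \<in> jumps n s")
    case True
    then show ?thesis using less.prems by (intro alg_dep_self[OF s]) auto
  next
    case False
    then have "alg_dep s (earlier n v) v"
      using less.prems diff_vars_upto_subset[of n k] by (auto simp: jumps_def)
    moreover have "alg_dep s ?J w" if "w \<in> earlier n v" for w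
      using that less.hyps[of w] earlier_subset_upto[OF less.prems] by (auto simp: earlier_def)
    moreover have "earlier n v \<union> ?J \<subseteq> diff_vars n" "v \<in> diff_vars n"
      using earlier_subset_upto[OF less.prems] diff_vars_upto_subset[of n k] less.prems by auto
    ultimately show ?thesis
      by (intro alg_dep_trans_set[OF s finite_earlier, of n v ?J v])
  qed
qed

lemma indep_card_le_jump_count:
  assumes "alg_indep s C" "C \<subseteq> diff_vars_upto n k"
  shows "card C \<le> jump_count n s k"
  unfolding jump_count_def
proof (rule steinitz[OF s assms(1)])
  show "finite C" using finite_subset[OF assms(2) finite_diff_vars_upto] .
  show "alg_dep s (jumps n s \<inter> diff_vars_upto n k) v" if "v \<in> C" for v
    using jumps_span that assms(2) by blast
qed (use assms diff_vars_upto_subset[of n k] finite_diff_vars_upto[of n k] in auto)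

end

text \<open>The rank bound is applied to the jumps of \<open>P\<close>; the independent set obtained
  modulo \<open>Q\<close> is no larger than the count for \<open>Q\<close>.\<close>

lemma jump_count_le:
  fixes P Q :: "((nat \<times> nat \<Rightarrow>\<^sub>0 nat) \<Rightarrow>\<^sub>0 'a::comm_ring_1) set"
  assumes dim: "\<And>n. krull_dim (poly_ring n :: ((nat \<Rightarrow>\<^sub>0 nat) \<Rightarrow>\<^sub>0 'a) ring) = enat d + enat n"
    and P: "prime_in (polys (diff_vars n)) P" and Q: "prime_in (polys (diff_vars n)) Q" and QP: "Q \<subseteq> P"
  shows "jump_count n P k \<le> jump_count n Q k + d"
proof -
  let ?B = "jumps n P \<inter> diff_vars_upto n k"
  have B: "finite ?B" "?B \<subseteq> diff_vars n" "alg_indep P ?B"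
    using finite_diff_vars_upto[of n k] diff_vars_upto_subset[of n k] jumps_indep[OF P, of ?B] by auto
  from jaffard_rank_bound[OF dim P Q QP B] obtain C where
    C: "C \<subseteq> ?B" "alg_indep Q C" "card ?B \<le> card C + d" by blast
  have "card C \<le> jump_count n Q k" using C(1) by (intro indep_card_le_jump_count[OF Q C(2)]) auto
  then show ?thesis using C(3) by (simp add: jump_count_def)
qed

text \<open>The jumps of \<open>P\<close> up to order \<open>k\<close> stay independent modulo
  \<open>Q\<close>, as the contraction of \<open>P\<close> lies in that of \<open>Q\<close>. If the
  count did not grow, no variable up to order \<open>k\<close> could be adjoined to them, so they
  would span modulo \<open>Q\<close> and the two primes would agree up to order
  \<open>k\<close>.\<close>

lemma jump_count_less:
  assumes P: "prime_in (polys (diff_vars n)) P" and Q: "prime_in (polys (diff_vars n)) Q" and QP: "Q \<subseteq> P"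
    and base: "base_prime P \<subseteq> base_prime Q" and ne: "\<not> P \<inter> polys (diff_vars_upto n k) \<subseteq> Q"
  shows "jump_count n P k < jump_count n Q k"
proof (rule ccontr)
  assume "\<not> ?thesis"
  then have le: "jump_count n Q k \<le> jump_count n P k" by simp
  let ?V = "diff_vars_upto n k"
  let ?B = "jumps n P \<inter> ?V"
  have B: "finite ?B" "?B \<subseteq> diff_vars n" "alg_indep P ?B"
    using finite_diff_vars_upto[of n k] diff_vars_upto_subset[of n k] jumps_indep[OF P, of ?B] by auto
  have "P \<inter> polys ?B \<subseteq> vars_ideal ?B (base_prime P) {}" using B(3) by (simp add: alg_indep_def)
  moreover have "vars_ideal ?B (base_prime P) {} \<subseteq> vars_ideal ?B (base_prime Q) {}"
    using base by (auto simp: vars_ideal_def)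
  ultimately have BQ: "alg_indep Q ?B" using QP unfolding alg_indep_def by blast
  have "alg_dep Q ?B v" if v: "v \<in> ?V" for v
  proof (rule ccontr)
    assume n: "\<not> alg_dep Q ?B v"
    then have "v \<notin> ?B" using alg_dep_self[OF Q] by blast
    moreover have "card (insert v ?B) \<le> jump_count n Q k"
      using v by (intro indep_card_le_jump_count[OF Q alg_indep_insert[OF Q BQ n]]) auto
    ultimately show False using le B(1) by (simp add: jump_count_def)
  qed
  then have "P \<inter> polys (?B \<union> ?V) \<subseteq> Q"
    by (intro prime_eq_of_spanning_indep[OF P Q QP base B(3,2) finite_diff_vars_upto diff_vars_upto_subset])
  then show False using ne by (simp add: Un_absorb1)
qed

section \<open>Derivations, separants and linear growth\<close>

lemma additive_leibniz_power:
  fixes D :: "'b::comm_ring_1 \<Rightarrow> 'b"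
  assumes mult: "\<And>x y. D (x * y) = D x * y + x * D y"
  shows "D (y ^ i) = of_nat i * y ^ (i - 1) * D y"
proof (induction i)
  case 0
  show ?case using mult[of 1 1] by simp
next
  case (Suc i)
  then show ?case by (cases i) (simp_all add: mult algebra_simps)
qed

lemma coeff_shifted_sum:
  fixes g :: "'b::comm_ring_1 poly"
  shows "coeff (\<Sum>i=1..degree g. Polynomial.monom (of_nat i * coeff g i) (i - 1)) j = of_nat (Suc j) * coeff g (Suc j)"
proof -
  have "coeff (\<Sum>i=1..degree g. Polynomial.monom (of_nat i * coeff g i) (i - 1)) j
     = (\<Sum>i=1..degree g. if Suc j = i then of_nat (Suc j) * coeff g (Suc j) else 0)"
    unfolding coeff_sum by (intro sum.cong) (auto simp: coeff_monom)
  also have "\<dots> = of_nat (Suc j) * coeff g (Suc j)" by (auto simp: coeff_eq_0)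
  finally show ?thesis .
qed

text \<open>The chain rule: the first sum evaluates \<open>g\<close> with differentiated
  coefficients, and the factor of \<open>D y\<close> is the formal derivative of \<open>g\<close> at
  \<open>y\<close>.\<close>

lemma additive_leibniz_poly:
  fixes D :: "'b::comm_ring_1 \<Rightarrow> 'b"
  assumes add: "\<And>x y. D (x + y) = D x + D y" and mult: "\<And>x y. D (x * y) = D x * y + x * D y"
  shows "D (poly g y) = (\<Sum>i\<le>degree g. D (coeff g i) * y ^ i) +
     poly (\<Sum>i=1..degree g. Polynomial.monom (of_nat i * coeff g i) (i - 1)) y * D y"
proof -
  have D0: "D 0 = 0" using add[of 0 0] by simp
  have sum: "D (sum f A) = (\<Sum>x\<in>A. D (f x))" for f :: "nat \<Rightarrow> 'b" and A
    by (induction A rule: infinite_finite_induct) (simp_all add: add D0)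
  have "D (poly g y) = (\<Sum>i\<le>degree g. D (coeff g i) * y ^ i) + (\<Sum>i\<le>degree g. of_nat i * coeff g i * y ^ (i - 1) * D y)"
    by (simp add: poly_altdef sum mult additive_leibniz_power[OF mult] sum.distrib algebra_simps)
  also have "(\<Sum>i\<le>degree g. of_nat i * coeff g i * y ^ (i - 1) * D y) = (\<Sum>i=1..degree g. of_nat i * coeff g i * y ^ (i - 1) * D y)"
    by (intro sum.mono_neutral_right) (auto simp: Suc_le_eq)
  also have "\<dots> = poly (\<Sum>i=1..degree g. Polynomial.monom (of_nat i * coeff g i) (i - 1)) y * D y"
    by (simp add: poly_sum poly_monom sum_distrib_right)
  finally show ?thesis .
qed

locale diff_setting =
  fixes \<delta> :: "'a \<Rightarrow> 'a::comm_ring_1" and n :: nat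
  assumes add: "\<And>x y. \<delta> (x + y) = \<delta> x + \<delta> y" and mult: "\<And>x y. \<delta> (x * y) = \<delta> x * y + x * \<delta> y"
    and n_pos: "n > 0"
begin

abbreviation "D \<equiv> diff_poly_deriv \<delta>"

lemmas D_add = diff_poly_deriv_add[of \<delta>, OF add mult]
lemmas D_mult = diff_poly_deriv_mult[of \<delta>, OF add mult]
lemmas D_sum = diff_poly_deriv_sum[of \<delta>, OF add mult]
lemmas D_single = diff_poly_deriv_single[of \<delta>, OF add mult, unfolded diff_poly_term_def[of \<delta>, OF add mult]]

lemma D_Var: "D (Var v) = Var (var_shift v)"
  using diff_poly_deriv_var[of \<delta>, OF add mult, of "fst v" "snd v"] by (simp add: var_shift_def)

lemma D_Const: "D (Const c) = Const (\<delta> c)"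
  by (rule diff_poly_deriv_const[of \<delta>, OF add mult])

lemma D_polys:
  assumes f: "f \<in> polys W" and W: "W \<union> var_shift ` W \<subseteq> W'"
  shows "D f \<in> polys W'"
proof -
  have "D (Poly_Mapping.single m (Poly_Mapping.lookup f m)) \<in> polys W'" if m: "m \<in> Poly_Mapping.keys f" for m
    unfolding D_single case_prod_unfold
  proof (intro subring_ofD(4)[OF subring_of_polys] subring_of_sum[OF subring_of_polys] single_in_polys)
    have mW: "Poly_Mapping.keys m \<subseteq> W" using f m by (auto simp: polys_def)
    then show "Poly_Mapping.keys m \<subseteq> W'" using W by blast
    fix v assume v: "v \<in> Poly_Mapping.keys m"
    have "Poly_Mapping.keys (m - Poly_Mapping.single (fst v, snd v) 1) \<subseteq> Poly_Mapping.keys m"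
      by (auto simp: in_keys_iff lookup_minus)
    moreover have "(fst v, Suc (snd v)) \<in> W'" using v mW W by (auto simp: var_shift_def)
    ultimately show "Poly_Mapping.keys (m - Poly_Mapping.single (fst v, snd v) 1 + Poly_Mapping.single (fst v, Suc (snd v)) 1) \<subseteq> W'"
      using mW W by (auto simp: keys_add_nat)
  qed
  then have "D (\<Sum>m\<in>Poly_Mapping.keys f. Poly_Mapping.single m (Poly_Mapping.lookup f m)) \<in> polys W'"
    unfolding D_sum by (rule subring_of_sum[OF subring_of_polys])
  then show ?thesis by (simp flip: poly_mapping_sum_single)
qed

definition diff_prime :: "((nat \<times> nat \<Rightarrow>\<^sub>0 nat) \<Rightarrow>\<^sub>0 'a) set \<Rightarrow> bool" where
  "diff_prime s \<longleftrightarrow> prime_in (polys (diff_vars n)) s \<and> (\<forall>f\<in>s. D f \<in> s)"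

lemma diff_spec_iff: "s \<in> diff_spec (diff_poly_ring n) D \<longleftrightarrow> diff_prime s"
  using primeideal_iff_prime_in[OF subring_of_polys, of s "diff_vars n"]
  by (auto simp: diff_spec_def diff_prime_def diff_poly_ring_def poly_ring_in_def polys_def diff_vars_def)

lemma base_diff_spec_iff:
  "r \<in> diff_spec ring_of_type_algebra \<delta> \<longleftrightarrow> prime_in UNIV r \<and> (\<forall>x\<in>r. \<delta> x \<in> r)"
proof -
  have "(ring_of_type_algebra :: 'a ring) = ring_of_type_algebra\<lparr>carrier := UNIV\<rparr>"
    by (simp add: ring_of_type_algebra_def)
  then show ?thesis
    using primeideal_iff_prime_in[of UNIV r] by (auto simp: diff_spec_def subring_of_def)
qed

lemma base_prime_diff_spec:
  assumes "diff_prime s"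
  shows "base_prime s \<in> diff_spec ring_of_type_algebra \<delta>"
  using assms base_prime_prime[of "diff_vars n" s] D_Const
  unfolding base_diff_spec_iff diff_prime_def by (force simp: base_prime_def)

text \<open>
  Differentiating a relation of minimal degree gives a relation that is linear in the shifted
  variable; its leading coefficient, the separant, is nonzero because of the characteristic.
\<close>

lemma alg_dep_shift:
  assumes s: "diff_prime s" and char0: "\<And>k. k > 0 \<Longrightarrow> of_nat k \<notin> s"
    and W: "W \<subseteq> diff_vars n" "v \<in> diff_vars n" and dep: "alg_dep s W v"
    and W': "W \<union> var_shift ` W \<union> {v} \<subseteq> W'"
  shows "alg_dep s W' (var_shift v)"
proof -
  have sp: "prime_in (polys (diff_vars n)) s" and sD: "\<And>f. f \<in> s \<Longrightarrow> D f \<in> s"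
    using s by (auto simp: diff_prime_def)
  obtain g0 where g0: "alg_rel (polys W) (Var v) s g0" using dep by (auto simp: alg_dep_def)
  obtain g where g: "alg_rel (polys W) (Var v) s g" "lead_coeff g \<notin> s" "degree g > 0"
    and min: "\<And>h. alg_rel (polys W) (Var v) s h \<Longrightarrow> degree g \<le> degree h"
    using minimal_alg_rel[OF subring_of_polys sp polys_mono[OF W(1)] Var_in_polys[OF W(2)] g0 subring_of_polys] by metis
  have gW: "coeff g i \<in> polys W" for i using g(1) by (auto simp: alg_rel_def coeffs_in_def)
  \<comment> \<open>The formal derivative of \<open>g\<close>; its value at \<open>Var v\<close> is
    the separant. The remaining part of the derivative, in which \<open>D\<close> acts on the
    coefficients, is called \<open>e\<close> below.\<close>
  define h where "h = (\<Sum>i=1..degree g. Polynomial.monom (of_nat i * coeff g i) (i - 1))"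
  have coeff_h: "coeff h j = of_nat (Suc j) * coeff g (Suc j)" for j unfolding h_def by (rule coeff_shifted_sum)
  define e where "e = (\<Sum>i\<le>degree g. D (coeff g i) * Var v ^ i)"
  have hW: "coeffs_in (polys W) h" unfolding coeffs_in_def coeff_h
    by (intro allI subring_ofD(6)[OF subring_of_polys] subring_of_of_nat gW subring_of_polys)
  have WW': "polys W \<subseteq> polys W'" using W' by (intro polys_mono) blast
  have vW': "Var v \<in> polys W'" using W' by (intro Var_in_polys) blast
  have hW': "poly h (Var v) \<in> polys W'"
    by (rule poly_in_subring[OF subring_of_polys coeffs_in_mono[OF hW WW'] vW'])
  have eW': "e \<in> polys W'" unfolding e_def
    using W' by (intro subring_of_sum subring_ofD(6)[OF subring_of_polys] subring_of_polys subring_of_power vW' D_polys[OF gW]) blast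
  \<comment> \<open>If \<open>h\<close> vanishes modulo \<open>s\<close>, then
    \<open>degree g\<close> times the leading coefficient of \<open>g\<close> lies in
    \<open>s\<close>, against \<open>char0\<close> and primality. Otherwise \<open>h\<close> would
    be a relation of smaller degree than \<open>g\<close>.\<close>
  have "poly h (Var v) \<notin> s"
  proof
    assume hs: "poly h (Var v) \<in> s"
    show False
    proof (cases "coeffs_in s h")
      case True
      have "of_nat (Suc (degree g - 1)) * coeff g (Suc (degree g - 1)) \<in> s"
        using True unfolding coeffs_in_def coeff_h[symmetric] by blast
      then have "of_nat (degree g) * lead_coeff g \<in> s" using g(3) by simp
      moreover have "lead_coeff g \<in> polys (diff_vars n)" using gW polys_mono[OF W(1)] by blast
      ultimately show False
        using prime_inD(7)[OF sp subring_of_of_nat[OF subring_of_polys, of "degree g"]] g(2) char0[OF g(3)] by blast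
    next
      case False
      then have "alg_rel (polys W) (Var v) s h" using hW hs by (auto simp: alg_rel_def coeffs_in_def)
      then have "degree g \<le> degree h" by (rule min)
      moreover have "degree h < degree g"
        using g(3) by (intro degree_lessI) (auto simp: coeff_h coeff_eq_0)
      ultimately show False by simp
    qed
  qed
  moreover have "e + poly h (Var v) * Var (var_shift v) = D (poly g (Var v))"
    unfolding e_def h_def D_Var[symmetric] by (rule additive_leibniz_poly[of D, OF D_add D_mult, symmetric])
  then have "poly [:e, poly h (Var v):] (Var (var_shift v)) \<in> s"
    using sD g(1) by (simp add: alg_rel_def mult.commute)
  ultimately have "alg_rel (polys W') (Var (var_shift v)) s [:e, poly h (Var v):]"
    using eW' hW' by (auto simp: alg_rel_def coeffs_in_pCons coeffs_in_ring subring_of_polys intro!: exI[of _ "Suc 0"])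
  then show ?thesis by (auto simp: alg_dep_def)
qed

text \<open>By \<open>alg_dep_shift\<close>, for each indeterminate the orders at which it jumps
  form an initial segment. A full segment contributes \<open>Suc k\<close> to the count, and
  \<open>diff_trdeg\<close> counts these; every other segment contributes a bounded amount.\<close>

lemma jump_count_growth:
  assumes s: "diff_prime s" and char0: "\<And>k. k > 0 \<Longrightarrow> of_nat k \<notin> s"
  shows "diff_trdeg n s * Suc k \<le> jump_count n s k"
    and "\<exists>c. \<forall>k. jump_count n s k \<le> diff_trdeg n s * Suc k + c"
proof -
  let ?J = "jumps n s"
  let ?I = "{i. i < n \<and> (\<forall>j. (i, j) \<in> ?J)}"
  have down: "(i, k) \<in> ?J" if "(i, Suc k) \<in> ?J" for i k
  proof (rule ccontr)
    assume "(i, k) \<notin> ?J"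
    moreover have i: "(i, k) \<in> diff_vars n" using that by (auto simp: jumps_def diff_vars_def)
    ultimately have "alg_dep s (earlier n (i, k)) (i, k)" by (simp add: jumps_def)
    then have "alg_dep s (earlier n (var_shift (i, k))) (var_shift (i, k))"
      using earlier_shift[OF i] i by (intro alg_dep_shift[OF s char0]) (auto simp: earlier_def)
    then show False using that by (simp add: jumps_def var_shift_def)
  qed
  have down': "(i, j) \<in> ?J" if "(i, k) \<in> ?J" "j \<le> k" for i j k
    using that(2,1) by (induction rule: inc_induct) (auto intro: down)
  have count: "jump_count n s k = (\<Sum>i<n. card {j. j \<le> k \<and> (i, j) \<in> ?J})" for k
  proof -
    have "?J \<inter> diff_vars_upto n k = (SIGMA i:{..<n}. {j. j \<le> k \<and> (i, j) \<in> ?J})"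
      by (auto simp: diff_vars_upto_def)
    then show ?thesis by (simp add: jump_count_def)
  qed
  have split: "(\<Sum>i<n. f i) = (\<Sum>i\<in>?I. f i) + (\<Sum>i\<in>{..<n} - ?I. f i)" for f :: "nat \<Rightarrow> nat"
  proof -
    have "?I \<subseteq> {..<n}" by auto
    then show ?thesis using sum.subset_diff[of ?I "{..<n}" f] by simp
  qed
  have full: "(\<Sum>i\<in>?I. card {j. j \<le> k \<and> (i, j) \<in> ?J}) = diff_trdeg n s * Suc k" for k
  proof -
    have "(\<Sum>i\<in>?I. card {j. j \<le> k \<and> (i, j) \<in> ?J}) = (\<Sum>i\<in>?I. card {..k})"
      by (intro sum.cong arg_cong[of _ _ card]) auto
    then show ?thesis by (simp add: diff_trdeg_def)
  qed
  have eq: "jump_count n s k = diff_trdeg n s * Suc k + (\<Sum>i\<in>{..<n} - ?I. card {j. j \<le> k \<and> (i, j) \<in> ?J})" for k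
    using count[of k] split[of "\<lambda>i. card {j. j \<le> k \<and> (i, j) \<in> ?J}"] full[of k] by presburger
  show "diff_trdeg n s * Suc k \<le> jump_count n s k"
    unfolding eq by (rule le_add1)
  \<comment> \<open>The length of the initial segment for \<open>i\<close>, meaningful only if the
    segment is not full.\<close>
  define h where "h i = (LEAST j. (i, j) \<notin> ?J)" for i
  have "card {j. j \<le> k \<and> (i, j) \<in> ?J} \<le> h i" if "i \<in> {..<n} - ?I" for i k
  proof -
    have "\<exists>j. (i, j) \<notin> ?J" using that by blast
    then have "(i, h i) \<notin> ?J" unfolding h_def by (rule LeastI_ex)
    have "{j. j \<le> k \<and> (i, j) \<in> ?J} \<subseteq> {..<h i}"
    proof
      fix j assume "j \<in> {j. j \<le> k \<and> (i, j) \<in> ?J}"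
      then have "\<not> h i \<le> j" using down'[of i j "h i"] \<open>(i, h i) \<notin> ?J\<close> by blast
      then show "j \<in> {..<h i}" by simp
    qed
    then have "card {j. j \<le> k \<and> (i, j) \<in> ?J} \<le> card {..<h i}" by (intro card_mono) auto
    then show ?thesis by simp
  qed
  then have "jump_count n s k \<le> diff_trdeg n s * Suc k + (\<Sum>i\<in>{..<n} - ?I. h i)" for k
    unfolding eq by (intro add_left_mono sum_mono)
  then show "\<exists>c. \<forall>k. jump_count n s k \<le> diff_trdeg n s * Suc k + c" by blast
qed

end

text \<open>Otherwise every term has a strictly smaller later one, and by induction every term has
  arbitrarily large height.\<close>

lemma primes_decreasing_stabilize:
  assumes bound: "\<And>h I. ht_ge A h I \<Longrightarrow> h \<le> d"
    and r: "\<And>i. prime_in A (r i)" "decseq r"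
  obtains N where "\<And>i. i \<ge> N \<Longrightarrow> r i = r N"
proof (rule ccontr)
  assume "\<not> thesis"
  then have ex: "\<exists>i\<ge>N. r i \<noteq> r N" for N using that by blast
  have "ht_ge A h (r N)" for h N
  proof (induction h arbitrary: N)
    case (Suc h)
    obtain i where "i \<ge> N" "r i \<noteq> r N" using ex by blast
    then have "r i \<subset> r N" using decseqD[OF r(2)] by blast
    then show ?case using r(1)[of N] Suc.IH[of i] by auto
  qed (simp add: r(1))
  then show False using bound Suc_n_not_le_n by blast
qed

section \<open>Chains of differential primes under the Jaffard condition\<close>

locale jaffard_diff_setting = diff_setting +
  fixes d :: nat
  assumes dim_base: "krull_dim (ring_of_type_algebra :: 'a ring) = enat d"
    and dim: "\<And>N. krull_dim (poly_ring N :: ((nat \<Rightarrow>\<^sub>0 nat) \<Rightarrow>\<^sub>0 'a) ring) = enat d + enat N"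
    and char0: "\<And>r k. r \<in> diff_spec ring_of_type_algebra \<delta> \<Longrightarrow> k > 0 \<Longrightarrow> of_nat k \<notin> r"
begin

lemma char0_diff_prime: "diff_prime s \<Longrightarrow> k > 0 \<Longrightarrow> of_nat k \<notin> s"
  using char0[OF base_prime_diff_spec, of s k] by (simp add: base_prime_def)

lemma ht_le_base_dim: "ht_ge (UNIV :: 'a set) h I \<Longrightarrow> h \<le> d"
proof -
  assume h: "ht_ge (UNIV :: 'a set) h I"
  have "(ring_of_type_algebra :: 'a ring) = ring_of_type_algebra\<lparr>carrier := UNIV\<rparr>"
    by (simp add: ring_of_type_algebra_def)
  then show ?thesis using ht_le_krull_dim[OF _ h] dim_base by (simp add: subring_of_def)
qed

text \<open>An element separating two consecutive primes involves finitely many variables, so the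
  difference is visible at some finite order. At an order that serves the first \<open>l\<close>
  steps together, each step raises the count.\<close>

lemma jump_count_chain:
  assumes s: "\<And>i. diff_prime (s i)" "\<And>i. s (Suc i) \<subset> s i" and base: "\<And>i. base_prime (s i) = base_prime (s 0)"
  shows "\<exists>k. jump_count n (s 0) k + l \<le> jump_count n (s l) k"
proof -
  have pr: "prime_in (polys (diff_vars n)) (s i)" for i using s(1) by (simp add: diff_prime_def)
  have "\<exists>k. \<not> s i \<inter> polys (diff_vars_upto n k) \<subseteq> s (Suc i)" for i
  proof -
    obtain f where f: "f \<in> s i" "f \<notin> s (Suc i)" using s(2)[of i] by blast
    then have "f \<in> polys (diff_vars n)" using prime_inD(1)[OF pr] by blast
    then obtain W where W: "finite W" "W \<subseteq> diff_vars n" "f \<in> polys W" using polys_finite_support by blast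
    have "snd w \<le> Max (insert 0 (snd ` W))" if "w \<in> W" for w using W(1) that by (intro Max_ge) auto
    then have "W \<subseteq> diff_vars_upto n (Max (insert 0 (snd ` W)))"
      using W(2) by (force simp: diff_vars_def diff_vars_upto_def)
    then show ?thesis using f W(3) polys_mono by blast
  qed
  then obtain k where k: "\<And>i. \<not> s i \<inter> polys (diff_vars_upto n (k i)) \<subseteq> s (Suc i)" by metis
  \<comment> \<open>The inserted \<open>0\<close> keeps the maximum defined for
    \<open>l = 0\<close>.\<close>
  define K where "K = Max (insert 0 (k ` {..<l}))"
  have K: "\<not> s i \<inter> polys (diff_vars_upto n K) \<subseteq> s (Suc i)" if "i < l" for i
  proof -
    have "k i \<le> K" unfolding K_def using that by (intro Max_ge) auto
    then have "diff_vars_upto n (k i) \<subseteq> diff_vars_upto n K" by (auto simp: diff_vars_upto_def)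
    then show ?thesis using k[of i] polys_mono by blast
  qed
  have "jump_count n (s 0) K + i \<le> jump_count n (s i) K" if "i \<le> l" for i
    using that
  proof (induction i)
    case (Suc i)
    have "jump_count n (s i) K < jump_count n (s (Suc i)) K"
      by (rule jump_count_less[OF pr pr]) (use s(2)[of i] base[of i] base[of "Suc i"] K[of i] Suc.prems in auto)
    then show ?case using Suc by auto
  qed simp
  then show ?thesis by blast
qed

lemma diff_trdeg_le: "diff_trdeg n s \<le> n"
proof -
  have "diff_trdeg n s \<le> card {..<n}" unfolding diff_trdeg_def by (intro card_mono) auto
  then show ?thesis by simp
qed

text \<open>After the contractions have stabilized at \<open>N\<close>, some order \<open>k\<close>
  shows a growth of at least \<open>l\<close> between \<open>s N\<close> and
  \<open>s (N + l)\<close>, for any \<open>l\<close>. Passing from \<open>p\<close> to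
  \<open>s N\<close> and from \<open>s (N + l)\<close> to \<open>q\<close> loses at most
  \<open>d\<close> each. If the slope for \<open>q\<close> were at most that for \<open>p\<close>,
  the bounded error in the linear growth would contradict a large \<open>l\<close>.\<close>

lemma diff_trdeg_less:
  assumes p: "diff_prime p" and q: "diff_prime q"
    and chain: "inf_desc_chain {s. diff_prime s} p q s"
  shows "diff_trdeg n p < diff_trdeg n q"
proof (rule ccontr)
  assume "\<not> ?thesis"
  then have le: "diff_trdeg n q \<le> diff_trdeg n p" by simp
  have s: "\<And>i. diff_prime (s i)" "\<And>i. s (Suc i) \<subset> s i" "\<And>i. q \<subseteq> s i" "s 0 = p"
    using chain by (auto simp: inf_desc_chain_def)
  have pr: "prime_in (polys (diff_vars n)) f" if "diff_prime f" for f using that by (simp add: diff_prime_def)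
  have dec: "decseq s" by (intro decseq_SucI) (use s(2) in blast)
  then have dec': "decseq (\<lambda>i. base_prime (s i))" by (auto simp: decseq_def base_prime_def)
  obtain N where N: "\<And>i. i \<ge> N \<Longrightarrow> base_prime (s i) = base_prime (s N)"
  proof (rule primes_decreasing_stabilize[of UNIV d "\<lambda>i. base_prime (s i)"])
    show "h \<le> d" if "ht_ge (UNIV :: 'a set) h I" for h I using ht_le_base_dim[OF that] .
    show "prime_in UNIV (base_prime (s i))" for i by (rule base_prime_prime[OF pr[OF s(1)]])
  qed (rule dec', rule that)
  obtain c where c: "\<And>k. jump_count n q k \<le> diff_trdeg n q * Suc k + c"
    using jump_count_growth(2)[OF q char0_diff_prime[OF q]] by blast
  \<comment> \<open>One more than the total slack: \<open>d\<close> twice from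
    \<open>jump_count_le\<close>, and \<open>c\<close> from the growth bound for
    \<open>q\<close>.\<close>
  define l where "l = Suc (2 * d + c)"
  obtain k where k: "jump_count n (s N) k + l \<le> jump_count n (s (N + l)) k"
    using jump_count_chain[of "\<lambda>i. s (N + i)" l] s(1,2) N[of "N + _"] by auto
  have "s N \<subseteq> p" using decseqD[OF dec, of 0 N] s(4) by auto
  have "diff_trdeg n p * Suc k \<le> jump_count n p k"
    by (rule jump_count_growth(1)[OF p char0_diff_prime[OF p]])
  also have "\<dots> \<le> jump_count n (s N) k + d"
    by (rule jump_count_le[OF dim pr[OF p] pr[OF s(1)] \<open>s N \<subseteq> p\<close>])
  finally have "diff_trdeg n p * Suc k + l \<le> jump_count n (s (N + l)) k + d" using k by simp
  also have "\<dots> \<le> jump_count n q k + d + d"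
    using jump_count_le[OF dim pr[OF s(1)] pr[OF q] s(3)] by simp
  also have "\<dots> \<le> diff_trdeg n q * Suc k + c + d + d" using c[of k] by simp
  also have "\<dots> \<le> diff_trdeg n p * Suc k + c + d + d" using mult_right_mono[OF le, of "Suc k"] by simp
  finally show False by (simp add: l_def)
qed

end

section \<open>Characteristic zero from standardness\<close>

text \<open>The hypothesis concerns a quotient of a localization, so the sums there are computed
  explicitly: multiples of the unit are the cosets of \<open>of_nat j\<close>. If
  \<open>of_nat k\<close> were in \<open>P\<close>, then \<open>k\<close> times the unit would be
  the zero coset.\<close>

lemma standard_of_nat_notin:
  fixes \<delta> :: "'a \<Rightarrow> 'a::comm_ring_1"
  assumes std: "standard ring_of_type_algebra \<delta>" and P: "P \<in> diff_spec ring_of_type_algebra \<delta>" and k: "k > 0"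
  shows "of_nat k \<notin> P"
proof
  assume kP: "of_nat k \<in> P"
  let ?R = "ring_of_type_algebra :: 'a ring"
  have "(ring_of_type_algebra :: 'a ring) = ring_of_type_algebra\<lparr>carrier := UNIV\<rparr>"
    by (simp add: ring_of_type_algebra_def)
  then have Pp: "prime_in UNIV P"
    using P primeideal_iff_prime_in[of UNIV P] by (auto simp: diff_spec_def subring_of_def)
  note pP = prime_inD[OF Pp]
  have nP: "s * t \<notin> P" if "s \<notin> P" "t \<notin> P" for s t using pP(7)[of s t] that by blast
  define rel where "rel = loc_rel ?R P"
  have rel: "((a, s), (b, t)) \<in> rel \<longleftrightarrow> s \<notin> P \<and> t \<notin> P \<and> (\<exists>u. u \<notin> P \<and> u * (t * a) = u * (s * b))" for a s b t
    by (auto simp: rel_def loc_rel_def ring_of_type_algebra_def)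
  have equiv: "equiv (UNIV \<times> (- P)) rel"
  proof (rule equivI)
    show "rel \<subseteq> (UNIV \<times> (- P)) \<times> (UNIV \<times> (- P))" by (auto simp: rel)
    show "refl_on (UNIV \<times> (- P)) rel" using pP(3) by (auto simp: refl_on_def rel)
    show "sym rel"
    proof (rule symI)
      fix x y assume "(x, y) \<in> rel"
      moreover obtain a s b t where xy: "x = (a, s)" "y = (b, t)" by (metis surj_pair)
      ultimately obtain u where "s \<notin> P" "t \<notin> P" "u \<notin> P" "u * (t * a) = u * (s * b)" by (auto simp: rel)
      then show "(y, x) \<in> rel" unfolding xy rel by metis
    qed
    show "trans rel"
    proof (rule transI)
      fix x y z assume "(x, y) \<in> rel" "(y, z) \<in> rel"
      moreover obtain a s b t c v where xyz: "x = (a, s)" "y = (b, t)" "z = (c, v)" by (metis surj_pair)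
      ultimately obtain u w where *: "s \<notin> P" "t \<notin> P" "v \<notin> P" "u \<notin> P" "w \<notin> P"
        "u * (t * a) = u * (s * b)" "w * (v * b) = w * (t * c)"
        by (auto simp: rel)
      have "(u * w * t) * (v * a) = (w * v) * (u * (t * a))" by (simp add: ac_simps)
      also have "\<dots> = (u * s) * (w * (v * b))" by (simp only: *(6)) (simp add: ac_simps)
      also have "\<dots> = (u * w * t) * (s * c)" by (simp only: *(7)) (simp add: ac_simps)
      finally show "(x, z) \<in> rel" unfolding xyz rel
        by (intro conjI exI[of _ "u * w * t"] nP *)
    qed
  qed
  define fr where "fr a s = rel `` {(a, s)}" for a s
  have fr: "frac_at ?R P = fr" by (simp add: fun_eq_iff frac_at_def fr_def rel_def)
  have fr_eq: "fr a s = fr b t" if "((a, s), (b, t)) \<in> rel" for a s b t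
    unfolding fr_def using equiv_class_eq[OF equiv that] .
  let ?L = "localization_at ?R P"
  \<comment> \<open>The sum is defined as a union over all pairs of representatives; every pair
    yields the same class, so the union collapses to it.\<close>
  have plus: "fr a s \<oplus>\<^bsub>?L\<^esub> fr b t = fr (t * a + s * b) (s * t)" if st: "s \<notin> P" "t \<notin> P" for a s b t
  proof -
    have "fr (t' * a' + s' * b') (s' * t') = fr (t * a + s * b) (s * t)"
      if "(a', s') \<in> fr a s" "(b', t') \<in> fr b t" for a' s' b' t'
    proof -
      from that obtain u w where *: "s' \<notin> P" "t' \<notin> P" "u \<notin> P" "w \<notin> P"
        "u * (s' * a) = u * (s * a')" "w * (t' * b) = w * (t * b')"
        by (auto simp: fr_def rel)
      have "(u * w) * ((s' * t') * (t * a + s * b)) = (w * t' * t) * (u * (s' * a)) + (u * s * s') * (w * (t' * b))"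
        by (simp add: algebra_simps)
      also have "\<dots> = (u * w) * ((s * t) * (t' * a' + s' * b'))"
        by (simp only: *(5,6)) (simp add: algebra_simps)
      finally have "((t * a + s * b, s * t), (t' * a' + s' * b', s' * t')) \<in> rel"
        unfolding rel by (intro conjI exI[of _ "u * w"] nP * st)
      then show ?thesis by (rule fr_eq[symmetric])
    qed
    moreover have "(a, s) \<in> fr a s" "(b, t) \<in> fr b t"
      using st pP(3) by (auto simp: fr_def rel)
    ultimately have "(\<Union>(a', s')\<in>fr a s. \<Union>(b', t')\<in>fr b t. fr (t' * a' + s' * b') (s' * t')) = fr (t * a + s * b) (s * t)"
      by fast
    then show ?thesis by (simp add: localization_at_def fr) (simp add: ring_of_type_algebra_def)
  qed
  \<comment> \<open>\<open>C b\<close> is the coset of \<open>b / 1\<close> modulo the maximal ideal of the localization.\<close>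
  define C where "C b = {fr x s | x s. s \<notin> P \<and> x - s * b \<in> P}" for b
  have fr_C: "fr b 1 \<in> C b" for b unfolding C_def using pP(2,3) by fastforce
  have C_plus: "x \<oplus>\<^bsub>?L\<^esub> y \<in> C (a + b)" if xy: "x \<in> C a" "y \<in> C b" for x y a b
  proof -
    obtain x' s y' t where x: "x = fr x' s" "s \<notin> P" "x' - s * a \<in> P"
      and y: "y = fr y' t" "t \<notin> P" "y' - t * b \<in> P"
      using xy by (auto simp: C_def)
    have "t * (x' - s * a) + s * (y' - t * b) \<in> P" using x y by (intro pP(4,5)) auto
    then have "(t * x' + s * y') - (s * t) * (a + b) \<in> P" by (simp add: algebra_simps)
    then show ?thesis unfolding x(1) y(1) plus[OF x(2) y(2)] C_def using nP[OF x(2) y(2)] by blast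
  qed
  \<comment> \<open>For z = x / s the first summand is (x - s b) / s, with the same
    denominator.\<close>
  have C_split: "\<exists>x\<in>C a. z = x \<oplus>\<^bsub>?L\<^esub> fr b 1" if z: "z \<in> C (a + b)" for z a b
  proof -
    obtain x s where x: "z = fr x s" "s \<notin> P" "x - s * (a + b) \<in> P" using z by (auto simp: C_def)
    have "(x - s * b) - s * a \<in> P" using x(3) by (simp add: algebra_simps)
    then have "fr (x - s * b) s \<in> C a" using x(2) by (auto simp: C_def)
    moreover have "z = fr (x - s * b) s \<oplus>\<^bsub>?L\<^esub> fr b 1" by (simp add: plus[OF x(2) pP(3)] x(1))
    ultimately show ?thesis by blast
  qed
  have set_plus: "C a <+>\<^bsub>?L\<^esub> C b = C (a + b)" for a b
  proof (rule equalityI; rule subsetI)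
    fix z assume "z \<in> C a <+>\<^bsub>?L\<^esub> C b"
    then obtain x y where "x \<in> C a" "y \<in> C b" "z = x \<oplus>\<^bsub>?L\<^esub> y" unfolding set_add_def' by blast
    then show "z \<in> C (a + b)" by (simp only: C_plus)
  next
    fix z assume "z \<in> C (a + b)"
    from C_split[OF this] obtain x where "x \<in> C a" "z = x \<oplus>\<^bsub>?L\<^esub> fr b 1" ..
    then show "z \<in> C a <+>\<^bsub>?L\<^esub> C b" unfolding set_add_def' using fr_C[of b] by blast
  qed
  let ?K = "residue_field ?R P"
  have ideal: "{frac_at ?R P a s | a s. a \<in> P \<and> s \<in> carrier ?R - P} = C 0"
  proof -
    have "carrier ?R = UNIV" by (simp add: ring_of_type_algebra_def)
    then show ?thesis unfolding fr C_def by auto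
  qed
  have K: "?K = ?L Quot C 0" unfolding residue_field_def ideal ..
  have one_L: "\<one>\<^bsub>?L\<^esub> = fr 1 1"
    by (simp add: localization_at_def fr) (simp add: ring_of_type_algebra_def)
  have "C 0 +>\<^bsub>?L\<^esub> fr 1 1 = C 1"
    unfolding a_r_coset_def' using C_plus[OF _ fr_C, of _ 0 1] C_split[of _ 0 1] by (simp only: add_0) blast
  then have one_K: "\<one>\<^bsub>?K\<^esub> = C 1" by (simp add: K FactRing_def one_L)
  have "add_pow ?K j \<one>\<^bsub>?K\<^esub> = C (of_nat j)" for j :: nat
  proof (induction j)
    case 0
    show ?case by (simp add: add_pow_def nat_pow_def K FactRing_def)
  next
    case (Suc j)
    have "add_pow ?K (Suc j) \<one>\<^bsub>?K\<^esub> = add_pow ?K j \<one>\<^bsub>?K\<^esub> \<oplus>\<^bsub>?K\<^esub> \<one>\<^bsub>?K\<^esub>"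
      by (simp add: add_pow_def nat_pow_def)
    also have "\<dots> = C (of_nat j) \<oplus>\<^bsub>?K\<^esub> C 1" unfolding Suc.IH unfolding one_K ..
    also have "\<dots> = C (of_nat j) <+>\<^bsub>?L\<^esub> C 1" by (simp add: K FactRing_def)
    also have "\<dots> = C (of_nat (Suc j))" by (simp add: set_plus add.commute)
    finally show ?case .
  qed
  moreover have "C (of_nat k) = C 0"
  proof -
    have "x - s * of_nat k \<in> P \<longleftrightarrow> x - s * 0 \<in> P" for x s
      using pP(4)[of "x - s * of_nat k" "s * of_nat k"] pP(4)[of x "- s * of_nat k"] pP(5)[OF UNIV_I kP, of s] pP(5)[OF UNIV_I kP, of "- s"] by auto
    then show ?thesis by (simp only: C_def)
  qed
  moreover have "\<zero>\<^bsub>?K\<^esub> = C 0" by (simp add: K FactRing_def)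
  ultimately have "add_pow ?K k \<one>\<^bsub>?K\<^esub> = \<zero>\<^bsub>?K\<^esub>" by simp
  then show False using std P k unfolding standard_def by blast
qed

section \<open>Gap measures, type and dimension\<close>

text \<open>Replaces the definite description by the recursive \<open>gap_ge\<close>, through which
  the later estimates of gap measures pass.\<close>

lemma gap_measure_ge_iff:
  assumes "p \<in> F" "q \<in> F" "q \<subseteq> p"
  shows "enat k \<le> gap_measure F p q \<longleftrightarrow> gap_ge F k p q"
proof -
  have "is_gap_measure F (gap_measure F)"
    using theI'[OF gap_measure_ex1[of F]] unfolding gap_measure_def by blast
  from is_gap_measure_iff_gap_ge[OF this assms] show ?thesis .
qed

lemma increasing_nat_ge: "(\<And>i. i < k \<Longrightarrow> f i < f (Suc i)) \<Longrightarrow> k \<le> f k" for f :: "nat \<Rightarrow> nat"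
proof (induction k)
  case (Suc k)
  then show ?case using Suc.IH by (metis Suc_leI le_less_trans less_Suc_eq)
qed simp

section \<open>Differential primes generated by derivatives of indeterminates\<close>

context diff_setting
begin

text \<open>Checked on single terms. A coefficient in \<open>r\<close> keeps every new coefficient
  in \<open>r\<close>. Otherwise the monomial contains some variable from \<open>Z\<close>:
  differentiating another variable leaves it in place, and differentiating it produces its shift,
  which is again in \<open>Z\<close>.\<close>

lemma vars_ideal_diff_prime:
  assumes r: "r \<in> diff_spec ring_of_type_algebra \<delta>" and Z: "var_shift ` Z \<subseteq> Z"
  shows "diff_prime (vars_ideal (diff_vars n) r Z)"
proof -
  let ?I = "vars_ideal (diff_vars n) r Z"
  have rp: "prime_in UNIV r" and r\<delta>: "\<And>x. x \<in> r \<Longrightarrow> \<delta> x \<in> r"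
    using r by (auto simp: base_diff_spec_iff)
  have "D f \<in> ?I" if f: "f \<in> ?I" for f
  proof -
    have "D (Poly_Mapping.single m (Poly_Mapping.lookup f m)) \<in> ?I" if m: "m \<in> Poly_Mapping.keys f" for m
      unfolding D_single case_prod_unfold
    proof (intro vars_ideal_add[OF rp] vars_ideal_sum[OF rp] single_in_vars_ideal[OF rp])
      note mf = vars_ideal_term[OF rp f m]
      show "Poly_Mapping.keys m \<subseteq> diff_vars n" by (rule mf(1))
      show "\<delta> (Poly_Mapping.lookup f m) \<in> r \<or> Poly_Mapping.keys m \<inter> Z \<noteq> {}" using mf(2) r\<delta> by blast
      fix v assume v: "v \<in> Poly_Mapping.keys m"
      let ?m = "m - Poly_Mapping.single (fst v, snd v) 1 + Poly_Mapping.single (fst v, Suc (snd v)) 1"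
      have sub: "Poly_Mapping.keys (m - Poly_Mapping.single (fst v, snd v) 1) \<subseteq> Poly_Mapping.keys m"
        by (auto simp: in_keys_iff lookup_minus)
      have "(fst v, Suc (snd v)) \<in> diff_vars n" using v mf(1) by (auto simp: diff_vars_def)
      then show "Poly_Mapping.keys ?m \<subseteq> diff_vars n" using sub mf(1) by (auto simp: keys_add_nat)
      show "of_nat (Poly_Mapping.lookup m (fst v, snd v)) * Poly_Mapping.lookup f m \<in> r \<or> Poly_Mapping.keys ?m \<inter> Z \<noteq> {}"
      proof (cases "Poly_Mapping.lookup f m \<in> r")
        case True
        then show ?thesis using prime_inD(5)[OF rp] by blast
      next
        case False
        then obtain w where w: "w \<in> Poly_Mapping.keys m" "w \<in> Z" using mf(2) by blast
        show ?thesis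
        proof (cases "w = v")
          case True
          then have "var_shift v \<in> Z" using w(2) Z by blast
          then show ?thesis by (auto simp: keys_add_nat var_shift_def)
        next
          case False
          then have "w \<in> Poly_Mapping.keys ?m"
            using w(1) by (auto simp: in_keys_iff lookup_add lookup_minus lookup_single when_def)
          then show ?thesis using w(2) by blast
        qed
      qed
    qed
    then have "D (\<Sum>m\<in>Poly_Mapping.keys f. Poly_Mapping.single m (Poly_Mapping.lookup f m)) \<in> ?I"
      unfolding D_sum by (rule vars_ideal_sum[OF rp])
    then show ?thesis by (simp flip: poly_mapping_sum_single)
  qed
  then show ?thesis using vars_ideal_prime[OF rp] by (simp add: diff_prime_def)
qed

lemma vars_ideal_strict_mono:
  assumes r: "r \<in> diff_spec ring_of_type_algebra \<delta>" and Z: "Z \<subseteq> Z'" "v \<in> diff_vars n" "v \<in> Z'" "v \<notin> Z"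
  shows "vars_ideal (diff_vars n) r Z \<subset> vars_ideal (diff_vars n) r Z'"
proof -
  have rp: "prime_in UNIV r" using r by (auto simp: base_diff_spec_iff)
  have "vars_ideal (diff_vars n) r Z \<subseteq> vars_ideal (diff_vars n) r Z'" using Z(1) by (auto simp: vars_ideal_def)
  moreover have "Var v \<in> vars_ideal (diff_vars n) r Z'"
    using Z by (intro single_in_vars_ideal[OF rp]) auto
  moreover have "Var v \<notin> vars_ideal (diff_vars n) r Z"
    using Z(4) prime_inD(3)[OF rp] by (auto simp: vars_ideal_def intro!: exI[of _ "Poly_Mapping.single v (Suc 0)"])
  ultimately show ?thesis by blast
qed

text \<open>The infinite chain between the two ideals kills, besides the indeterminates after
  \<open>i\<close>, only the derivatives of the indeterminate \<open>i\<close> of order at least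
  \<open>j\<close>, for increasing \<open>j\<close>.\<close>

lemma gap_ge_vars_ideal:
  assumes r: "r \<in> diff_spec ring_of_type_algebra \<delta>" and i: "i < n"
  shows "vars_ideal (diff_vars n) r ({Suc i..<n} \<times> UNIV) \<subset> vars_ideal (diff_vars n) r ({i..<n} \<times> UNIV)"
    and "gap_ge {s. diff_prime s} 1 (vars_ideal (diff_vars n) r ({i..<n} \<times> UNIV))
           (vars_ideal (diff_vars n) r ({Suc i..<n} \<times> UNIV))"
proof -
  let ?I = "vars_ideal (diff_vars n) r"
  let ?Z = "\<lambda>j. ({Suc i..<n} \<times> UNIV) \<union> {i} \<times> {j..} :: (nat \<times> nat) set"
  have Z0: "?Z 0 = {i..<n} \<times> UNIV" using i by auto
  show less: "?I ({Suc i..<n} \<times> UNIV) \<subset> ?I ({i..<n} \<times> UNIV)"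
    using i by (intro vars_ideal_strict_mono[OF r, of _ _ "(i, 0)"]) (auto simp: diff_vars_def)
  have "diff_prime (?I (?Z j))" for j
    by (rule vars_ideal_diff_prime[OF r]) (auto simp: var_shift_def)
  moreover have "?I ({Suc i..<n} \<times> UNIV) \<subseteq> ?I (?Z j)" for j
    by (auto simp: vars_ideal_def)
  moreover have "?I (?Z (Suc j)) \<subset> ?I (?Z j)" for j
    using i by (intro vars_ideal_strict_mono[OF r, of _ _ "(i, j)"]) (auto simp: diff_vars_def)
  ultimately have "inf_desc_chain {s. diff_prime s} (?I ({i..<n} \<times> UNIV)) (?I ({Suc i..<n} \<times> UNIV)) (\<lambda>j. ?I (?Z j))"
    unfolding inf_desc_chain_def Z0 by blast
  then show "gap_ge {s. diff_prime s} 1 (?I ({i..<n} \<times> UNIV)) (?I ({Suc i..<n} \<times> UNIV))"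
    using less by auto
qed

end

section \<open>Type and dimension of the differential polynomial ring\<close>

context jaffard_diff_setting
begin

abbreviation "F \<equiv> {s. diff_prime s}"

lemma gap_ge_1_trdeg:
  assumes "p \<in> F" "q \<in> F" "gap_ge F 1 p q"
  shows "diff_trdeg n p < diff_trdeg n q"
proof -
  obtain s where "inf_desc_chain F p q s" using assms(3) by auto
  then show ?thesis using assms(1,2) diff_trdeg_less by blast
qed

text \<open>Such a gap contains an infinite chain whose consecutive gaps are positive, along which
  \<open>diff_trdeg\<close> would increase strictly beyond its bound \<open>n\<close>.\<close>

lemma not_gap_ge_2: "\<not> gap_ge F 2 p q"
proof
  assume "gap_ge F 2 p q"
  then obtain s where s: "inf_desc_chain F p q s" "\<forall>i\<ge>1. gap_ge F 1 (s (i - 1)) (s i)"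
    unfolding numeral_2_eq_2 One_nat_def gap_ge.simps(2)[of F "Suc 0"] by blast
  have "diff_trdeg n (s i) < diff_trdeg n (s (Suc i))" for i
  proof (rule gap_ge_1_trdeg)
    show "gap_ge F 1 (s i) (s (Suc i))" using s(2)[rule_format, of "Suc i"] by simp
  qed (use s(1) in \<open>auto simp: inf_desc_chain_def\<close>)
  then have "Suc n \<le> diff_trdeg n (s (Suc n))" by (intro increasing_nat_ge)
  then show False using diff_trdeg_le[of "s (Suc n)"] by simp
qed

lemma diff_spec_eq: "diff_spec (diff_poly_ring n) D = F"
  using diff_spec_iff by blast

lemma gap_measure_le_1:
  assumes "p \<in> F" "q \<in> F" "q \<subseteq> p"
  shows "gap_measure F p q \<le> 1"
proof -
  have "\<not> enat 2 \<le> gap_measure F p q" using gap_measure_ge_iff[OF assms] not_gap_ge_2 by blast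
  then show ?thesis by (cases "gap_measure F p q") (auto simp: one_enat_def)
qed

lemma gap_vars_ideal:
  assumes r: "r \<in> diff_spec ring_of_type_algebra \<delta>"
  shows "vars_ideal (diff_vars n) r ({i..<n} \<times> UNIV) \<in> F"
    and "i < n \<Longrightarrow> gap_measure F (vars_ideal (diff_vars n) r ({i..<n} \<times> UNIV))
           (vars_ideal (diff_vars n) r ({Suc i..<n} \<times> UNIV)) = 1"
proof -
  show F: "vars_ideal (diff_vars n) r ({i..<n} \<times> UNIV) \<in> F" for i
  proof -
    have "var_shift ` ({i..<n} \<times> UNIV) \<subseteq> {i..<n} \<times> UNIV" by (auto simp: var_shift_def)
    then show ?thesis using vars_ideal_diff_prime[OF r] by blast
  qed
  assume i: "i < n"
  note g = gap_ge_vars_ideal[OF r i]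
  show "gap_measure F (vars_ideal (diff_vars n) r ({i..<n} \<times> UNIV))
           (vars_ideal (diff_vars n) r ({Suc i..<n} \<times> UNIV)) = 1"
  proof (rule antisym)
    show "1 \<le> gap_measure F (vars_ideal (diff_vars n) r ({i..<n} \<times> UNIV))
           (vars_ideal (diff_vars n) r ({Suc i..<n} \<times> UNIV))"
      using gap_measure_ge_iff[OF F F psubset_imp_subset[OF g(1)], of 1] g(2) by (simp add: one_enat_def)
  qed (rule gap_measure_le_1[OF F F psubset_imp_subset[OF g(1)]])
qed

lemma diff_type_diff_poly_ring:
  assumes r: "r \<in> diff_spec ring_of_type_algebra \<delta>"
  shows "diff_type (diff_poly_ring n) D = 1"
  unfolding diff_type_def diff_spec_eq
proof (rule antisym)
  show "Sup {gap_measure F p q |p q. p \<in> F \<and> q \<in> F \<and> q \<subseteq> p} \<le> 1"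
    by (rule Sup_least) (use gap_measure_le_1 in blast)
  \<comment> \<open>The gap 1 is attained by releasing the indeterminate with index 0, which exists
    because \<open>n\<close> is positive.\<close>
  have "gap_measure F (vars_ideal (diff_vars n) r ({0..<n} \<times> UNIV)) (vars_ideal (diff_vars n) r ({Suc 0..<n} \<times> UNIV))
      \<in> {gap_measure F p q |p q. p \<in> F \<and> q \<in> F \<and> q \<subseteq> p}"
    using gap_vars_ideal(1)[OF r, of 0] gap_vars_ideal(1)[OF r, of "Suc 0"] gap_ge_vars_ideal(1)[OF r n_pos] by blast
  from Sup_upper[OF this] show "1 \<le> Sup {gap_measure F p q |p q. p \<in> F \<and> q \<in> F \<and> q \<subseteq> p}"
    using gap_vars_ideal(2)[OF r n_pos] by simp
qed

text \<open>From above, \<open>diff_trdeg\<close> increases strictly along a chain of gaps 1 and is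
  at most \<open>n\<close>. From below, the indeterminates are released one after another.\<close>

lemma diff_dim_diff_poly_ring:
  assumes r: "r \<in> diff_spec ring_of_type_algebra \<delta>"
  shows "diff_dim (diff_poly_ring n) D = enat n"
  unfolding diff_dim_def diff_type_diff_poly_ring[OF r] diff_spec_eq
proof (rule antisym)
  show "Sup {enat k |k. \<exists>p. (\<forall>i\<le>k. p i \<in> F) \<and> (\<forall>i<k. p (Suc i) \<subset> p i) \<and>
      (\<forall>i\<in>{1..k}. gap_measure F (p (i - 1)) (p i) = 1)} \<le> enat n"
  proof (rule Sup_least, clarsimp simp del: One_nat_def)
    fix k p assume p: "\<forall>i\<le>k. diff_prime (p i)" "\<forall>i<k. p (Suc i) \<subset> p i"
      "\<forall>i\<in>{1..k}. gap_measure F (p (i - 1)) (p i) = 1"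
    have "diff_trdeg n (p i) < diff_trdeg n (p (Suc i))" if i: "i < k" for i
    proof (rule gap_ge_1_trdeg)
      show pi: "p i \<in> F" "p (Suc i) \<in> F" using p(1) i by auto
      have "gap_measure F (p i) (p (Suc i)) = 1" using p(3)[rule_format, of "Suc i"] i by simp
      then show "gap_ge F 1 (p i) (p (Suc i))"
        using gap_measure_ge_iff[OF pi psubset_imp_subset[OF p(2)[rule_format, OF i]], of 1] by (simp add: one_enat_def)
    qed
    then have "k \<le> diff_trdeg n (p k)" by (rule increasing_nat_ge)
    then show "k \<le> n" using diff_trdeg_le[of "p k"] by simp
  qed
  \<comment> \<open>\<open>?p 0\<close> contains all variables and \<open>?p n\<close> is generated
    by \<open>r\<close> alone, since the index interval is then empty; this gives exactly
    \<open>n\<close> steps.\<close>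
  let ?p = "\<lambda>i. vars_ideal (diff_vars n) r ({i..<n} \<times> UNIV)"
  have "gap_measure F (?p (i - 1)) (?p i) = 1" if "i \<in> {1..n}" for i
    using gap_vars_ideal(2)[OF r, of "i - 1"] that by (cases i) auto
  then have "(\<forall>i\<le>n. ?p i \<in> F) \<and> (\<forall>i<n. ?p (Suc i) \<subset> ?p i) \<and>
      (\<forall>i\<in>{1..n}. gap_measure F (?p (i - 1)) (?p i) = 1)"
    using gap_vars_ideal(1)[OF r] gap_ge_vars_ideal(1)[OF r] by blast
  then show "enat n \<le> Sup {enat k |k. \<exists>p. (\<forall>i\<le>k. p i \<in> F) \<and> (\<forall>i<k. p (Suc i) \<subset> p i) \<and>
      (\<forall>i\<in>{1..k}. gap_measure F (p (i - 1)) (p i) = 1)}"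
    by (intro Sup_upper CollectI exI[of _ n] exI[of _ ?p] conjI[OF refl])
qed

end

text \<open>Finite Krull dimension makes descending sequences of primes stabilize, so no gap in the
  ground ring is positive.\<close>

lemma diff_type_eq_0:
  fixes \<delta> :: "'a \<Rightarrow> 'a::comm_ring_1"
  assumes "krull_dim (ring_of_type_algebra :: 'a ring) = enat d"
  shows "diff_type ring_of_type_algebra \<delta> = 0"
proof -
  let ?F = "diff_spec ring_of_type_algebra \<delta>"
  have R: "(ring_of_type_algebra :: 'a ring) = ring_of_type_algebra\<lparr>carrier := UNIV\<rparr>"
    by (simp add: ring_of_type_algebra_def)
  have S: "subring_of (UNIV :: 'a set)" by (simp add: subring_of_def)
  have bound: "h \<le> d" if "ht_ge (UNIV :: 'a set) h I" for h I
    using ht_le_krull_dim[OF S that] R assms by simp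
  have "gap_measure ?F p q = 0" if pq: "p \<in> ?F" "q \<in> ?F" "q \<subseteq> p" for p q
  proof (rule ccontr)
    assume "gap_measure ?F p q \<noteq> 0"
    then have "enat 1 \<le> gap_measure ?F p q" by (cases "gap_measure ?F p q") (auto simp: zero_enat_def)
    then have "gap_ge ?F (Suc 0) p q" using gap_measure_ge_iff[OF pq, of 1] by simp
    then obtain s where s: "inf_desc_chain ?F p q s" by auto
    have pr: "prime_in UNIV (s i)" for i
      using s primeideal_iff_prime_in[OF S, of "s i"] R by (auto simp: inf_desc_chain_def diff_spec_def)
    have dec: "decseq s" by (intro decseq_SucI) (use s in \<open>auto simp: inf_desc_chain_def\<close>)
    obtain N where N: "\<And>i. i \<ge> N \<Longrightarrow> s i = s N"
      by (rule primes_decreasing_stabilize[of UNIV d s, OF bound pr dec]) (assumption, rule that)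
    have "s (Suc N) = s N" by (rule N) simp
    moreover have "s (Suc N) \<subset> s N" using s by (auto simp: inf_desc_chain_def)
    ultimately show False by simp
  qed
  then have "diff_type ring_of_type_algebra \<delta> \<le> 0"
    unfolding diff_type_def by (intro Sup_least) auto
  then show ?thesis by simp
qed

theorem corollary31:
  fixes \<delta> :: "'a \<Rightarrow> 'a::comm_ring_1"
  assumes "derivation ring_of_type_algebra \<delta>"
    and "diff_spec ring_of_type_algebra \<delta> \<noteq> {}"
    and "standard ring_of_type_algebra \<delta>"
    and "jaffard TYPE('a)"
  shows "J_ring \<delta>"
proof -
  obtain r where r: "r \<in> diff_spec ring_of_type_algebra \<delta>" using assms(2) by blast
  obtain d where d: "krull_dim (ring_of_type_algebra :: 'a ring) = enat d"
    using assms(4) unfolding jaffard_def by (metis less_infinityE)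
  have "diff_type (diff_poly_ring n) (diff_poly_deriv \<delta>) = 1 \<and> diff_dim (diff_poly_ring n) (diff_poly_deriv \<delta>) = enat n"
    if n: "n > 0" for n
  proof -
    interpret jaffard_diff_setting \<delta> n d
    proof
      show "\<delta> (x + y) = \<delta> x + \<delta> y" "\<delta> (x * y) = \<delta> x * y + x * \<delta> y" for x y
        using assms(1) by (auto simp: derivation_def ring_of_type_algebra_def)
      show "krull_dim (poly_ring N :: ((nat \<Rightarrow>\<^sub>0 nat) \<Rightarrow>\<^sub>0 'a) ring) = enat d + enat N" for N
        using assms(4) d by (simp add: jaffard_def)
      show "of_nat k \<notin> s" if "s \<in> diff_spec ring_of_type_algebra \<delta>" "k > 0" for s k
        by (rule standard_of_nat_notin[OF assms(3) that])
    qed (rule n, rule d)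
    show ?thesis using diff_type_diff_poly_ring[OF r] diff_dim_diff_poly_ring[OF r] by blast
  qed
  then show ?thesis
    \<comment> \<open>Type 0 is below 1, so of the three clauses on the dimension only the first has
      to be met.\<close>
    unfolding J_ring_def Let_def diff_type_eq_0[OF d] by (simp add: max_def)
qed

end
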